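(* Let $\kappa \geq 1$. For all $x \in \mathbb{R}$ and $n \in \{1,2,3,\dots\}$, the estimates \begin{align*} |\psi_n(x;V)| &\lesssim_{\bar\kappa,\alpha} \frac{1}{|\{V \leq E_n(V)\}|^{1/2}} \min \{ n^{2\alpha/3}, |1-V(x)/E_n(V)|^{-\alpha} \} , \\ |\psi_n'(x;V)| &\lesssim_{\bar\kappa,\alpha} \frac{E_n(V)^{1/2}}{|\{V \leq E_n(V)\}|^{1/2}} \max \{ n^{(2\alpha-1)/3}, (1-V(x)/E_n(V))_+^{1/2-\alpha} \} \end{align*} hold in the following cases: (i) with $\bar\kappa=\kappa$ and $\alpha=1/2$, whenever $V \in \mathcal{P}_1(\kappa)$; (ii) with $\bar\kappa=(\kappa,\omega)$ and $\alpha \in (1/4,1/2)$, whenever $\omega$ is a modulus of continuity and $V \in \mathcal{P}_{1,\mathrm{uc}}(\kappa,\omega)$; (iii) with $\bar\kappa=\kappa$ and $\alpha = 1/4$, whenever $V \in \mathcal{P}_{1,\mathrm{cv}}(\kappa)$; (iv) with $\bar\kappa=\kappa$ and $\alpha = 1/4$, whenever $V \in \mathcal{P}_3(\kappa)$.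
   Context: $A \lesssim_{s} B$ means $A \leq C B$ with a positive constant $C$ depending only on the parameters $s$ (in particular, here, not on the specific $V$ in the class, nor on $n$ or $x$). $|S|$ is the Lebesgue measure of $S \subseteq \mathbb{R}$, $\{V \leq E\} = \{x \in \mathbb{R} : V(x) \leq E\}$, and $u_+ = \max\{u,0\}$. A negative power of $0$ is $+\infty$. Classes of potentials, for $\kappa \geq 1$: - $\mathcal{P}_1(\kappa)$ is the class of non-identically zero continuous functions $V : \mathbb{R} \to [0,\infty)$ which are $C^1$ on $\mathbb{R}\setminus\{0\}$ and such that $\kappa^{-1} V(x) \leq x V'(x) \leq \kappa V(x)$ and $V(-x) \leq \kappa V(x)$ for all $x \neq 0$. - A modulus of continuity is a function $\omega : [0,\infty] \to [0,\infty]$ with $\lim_{t \to 0} \omega(t) = 0$. $\mathcal{P}_{1,\mathrm{uc}}(\kappa,\omega)$ is the class of $V \in \mathcal{P}_1(\kappa)$ such that $|\log (V'(\pm e^{t}) /V'(\pm e^{t'}))| \leq \omega(|t-t'|)$ for all $t,t' \in \mathbb{R}$ (for each choice of sign, the same in numerator and denominator). - $\mathcal{P}_{1,\mathrm{cv}}(\kappa)$ is the class of convex $V \in \mathcal{P}_1(\kappa)$. - $\mathcal{P}_3(\kappa)$ is the class of $V \in \mathcal{P}_1(\kappa)$ which are $C^3$ on $\mathbb{R} \setminus \{0\}$ and satisfy $|x^{\ell} V^{(\ell)}(x)| \leq \kappa V(x)$ for all $x \neq 0$ and $\ell=2,3$. For $V \in \mathcal{P}_1(\kappa)$, let $\mathcal{H}[V]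 = -\partial_x^2 + V$ be the Schr\"odinger operator on $\mathbb{R}$, a self-adjoint operator on $L^2(\mathbb{R})$ with discrete spectrum consisting of simple positive eigenvalues $E_1(V) < E_2(V) < \cdots$; $\psi_n(\cdot;V)$ is the corresponding real-valued eigenfunction with eigenvalue $E_n(V)$, normalised by $\|\psi_n(\cdot;V)\|_{L^2(\mathbb{R})} = 1$ (unique up to sign). $\psi_n'(\cdot;V)$ denotes its derivative in $x$. *)

theory Defs
  imports "HOL-Analysis.Analysis"
begin

section \<open>Classes of potentials\<close>

definition P1 :: "real \<Rightarrow> (real \<Rightarrow> real) set" where
  "P1 \<kappa> = {V. continuous_on UNIV V \<and> (\<forall>x. 0 \<le> V x) \<and> (\<exists>x. V x \<noteq> 0) \<and>
      V C1_differentiable_on (- {0}) \<and>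
      (\<forall>x. x \<noteq> 0 \<longrightarrow> V x / \<kappa> \<le> x * deriv V x \<and> x * deriv V x \<le> \<kappa> * V x \<and> V (- x) \<le> \<kappa> * V x)}"

definition modulus_of_continuity :: "(ennreal \<Rightarrow> ennreal) \<Rightarrow> bool" where
  "modulus_of_continuity \<omega> \<longleftrightarrow> (\<omega> \<longlongrightarrow> 0) (at 0)"

text \<open>For \<open>V \<in> P1 \<kappa>\<close> the derivative is nonzero and of constant sign on each half-line,
  so the logarithm below is always taken at a positive number.\<close>

definition P1_uc :: "real \<Rightarrow> (ennreal \<Rightarrow> ennreal) \<Rightarrow> (real \<Rightarrow> real) set" where
  "P1_uc \<kappa> \<omega> = {V \<in> P1 \<kappa>. \<forall>\<sigma>\<in>{1, -1}. \<forall>t t'.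
      ennreal \<bar>ln (deriv V (\<sigma> * exp t) / deriv V (\<sigma> * exp t'))\<bar> \<le> \<omega> (ennreal \<bar>t - t'\<bar>)}"

definition P1_cv :: "real \<Rightarrow> (real \<Rightarrow> real) set" where
  "P1_cv \<kappa> = {V \<in> P1 \<kappa>. convex_on UNIV V}"

definition P3 :: "real \<Rightarrow> (real \<Rightarrow> real) set" where
  "P3 \<kappa> = {V \<in> P1 \<kappa>. (\<forall>k<3. (deriv ^^ k) V C1_differentiable_on (- {0})) \<and>
      (\<forall>x l. x \<noteq> 0 \<longrightarrow> l \<in> {2, 3} \<longrightarrow> \<bar>x ^ l * (deriv ^^ l) V x\<bar> \<le> \<kappa> * V x)}"


section \<open>The Schroedinger operator\<close>

definition in_L2 :: "(real \<Rightarrow> real) \<Rightarrow> bool" where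
  "in_L2 f \<longleftrightarrow> f \<in> borel_measurable lebesgue \<and> integrable lebesgue (\<lambda>x. (f x)\<^sup>2)"

definition norm_L2 :: "(real \<Rightarrow> real) \<Rightarrow> real" where
  "norm_L2 f = sqrt (LINT x|lebesgue. (f x)\<^sup>2)"

text \<open>\<open>g\<close> is the almost everywhere defined second derivative of \<open>f\<close>, where \<open>f\<close> is
  differentiable everywhere and its derivative is locally absolutely continuous, i.e. an
  indefinite integral.\<close>

definition has_second_derivative_AC :: "(real \<Rightarrow> real) \<Rightarrow> (real \<Rightarrow> real) \<Rightarrow> bool" where
  "has_second_derivative_AC f g \<longleftrightarrow>
     (\<forall>x. f differentiable at x) \<and>
     (\<forall>a b. a \<le> b \<longrightarrow> set_integrable lebesgue {a..b} g \<and>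
        deriv f b - deriv f a = (LINT x:{a..b}|lebesgue. g x))"

text \<open>The graph of the operator \<open>- \<partial>\<^sup>2 + V\<close> in real \<open>L\<^sup>2\<close>, with its maximal domain: all square
  integrable \<open>f\<close> with \<open>f\<close> and \<open>f'\<close> locally absolutely continuous and \<open>- f'' + V f\<close> square
  integrable. For continuous \<open>V \<ge> 0\<close> both endpoints are in the limit point case, so this is the
  unique self-adjoint realisation. Every element of the domain is represented by its
  continuously differentiable representative, so that pointwise values make sense.\<close>

definition schroedinger :: "(real \<Rightarrow> real) \<Rightarrow> (real \<Rightarrow> real) \<Rightarrow> (real \<Rightarrow> real) \<Rightarrow> bool" where
  "schroedinger V f h \<longleftrightarrow> in_L2 f \<and> in_L2 h \<and>
     (\<exists>g. has_second_derivative_AC f g \<and> (AE x in lebesgue. h x = - g x + V x * f x))"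

definition eigenfunction :: "(real \<Rightarrow> real) \<Rightarrow> real \<Rightarrow> (real \<Rightarrow> real) \<Rightarrow> bool" where
  "eigenfunction V E f \<longleftrightarrow> schroedinger V f (\<lambda>x. E * f x) \<and> norm_L2 f \<noteq> 0"

definition eigenvalue :: "(real \<Rightarrow> real) \<Rightarrow> real \<Rightarrow> bool" where
  "eigenvalue V E \<longleftrightarrow> (\<exists>f. eigenfunction V E f)"

text \<open>\<open>E\<close> is the \<open>n\<close>-th smallest eigenvalue, counting from \<open>1\<close>.\<close>

definition nth_eigenvalue :: "(real \<Rightarrow> real) \<Rightarrow> nat \<Rightarrow> real \<Rightarrow> bool" where
  "nth_eigenvalue V n E \<longleftrightarrow> eigenvalue V E \<and>
     finite {F. eigenvalue V F \<and> F \<le> E} \<and> card {F. eigenvalue V F \<and> F \<le> E} = n"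


section \<open>Powers\<close>

text \<open>A negative power of \<open>0\<close> is \<open>\<infinity>\<close>, whereas \<open>0 powr p = 0\<close> for every \<open>p\<close>.
  The convention for \<open>0\<close> to the power \<open>0\<close> is immaterial below: such a power only occurs inside
  a maximum with \<open>1\<close>.\<close>

definition epowr :: "real \<Rightarrow> real \<Rightarrow> ereal" where
  "epowr u p = (if u = 0 \<and> p < 0 then \<infinity> else ereal (u powr p))"

end

theory Submission
  imports Defs
begin

text \<open>
  Write \<open>{V \<le> E} = {-a..b}\<close> for the well of the energy \<open>E\<close>, \<open>N = sqrt E * (a + b)\<close>, and let \<open>f\<close> be a
  normalised eigenfunction, a classical solution of \<open>f'' = (V - E) f\<close>. There are three ingredients.

  \<^item> Amplitude. On the right half line the energy function \<open>A = (E - V) f\<^sup>2 + f'\<^sup>2\<close> decreases. On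
  \<open>{0<..<b}\<close> the quotient \<open>A / (E - V)\<close> increases, so \<open>A\<close> is comparable to \<open>A 0\<close> where \<open>V \<le> E / 2\<close>, and the
  identity \<open>\<integral> f'\<^sup>2 + V f\<^sup>2 = E\<close> gives \<open>A 0 \<le> C E / (a + b)\<close> (\<open>initial_amplitude\<close>). This alone settles
  \<open>\<alpha> = 1/2\<close> up to the powers of \<open>n\<close>.

  \<^item> Propagation to the turning point \<open>b\<close>. With \<open>u = E - V\<close> and \<open>G = u powr (2 * \<alpha> - 1) * A\<close> one has
  \<open>G' = (1/2) V' u powr (2 * \<alpha> - 2) (f f')' - (2 * \<alpha> - 1/2) (V' / u) G\<close>. If \<open>V'\<close> were nondecreasing, the
  weight of \<open>(f f')'\<close> would be nondecreasing too, and the second mean value theorem would bound its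
  integral by boundary terms, which are at most half the supremum of \<open>G\<close> as long as \<open>u\<close> is not below
  \<open>E n powr (-2/3)\<close> in order of magnitude (\<open>amplitude_bound\<close>). It suffices that \<open>V'\<close> be
  a difference \<open>p - q\<close> of nondecreasing functions up to an error \<open>(4 * \<alpha> - 1) V'\<close>, which the second term of \<open>G'\<close>
  absorbs. This one condition, \<open>almost_monotone_slope\<close>, holds near \<open>b\<close> in all four cases: with
  \<open>p = q = 0\<close> for \<open>\<alpha> = 1/2\<close>; with \<open>p\<close> a constant for a slowly varying slope; with \<open>p = V'\<close> for a convex
  potential; with \<open>p = V' + K x\<close> and \<open>q = K x\<close> when \<open>V''\<close> is bounded. From the cut-off point on, the
  monotonicity of \<open>A\<close>, and beyond \<open>b\<close> the inequality \<open>(V - E) f\<^sup>2 \<le> f'\<^sup>2\<close>, give the remaining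
  bounds (\<open>turning_point_bounds\<close>). The left half line is the mirror image.

  \<^item> Counting. These estimates come with powers of \<open>N\<close>, so \<open>N\<close> has to be comparable to \<open>n\<close>. For
  \<open>n \<le> C N\<close>: by Sturm's argument an eigenfunction has at least as many zeros as there are smaller
  eigenvalues, its zeros lie in the well and are \<open>1 / sqrt E\<close> apart, and \<open>N\<close> itself is bounded below
  (\<open>index_upper\<close>). For \<open>N \<le> C n\<close> eigenvalues have to be produced: the Pruefer angle of the solution
  starting at \<open>-S\<close> turns by \<open>M\<close> half turns at energy \<open>E\<close>, with \<open>M\<close> of the order of \<open>N\<close>, and by less
  than one at energy \<open>-1\<close>, so it turns by exactly \<open>k\<close> half turns at some energy for each \<open>k \<le> M\<close>;
  the limit \<open>S \<rightarrow> \<infinity>\<close> yields square integrable solutions, and different \<open>k\<close> belong to different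
  energies (\<open>many_eigenvalues\<close>, \<open>index_lower\<close>).
\<close>

section \<open>Calculus on the line and classical eigenfunctions\<close>

lemma DERIV_nonneg_nondecreasing:
  fixes g :: "real \<Rightarrow> real"
  assumes "a \<le> b" "continuous_on {a..b} g"
    and "\<And>x. a < x \<Longrightarrow> x < b \<Longrightarrow> (g has_real_derivative g' x) (at x)"
    and "\<And>x. a < x \<Longrightarrow> x < b \<Longrightarrow> 0 \<le> g' x"
  shows "g a \<le> g b"
proof (cases "a = b")
  case False
  then obtain l z where z: "a < z" "z < b" "(g has_real_derivative l) (at z)" "g b - g a = (b - a) * l"
    using MVT[of a b g] assms real_differentiable_def by (metis order_le_less)
  then have "l = g' z" using assms(3) DERIV_unique by blast
  then have "0 \<le> (b - a) * l" using z assms by simp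
  then show ?thesis using z by linarith
qed simp

lemma DERIV_square:
  fixes g :: "real \<Rightarrow> real"
  assumes "(g has_real_derivative d) (at x)"
  shows "((\<lambda>x. (g x)\<^sup>2) has_real_derivative 2 * (g x * d)) (at x)"
  using assms by (auto intro!: derivative_eq_intros)

lemma continuous_on_Icc_bounded:
  fixes g :: "real \<Rightarrow> real"
  assumes "continuous_on {a..b} g"
  obtains B where "0 < B" "\<And>x. x \<in> {a..b} \<Longrightarrow> \<bar>g x\<bar> \<le> B"
proof -
  obtain B where "0 < B" "\<forall>y\<in>g ` {a..b}. norm y \<le> B"
    using compact_imp_bounded[OF compact_continuous_image[OF assms compact_Icc]]
    unfolding bounded_pos by blast
  then show ?thesis using that by (metis imageI real_norm_def)
qed

definition antiderivative :: "real \<Rightarrow> (real \<Rightarrow> real) \<Rightarrow> real \<Rightarrow> real" where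
  "antiderivative x0 g x = integral {x0..x} g - integral {x..x0} g"

lemma antiderivative_base [simp]: "antiderivative x0 g x0 = 0"
  by (simp add: antiderivative_def)

text \<open>
  One of the two integrals in the definition ranges over an empty interval, so the formula is the
  oriented integral on both sides of the base point.
\<close>

lemma DERIV_antiderivative:
  fixes g :: "real \<Rightarrow> real"
  assumes "continuous_on UNIV g"
  shows "(antiderivative x0 g has_real_derivative g x) (at x)"
proof -
    define a where "a = min x0 x - 1"
    define b where "b = x + 1"
    have int: "g integrable_on {c..d}" for c d
      by (intro integrable_continuous_real continuous_on_subset[OF assms]) auto
    have eq: "antiderivative x0 g y = integral {a..y} g - integral {a..x0} g" if "a \<le> y" for y
    proof (cases "x0 \<le> y")
      case True
      then have "integral {a..x0} g + integral {x0..y} g = integral {a..y} g"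
        by (intro Henstock_Kurzweil_Integration.integral_combine int) (auto simp: a_def)
      moreover have "integral {y..x0} g = 0" using True by (cases "x0 = y") auto
      ultimately show ?thesis by (simp add: antiderivative_def)
    next
      case False
      then have "integral {a..y} g + integral {y..x0} g = integral {a..x0} g"
        by (intro Henstock_Kurzweil_Integration.integral_combine int) (auto simp: that)
      moreover have "integral {x0..y} g = 0" using False by simp
      ultimately show ?thesis by (simp add: antiderivative_def)
    qed
    have "((\<lambda>y. integral {a..y} g) has_real_derivative g x) (at x within {a..b})"
      by (intro integral_has_real_derivative continuous_on_subset[OF assms]) (auto simp: a_def b_def)
    then have "((\<lambda>y. integral {a..y} g) has_real_derivative g x) (at x)"
      using at_within_Icc_at[of a x b] by (simp add: a_def b_def)
    then have "((\<lambda>y. integral {a..y} g - integral {a..x0} g) has_real_derivative g x) (at x)"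
      by (auto intro!: derivative_eq_intros)
    then show ?thesis
      by (rule DERIV_cong_ev[THEN iffD1, rotated 3])
         (use eq in \<open>auto simp: a_def eventually_nhds intro!: exI[of _ "{min x0 x - 1<..}"]\<close>)
qed

text \<open>
  Since the hypothesis bounds \<open>\<bar>Q'\<bar>\<close> and not only \<open>Q'\<close>, the estimate holds on both sides of
  \<open>x0\<close>.
\<close>

lemma gronwall:
  fixes Q :: "real \<Rightarrow> real"
  assumes Q: "\<And>s. s \<in> closed_segment x0 x \<Longrightarrow> (Q has_real_derivative Q' s) (at s)"
    and le: "\<And>s. s \<in> closed_segment x0 x \<Longrightarrow> \<bar>Q' s\<bar> \<le> K * Q s"
  shows "Q x \<le> exp (K * \<bar>x - x0\<bar>) * Q x0"
proof (cases "x0 \<le> x")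
  case True
  have "exp (- K * x) * Q x \<le> exp (- K * x0) * Q x0"
  proof (rule DERIV_nonpos_imp_nonincreasing[OF True])
    fix s assume "x0 \<le> s" "s \<le> x"
    then have s: "s \<in> closed_segment x0 x" by (simp add: closed_segment_eq_real_ivl)
    have "((\<lambda>x. exp (- K * x) * Q x) has_real_derivative exp (- K * s) * (Q' s - K * Q s)) (at s)"
      by (rule derivative_eq_intros Q[OF s] refl)+ (simp add: algebra_simps)
    moreover have "exp (- K * s) * (Q' s - K * Q s) \<le> 0"
      using le[OF s] by (simp add: mult_le_0_iff)
    ultimately show "\<exists>d. ((\<lambda>x. exp (- K * x) * Q x) has_real_derivative d) (at s) \<and> d \<le> 0" by blast
  qed
  then have "exp (K * x) * (exp (- K * x) * Q x) \<le> exp (K * x) * (exp (- K * x0) * Q x0)"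
    by (rule mult_left_mono) simp
  moreover have "exp (K * x) * (exp (- K * x) * Q x) = Q x"
    by (simp only: mult.assoc[symmetric] exp_add[symmetric]) simp
  moreover have "exp (K * x) * (exp (- K * x0) * Q x0) = exp (K * \<bar>x - x0\<bar>) * Q x0"
    using True by (simp only: mult.assoc[symmetric] exp_add[symmetric]) (simp add: right_diff_distrib)
  ultimately show ?thesis by metis
next
  case False
  then have "x \<le> x0" by simp
  have "exp (K * x) * Q x \<le> exp (K * x0) * Q x0"
  proof (rule DERIV_nonneg_imp_nondecreasing[OF \<open>x \<le> x0\<close>])
    fix s assume "x \<le> s" "s \<le> x0"
    then have s: "s \<in> closed_segment x0 x" by (simp add: closed_segment_eq_real_ivl)
    have "((\<lambda>x. exp (K * x) * Q x) has_real_derivative exp (K * s) * (Q' s + K * Q s)) (at s)"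
      by (rule derivative_eq_intros Q[OF s] refl)+ (simp add: algebra_simps)
    moreover have "0 \<le> exp (K * s) * (Q' s + K * Q s)"
      using le[OF s] by simp
    ultimately show "\<exists>d. ((\<lambda>x. exp (K * x) * Q x) has_real_derivative d) (at s) \<and> 0 \<le> d" by blast
  qed
  then have "exp (- K * x) * (exp (K * x) * Q x) \<le> exp (- K * x) * (exp (K * x0) * Q x0)"
    by (rule mult_left_mono) simp
  moreover have "exp (- K * x) * (exp (K * x) * Q x) = Q x"
    by (simp only: mult.assoc[symmetric] exp_add[symmetric]) simp
  moreover have "exp (- K * x) * (exp (K * x0) * Q x0) = exp (K * \<bar>x - x0\<bar>) * Q x0"
    using False by (simp only: mult.assoc[symmetric] exp_add[symmetric]) (simp add: right_diff_distrib)
  ultimately show ?thesis by metis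
qed

definition eigenstate ::
  "(real \<Rightarrow> real) \<Rightarrow> real \<Rightarrow> (real \<Rightarrow> real) \<Rightarrow> (real \<Rightarrow> real) \<Rightarrow> bool" where
  "eigenstate V E f f' \<longleftrightarrow>
     (\<forall>x. (f has_real_derivative f' x) (at x)) \<and>
     (\<forall>x. (f' has_real_derivative (V x - E) * f x) (at x)) \<and>
     (\<lambda>x. (f x)\<^sup>2) integrable_on UNIV \<and> (\<exists>x. f x \<noteq> 0)"

lemma eigenstateD:
  assumes "eigenstate V E f f'"
  shows "\<And>x. (f has_real_derivative f' x) (at x)"
    and "\<And>x. (f' has_real_derivative (V x - E) * f x) (at x)"
    and "(\<lambda>x. (f x)\<^sup>2) integrable_on UNIV"
    and "\<exists>x. f x \<noteq> 0"
    and "continuous_on A f" and "continuous_on A f'"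
proof -
  show 1: "\<And>x. (f has_real_derivative f' x) (at x)"
    and 2: "\<And>x. (f' has_real_derivative (V x - E) * f x) (at x)"
    and "(\<lambda>x. (f x)\<^sup>2) integrable_on UNIV" and "\<exists>x. f x \<noteq> 0"
    using assms by (auto simp: eigenstate_def)
  show "continuous_on A f" "continuous_on A f'"
    using DERIV_isCont[OF 1] DERIV_isCont[OF 2] by (auto intro: continuous_at_imp_continuous_on)
qed

lemma integrable_lebesgue_iff_nonneg:
  fixes g :: "real \<Rightarrow> real"
  assumes "\<And>x. 0 \<le> g x"
  shows "integrable lebesgue g \<longleftrightarrow> g integrable_on UNIV"
  using assms integrable_on_lebesgue nonnegative_absolutely_integrable_1[of g UNIV]
  by (auto simp: set_integrable_def)

text \<open>
  The second derivative in the operator domain equals the continuous function \<open>(V - E) f\<close> almost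
  everywhere, so \<open>f'\<close> is the integral of a continuous function and therefore differentiable at every
  point.
\<close>

lemma eigenfunction_imp_eigenstate:
  assumes V: "continuous_on UNIV V" and ef: "eigenfunction V E f"
  shows "eigenstate V E f (deriv f)"
proof -
  obtain g where g: "in_L2 f" "has_second_derivative_AC f g"
      "AE x in lebesgue. E * f x = - g x + V x * f x" and n: "norm_L2 f \<noteq> 0"
    using ef by (auto simp: eigenfunction_def schroedinger_def)
  have df: "(f has_real_derivative deriv f x) (at x)" for x
    using g(2) DERIV_deriv_iff_real_differentiable by (auto simp: has_second_derivative_AC_def)
  have cf: "continuous_on A f" for A
    using DERIV_isCont[OF df] by (auto intro: continuous_at_imp_continuous_on)
  define h where "h x = (V x - E) * f x" for x
  have ch: "continuous_on UNIV h" unfolding h_def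
    by (intro continuous_intros V cf)
  have diff: "deriv f b - deriv f a = integral {a..b} h" if "a \<le> b" for a b
  proof -
    have abs: "h absolutely_integrable_on {a..b}"
      by (intro absolutely_integrable_continuous_real continuous_on_subset[OF ch]) auto
    have gint: "set_integrable lebesgue {a..b} g" 
      and eq: "deriv f b - deriv f a = (LINT x:{a..b}|lebesgue. g x)"
      using g(2) that unfolding has_second_derivative_AC_def by blast+
    have "AE x in lebesgue. indicator {a..b} x *\<^sub>R g x = indicator {a..b} x *\<^sub>R h x"
      using g(3)
    proof eventually_elim
      case (elim x)
      then have "g x = h x" by (simp add: h_def left_diff_distrib)
      then show ?case by simp
    qed
    then have "(LINT x:{a..b}|lebesgue. g x) = (LINT x:{a..b}|lebesgue. h x)"
      unfolding set_lebesgue_integral_def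
      using gint abs unfolding set_integrable_def
      by (intro integral_cong_AE borel_measurable_integrable)
    also have "\<dots> = integral {a..b} h" using abs by (rule set_lebesgue_integral_eq_integral)
    finally show ?thesis using eq by simp
  qed
  have ddf: "(deriv f has_real_derivative (V x - E) * f x) (at x)" for x
  proof -
    have "((\<lambda>y. integral {x-1..y} h) has_real_derivative h x) (at x within {x-1..x+1})"
      by (intro integral_has_real_derivative continuous_on_subset[OF ch]) auto
    then have "((\<lambda>y. integral {x-1..y} h) has_real_derivative h x) (at x)"
      using at_within_Icc_at[of "x-1" x "x+1"] by simp
    then have der: "((\<lambda>y. integral {x-1..y} h + deriv f (x-1)) has_real_derivative h x) (at x)"
      by (auto intro!: derivative_eq_intros)
    have ev: "\<forall>\<^sub>F y in nhds x. integral {x-1..y} h + deriv f (x-1) = deriv f y"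
      using eventually_nhds_in_open[of "{x-1<..}" x]
    proof (rule eventually_mono)
      show "integral {x-1..y} h + deriv f (x-1) = deriv f y" if "y \<in> {x-1<..}" for y
        using diff[of "x-1" y] that by simp
    qed auto
    have "(deriv f has_real_derivative h x) (at x)"
      using der DERIV_cong_ev[OF refl ev refl, of "h x"] by (rule iffD1[rotated])
    then show ?thesis by (simp add: h_def)
  qed
  have int: "(\<lambda>x. (f x)\<^sup>2) integrable_on UNIV"
    using g(1) by (auto simp: in_L2_def integrable_on_lebesgue)
  have "\<exists>x. f x \<noteq> 0"
  proof (rule ccontr)
    assume "\<not> ?thesis"
    then have "f = (\<lambda>x. 0)" by auto
    then show False using n by (simp add: norm_L2_def)
  qed
  then show ?thesis using df ddf int by (simp add: eigenstate_def)
qed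

lemma integral_square_pos:
  assumes "eigenstate V E f f'"
  shows "0 < integral UNIV (\<lambda>x. (f x)\<^sup>2)"
proof -
  obtain x where x: "f x \<noteq> 0" using eigenstateD(4)[OF assms] by blast
  have c: "continuous_on {x-1..x+1} (\<lambda>x. (f x)\<^sup>2)"
    by (intro continuous_intros eigenstateD(5)[OF assms])
  have "integral {x-1..x+1} (\<lambda>x. (f x)\<^sup>2) \<noteq> 0"
    using integral_eq_0_iff[OF c] x by auto
  moreover have "0 \<le> integral {x-1..x+1} (\<lambda>x. (f x)\<^sup>2)"
    by (rule integral_nonneg) (use c integrable_continuous_real in auto)
  moreover have "integral {x-1..x+1} (\<lambda>x. (f x)\<^sup>2) \<le> integral UNIV (\<lambda>x. (f x)\<^sup>2)"
    by (rule integral_subset_le) (use c integrable_continuous_real eigenstateD(3)[OF assms] in auto)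
  ultimately show ?thesis by linarith
qed

lemma norm_L2_eigenstate:
  assumes "eigenstate V E f f'"
  shows "norm_L2 f = sqrt (integral UNIV (\<lambda>x. (f x)\<^sup>2))"
proof -
  have "integrable lebesgue (\<lambda>x. (f x)\<^sup>2)"
    using eigenstateD(3)[OF assms] by (subst integrable_lebesgue_iff_nonneg) auto
  then show ?thesis
    using has_integral_integral_lebesgue integral_unique unfolding norm_L2_def by metis
qed

lemma eigenstate_imp_eigenfunction:
  assumes V: "continuous_on UNIV V" and es: "eigenstate V E f f'"
  shows "eigenfunction V E f"
proof -
  note d = eigenstateD[OF es]
  have f': "deriv f = f'" using d(1) DERIV_imp_deriv by blast
  define g where "g x = (V x - E) * f x" for x
  have cg: "continuous_on A g" for A unfolding g_def
    by (intro continuous_intros continuous_on_subset[OF V] d(5)) auto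
  have "has_second_derivative_AC f g"
    unfolding has_second_derivative_AC_def
  proof (intro conjI allI impI)
    show "f differentiable at x" for x using d(1) real_differentiable_def by blast
    fix a b :: real assume "a \<le> b"
    have abs: "g absolutely_integrable_on {a..b}"
      by (intro absolutely_integrable_continuous_real cg)
    then show "set_integrable lebesgue {a..b} g" .
    have "(g has_integral (f' b - f' a)) {a..b}"
      using \<open>a \<le> b\<close> by (intro fundamental_theorem_of_calculus)
        (auto simp: g_def has_real_derivative_iff_has_vector_derivative[symmetric] intro: DERIV_subset[OF d(2)])
    then show "deriv f b - deriv f a = (LINT x:{a..b}|lebesgue. g x)"
      using abs f' by (simp add: set_lebesgue_integral_eq_integral integral_unique)
  qed
  moreover have m: "f \<in> borel_measurable lebesgue"
  proof -
    have "f \<in> borel_measurable borel" using d(5) by (rule borel_measurable_continuous_onI)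
    then have "f \<in> borel_measurable lborel" by simp
    then show ?thesis by (rule measurable_completion)
  qed
  moreover have i: "integrable lebesgue (\<lambda>x. (f x)\<^sup>2)"
    using d(3) by (subst integrable_lebesgue_iff_nonneg) auto
  moreover have "in_L2 (\<lambda>x. E * f x)"
    unfolding in_L2_def using m i by (auto simp: power_mult_distrib)
  moreover have "norm_L2 f \<noteq> 0"
    using norm_L2_eigenstate[OF es] integral_square_pos[OF es] by simp
  ultimately show ?thesis
    unfolding eigenfunction_def schroedinger_def in_L2_def
    by (auto simp: g_def algebra_simps intro!: exI[of _ g])
qed

lemma eigenstate_reflect:
  assumes "eigenstate V E f f'"
  shows "eigenstate (\<lambda>x. V (- x)) E (\<lambda>x. f (- x)) (\<lambda>x. - f' (- x))"
proof -
  note d = eigenstateD[OF assms]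
  have 1: "((\<lambda>x. f (- x)) has_real_derivative - f' (- x)) (at x)" for x
    using DERIV_mirror[of f "f' (-x)" x] d(1) by simp
  have "((\<lambda>x. f' (- x)) has_real_derivative - ((V (- x) - E) * f (- x))) (at x)" for x
    using DERIV_mirror[of f' "(V (- x) - E) * f (- x)" x] d(2) by simp
  from DERIV_minus[OF this]
  have 2: "((\<lambda>x. - f' (- x)) has_real_derivative (V (- x) - E) * f (- x)) (at x)" for x
    by simp
  have "(\<lambda>x. (f x)\<^sup>2) absolutely_integrable_on UNIV"
    using d(3) nonnegative_absolutely_integrable_1 by fastforce
  then have "(\<lambda>x. (f (- x))\<^sup>2) absolutely_integrable_on UNIV"
    using has_absolute_integral_reflect_real[of UNIV UNIV "\<lambda>x. (f x)\<^sup>2" "integral UNIV (\<lambda>x. (f x)\<^sup>2)"]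
    by simp
  then have "(\<lambda>x. (f (- x))\<^sup>2) integrable_on UNIV"
    by (rule set_lebesgue_integral_eq_integral)
  moreover have "\<exists>x. f (- x) \<noteq> 0" using d(4) by (metis minus_minus)
  ultimately show ?thesis using 1 2 by (simp add: eigenstate_def)
qed

section \<open>Decay outside the well\<close>

text \<open>
  The only way in which square integrability enters the analysis at infinity.
\<close>

lemma integrable_square_not_bounded_below:
  fixes g :: "real \<Rightarrow> real"
  assumes g: "g integrable_on UNIV" "\<And>x. 0 \<le> g x" and e: "0 < e"
  shows "\<exists>x\<ge>y. g x < e"
proof (rule ccontr)
  assume "\<not> ?thesis"
  then have ge: "e \<le> g x" if "y \<le> x" for x using that by force
  define I where "I = integral UNIV g"
  have I0: "0 \<le> I" unfolding I_def by (rule integral_nonneg) (use g in auto)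
  define z where "z = y + (I + 1) / e"
  have yz: "y \<le> z" using I0 e by (simp add: z_def)
  have gi: "g integrable_on {y..z}" using g(1) integrable_on_subinterval by blast
  have "integral {y..z} (\<lambda>x. e) \<le> integral {y..z} g"
    by (rule integral_le) (use gi ge in auto)
  also have "\<dots> \<le> I" unfolding I_def by (rule integral_subset_le) (use gi g in auto)
  finally show False using yz e by (simp add: z_def)
qed

context
  fixes V E f f' b
  assumes es: "eigenstate V E f f'" and VE: "\<And>x. b \<le> x \<Longrightarrow> E \<le> V x"
begin

lemma DERIV_product_eigenstate:
  "((\<lambda>x. f x * f' x) has_real_derivative (f' x)\<^sup>2 + (V x - E) * (f x)\<^sup>2) (at x)"
  using eigenstateD(1,2)[OF es]
  by (auto intro!: derivative_eq_intros simp: power2_eq_square algebra_simps)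

text \<open>
  Where \<open>V \<ge> E\<close> the product \<open>f f'\<close> is nondecreasing; if it became positive, \<open>f\<^sup>2\<close> would increase
  from there on.
\<close>

lemma product_nonpos:
  assumes "b \<le> x" shows "f x * f' x \<le> 0"
proof (rule ccontr)
  assume "\<not> ?thesis"
  then have c: "0 < f x * f' x" (is "0 < ?c") by simp
  have ge: "?c \<le> f y * f' y" if "x \<le> y" for y
    by (rule DERIV_nonneg_imp_nondecreasing[OF that])
       (use DERIV_product_eigenstate VE assms in \<open>force intro!: add_nonneg_nonneg mult_nonneg_nonneg\<close>)
  have "(f x)\<^sup>2 \<le> (f y)\<^sup>2" if "x \<le> y" for y
  proof (rule DERIV_nonneg_imp_nondecreasing[OF that])
    fix z assume z: "x \<le> z"
    show "\<exists>d. ((\<lambda>a. (f a)\<^sup>2) has_real_derivative d) (at z) \<and> 0 \<le> d"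
      using ge[OF z] c
      by (intro exI[of _ "2 * (f z * f' z)"])
         (auto intro!: derivative_eq_intros eigenstateD(1)[OF es])
  qed
  moreover have "0 < (f x)\<^sup>2" using c by auto
  ultimately show False
    using integrable_square_not_bounded_below[OF eigenstateD(3)[OF es], of "(f x)\<^sup>2" x] by force
qed

lemma square_antimono:
  assumes "b \<le> x" "x \<le> y" shows "(f y)\<^sup>2 \<le> (f x)\<^sup>2"
proof (rule DERIV_nonpos_imp_nonincreasing[OF assms(2)])
  fix z assume z: "x \<le> z"
  show "\<exists>d. ((\<lambda>a. (f a)\<^sup>2) has_real_derivative d) (at z) \<and> d \<le> 0"
    using product_nonpos[of z] z assms DERIV_square[OF eigenstateD(1)[OF es, of z]]
    by (intro exI[of _ "2 * (f z * f' z)"]) simp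
qed

text \<open>
  \<open>(f'\<^sup>2)' = 2 (V - E) f f'\<close>, and \<open>f f'\<close> is nonpositive.
\<close>

lemma deriv_square_antimono:
  assumes "b \<le> x" "x \<le> y" shows "(f' y)\<^sup>2 \<le> (f' x)\<^sup>2"
proof (rule DERIV_nonpos_imp_nonincreasing[OF assms(2)])
  fix z assume z: "x \<le> z"
  have "(V z - E) * (f z * f' z) \<le> 0"
    using product_nonpos[of z] VE[of z] z assms by (simp add: mult_nonneg_nonpos)
  moreover have "2 * (f' z * ((V z - E) * f z)) = 2 * ((V z - E) * (f z * f' z))" by simp
  ultimately have "2 * (f' z * ((V z - E) * f z)) \<le> 0" by linarith
  then show "\<exists>d. ((\<lambda>a. (f' a)\<^sup>2) has_real_derivative d) (at z) \<and> d \<le> 0"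
    using DERIV_square[OF eigenstateD(2)[OF es, of z]] by blast
qed

text \<open>
  The expression is the derivative of \<open>f f'\<close>, which stays nonpositive and so cannot grow
  linearly.
\<close>

lemma energy_not_bounded_below:
  assumes "0 < e"
  shows "\<exists>x\<ge>y. (f' x)\<^sup>2 + (V x - E) * (f x)\<^sup>2 < e"
proof (rule ccontr)
  assume "\<not> ?thesis"
  then have ge: "e \<le> (f' x)\<^sup>2 + (V x - E) * (f x)\<^sup>2" if "y \<le> x" for x using that by force
  define y0 where "y0 = max y b"
  define z where "z = y0 + (\<bar>f y0 * f' y0\<bar> + 1) / e"
  have z: "y0 \<le> z" using assms by (simp add: z_def)
  have "f y0 * f' y0 - e * y0 \<le> f z * f' z - e * z"
  proof (rule DERIV_nonneg_imp_nondecreasing[OF z])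
    fix x assume "y0 \<le> x"
    then show "\<exists>d. ((\<lambda>a. f a * f' a - e * a) has_real_derivative d) (at x) \<and> 0 \<le> d"
      using ge[of x] DERIV_diff[OF DERIV_product_eigenstate DERIV_cmult_Id[of e], of x]
      by (intro exI[of _ "(f' x)\<^sup>2 + (V x - E) * (f x)\<^sup>2 - e"]) (auto simp: y0_def)
  qed
  moreover have "f z * f' z \<le> 0" using product_nonpos z by (simp add: y0_def)
  moreover have "e * (z - y0) = \<bar>f y0 * f' y0\<bar> + 1" using assms by (simp add: z_def)
  ultimately show False by (simp add: algebra_simps)
qed

lemma tendsto_0_of_antimono_square:
  fixes h :: "real \<Rightarrow> real"
  assumes "\<And>x y. b \<le> x \<Longrightarrow> x \<le> y \<Longrightarrow> (h y)\<^sup>2 \<le> (h x)\<^sup>2"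
    and "\<And>e. 0 < e \<Longrightarrow> \<exists>x\<ge>b. (h x)\<^sup>2 < e"
  shows "(h \<longlongrightarrow> 0) at_top"
proof (rule tendstoI)
  fix e :: real assume "0 < e"
  then obtain x where x: "b \<le> x" "(h x)\<^sup>2 < e\<^sup>2" using assms(2)[of "e\<^sup>2"] by auto
  have "\<bar>h y\<bar> < e" if "x \<le> y" for y
  proof -
    have "(h y)\<^sup>2 < e\<^sup>2" using assms(1)[OF x(1) that] x(2) by linarith
    then show ?thesis using \<open>0 < e\<close> by (metis abs_le_square_iff abs_of_pos not_le)
  qed
  then show "\<forall>\<^sub>F x in at_top. dist (h x) 0 < e"
    unfolding eventually_at_top_linorder by (auto simp: dist_real_def)
qed

lemma eigenstate_tendsto_0: "(f \<longlongrightarrow> 0) at_top"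
  using square_antimono integrable_square_not_bounded_below[OF eigenstateD(3)[OF es], of _ b]
  by (intro tendsto_0_of_antimono_square) auto

lemma eigenstate_deriv_tendsto_0: "(f' \<longlongrightarrow> 0) at_top"
proof (rule tendsto_0_of_antimono_square)
  fix e :: real assume e: "0 < e"
  show "\<exists>x\<ge>b. (f' x)\<^sup>2 < e"
  proof -
    obtain x where x: "b \<le> x" "(f' x)\<^sup>2 + (V x - E) * (f x)\<^sup>2 < e"
      using energy_not_bounded_below[OF e] by blast
    moreover have "0 \<le> (V x - E) * (f x)\<^sup>2" using VE[OF x(1)] by simp
    ultimately show ?thesis by force
  qed
qed (rule deriv_square_antimono)

end

text \<open>
  For \<open>E \<le> 0\<close> every point lies where \<open>V \<ge> E\<close>, so \<open>f\<^sup>2\<close> would be monotone in both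
  directions.
\<close>

lemma eigenstate_energy_pos:
  assumes es: "eigenstate V E f f'" and V: "\<And>x. 0 \<le> V x" shows "0 < E"
proof (rule ccontr)
  assume "\<not> 0 < E"
  then have VE: "\<And>x. E \<le> V x" using V by (meson not_le order_trans)
  have anti: "(f y)\<^sup>2 \<le> (f x)\<^sup>2" if "x \<le> y" for x y
    using square_antimono[OF es, of x x y] VE that by simp
  have anti2: "(f (- y))\<^sup>2 \<le> (f (- x))\<^sup>2" if "x \<le> y" for x y
    using square_antimono[OF eigenstate_reflect[OF es], of x x y] VE that by simp
  have const: "(f y)\<^sup>2 = (f x)\<^sup>2" if "x \<le> y" for x y
    using anti[of x y] anti2[of "-y" "-x"] that by simp
  obtain x where "f x \<noteq> 0" using eigenstateD(4)[OF es] by blast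
  then show False
    using integrable_square_not_bounded_below[OF eigenstateD(3)[OF es], of "(f x)\<^sup>2" x] const by force
qed

text \<open>
  Uniqueness for the initial value problem, by Gronwall's estimate for \<open>f\<^sup>2 + f'\<^sup>2\<close>.
\<close>

lemma eigenstate_nontrivial_initial:
  assumes es: "eigenstate V E f f'" and V: "continuous_on UNIV V"
  shows "f z \<noteq> 0 \<or> f' z \<noteq> 0"
proof (rule ccontr)
  assume "\<not> ?thesis"
  then have z: "f z = 0" "f' z = 0" by auto
  have "f y = 0" for y
  proof -
    define Q where "Q x = (f x)\<^sup>2 + (f' x)\<^sup>2" for x
    obtain B where B: "\<And>x. x \<in> {min z y..max z y} \<Longrightarrow> \<bar>1 + (V x - E)\<bar> \<le> B"
    proof (rule continuous_on_Icc_bounded[of "min z y" "max z y" "\<lambda>x. 1 + (V x - E)"])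
      show "continuous_on {min z y..max z y} (\<lambda>x. 1 + (V x - E))"
        by (intro continuous_intros continuous_on_subset[OF V]) auto
    qed blast
    have "Q y \<le> exp (B * \<bar>y - z\<bar>) * Q z"
    proof (rule gronwall)
      fix x assume "x \<in> closed_segment z y"
      then have x: "x \<in> {min z y..max z y}" by (auto simp: closed_segment_eq_real_ivl split: if_splits)
      show "(Q has_real_derivative (1 + (V x - E)) * (2 * (f x * f' x))) (at x)"
        unfolding Q_def using DERIV_add[OF DERIV_square[OF eigenstateD(1)[OF es, of x]] DERIV_square[OF eigenstateD(2)[OF es, of x]]]
        by (rule DERIV_cong) (simp add: algebra_simps)
      have "\<bar>2 * (f x * f' x)\<bar> \<le> Q x" unfolding Q_def
        using sum_squares_bound[of "f x" "f' x"] sum_squares_bound[of "f x" "- f' x"] by auto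
      then show "\<bar>(1 + (V x - E)) * (2 * (f x * f' x))\<bar> \<le> B * Q x"
        unfolding abs_mult[of "1 + (V x - E)"] using B[OF x] by (intro mult_mono) auto
    qed
    then have "(f y)\<^sup>2 + (f' y)\<^sup>2 \<le> 0" using z by (simp add: Q_def)
    then show "f y = 0" by (simp add: sum_power2_le_zero_iff)
  qed
  then show False using eigenstateD(4)[OF es] by blast
qed

section \<open>Sturm oscillation and the spacing of zeros\<close>

lemma eigenstate_scale:
  assumes "eigenstate V E f f'" "c \<noteq> 0"
  shows "eigenstate V E (\<lambda>x. c * f x) (\<lambda>x. c * f' x)"
proof -
  note d = eigenstateD[OF assms(1)]
  have "(\<lambda>x. c\<^sup>2 * (f x)\<^sup>2) integrable_on UNIV" 
    using integrable_cmul[OF d(3), of "c\<^sup>2"] by simp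
  moreover have "((\<lambda>x. c * f' x) has_real_derivative (V x - E) * (c * f x)) (at x)" for x
    using DERIV_cmult[OF d(2), of c x] by (simp add: mult.left_commute)
  ultimately show ?thesis
    using d(4) DERIV_cmult[OF d(1)] assms(2) unfolding eigenstate_def
    by (simp add: power_mult_distrib)
qed

lemma continuous_left_limit_nonneg:
  fixes g :: "real \<Rightarrow> real"
  assumes "isCont g d" "a < d" "\<And>y. a \<le> y \<Longrightarrow> y < d \<Longrightarrow> 0 \<le> g y"
  shows "0 \<le> g d"
proof (rule tendsto_lowerbound)
  show "(g \<longlongrightarrow> g d) (at_left d)"
    using assms(1) by (metis isCont_def filterlim_at_split)
  show "\<forall>\<^sub>F y in at_left d. 0 \<le> g y"
    using assms(2,3) eventually_at_left[OF assms(2)] by force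
qed auto

lemma wronskian_DERIV:
  assumes f: "eigenstate V F f f'" and g: "eigenstate V G g g'"
  shows "((\<lambda>x. f' x * g x - f x * g' x) has_real_derivative (G - F) * (f x * g x)) (at x)"
  using eigenstateD(1,2)[OF f, of x] eigenstateD(1,2)[OF g, of x]
  by (auto intro!: derivative_eq_intros simp: algebra_simps)

lemma wronskian_tendsto_0:
  assumes f: "eigenstate V F f f'" and g: "eigenstate V G g g'"
    and VF: "\<And>x. b \<le> x \<Longrightarrow> F \<le> V x" and VG: "\<And>x. b \<le> x \<Longrightarrow> G \<le> V x"
  shows "((\<lambda>x. f' x * g x - f x * g' x) \<longlongrightarrow> 0) at_top"
  using tendsto_diff[OF
    tendsto_mult[OF eigenstate_deriv_tendsto_0[OF f VF] eigenstate_tendsto_0[OF g VG]]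
    tendsto_mult[OF eigenstate_tendsto_0[OF f VF] eigenstate_deriv_tendsto_0[OF g VG]]]
  by simp

text \<open>
  The Wronskian \<open>f' g - f g'\<close> increases strictly as long as \<open>f\<close> and \<open>g\<close> are positive. To the right
  of \<open>x1\<close> either \<open>f\<close> reaches a first zero, where the Wronskian is nonpositive, or \<open>f\<close> stays positive
  and the Wronskian tends to \<open>0\<close>. In both cases it is negative at \<open>x1\<close>. The conclusion says
  \<open>f'/f < g'/g\<close> at \<open>x1\<close>, and the mirror image of this statement is the opposite inequality.
\<close>

lemma sturm_right:
  assumes f: "eigenstate V F f f'" and g: "eigenstate V G g g'" and FG: "F < G"
    and VG: "\<And>x. b \<le> x \<Longrightarrow> G \<le> V x"
    and fx: "0 < f x1" and gx: "\<And>x. x1 \<le> x \<Longrightarrow> (\<And>y. y \<in> {x1..x} \<Longrightarrow> 0 < f y) \<Longrightarrow> 0 < g x"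
  shows "f' x1 * g x1 < f x1 * g' x1"
proof -
  define W where "W x = f' x * g x - f x * g' x" for x
  have W': "(W has_real_derivative (G - F) * (f x * g x)) (at x)" for x
    unfolding W_def by (rule wronskian_DERIV[OF f g])
  have Wc: "continuous_on A W" for A
    using DERIV_isCont[OF W'] by (auto intro: continuous_at_imp_continuous_on)
  have inc: "W x < W y" if "x1 \<le> x" "x < y" and pos: "\<And>z. x1 \<le> z \<Longrightarrow> z < y \<Longrightarrow> 0 < f z" for x y
  proof (rule DERIV_pos_imp_increasing_open[OF \<open>x < y\<close> _ Wc])
    fix z assume z: "x < z" "z < y"
    have "0 < f z" using pos z that by simp
    moreover have "0 < g z" by (rule gx) (use z that pos in auto)
    ultimately show "\<exists>d. (W has_real_derivative d) (at z) \<and> 0 < d"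
      using W'[of z] FG by (intro exI[of _ "(G - F) * (f z * g z)"]) simp
  qed
  have "W x1 < 0"
  proof (cases "\<exists>z\<ge>x1. f z \<le> 0")
    case False
    then have pos: "0 < f z" if "x1 \<le> z" for z using that by force
    have "(W \<longlongrightarrow> 0) at_top" unfolding W_def
      using wronskian_tendsto_0[OF f g _ VG, of b] VG FG by (meson less_eq_real_def order_trans)
    moreover have "\<forall>\<^sub>F y in at_top. W (x1 + 1) \<le> W y"
      using eventually_gt_at_top[of "x1 + 1"] by eventually_elim (use inc pos in \<open>auto intro: less_imp_le\<close>)
    ultimately have "W (x1 + 1) \<le> 0" by (intro tendsto_lowerbound) auto
    moreover have "W x1 < W (x1 + 1)" using inc pos by simp
    ultimately show ?thesis by simp
  next
    case True
    define S where "S = {x1..} \<inter> f -` {..0}"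
    have "closed S" unfolding S_def
      by (rule continuous_closed_vimage[THEN closed_Int[OF closed_atLeast]])
         (use DERIV_isCont eigenstateD(1)[OF f] in auto)
    moreover have "S \<noteq> {}" "bdd_below S" using True by (auto simp: S_def)
    ultimately have dS: "Inf S \<in> S" by (rule closed_contains_Inf[rotated 2])
    define d where "d = Inf S"
    have d: "x1 \<le> d" "f d \<le> 0" using dS by (auto simp: S_def d_def)
    then have "x1 < d" using fx by (cases "x1 = d") auto
    have pos: "0 < f y" if "x1 \<le> y" "y < d" for y
    proof (rule ccontr)
      assume "\<not> 0 < f y"
      then have "y \<in> S" using that by (simp add: S_def)
      then show False using cInf_lower[OF _ \<open>bdd_below S\<close>] that by (fastforce simp: d_def)
    qed
    have gpos: "0 < g y" if "x1 \<le> y" "y < d" for y by (rule gx) (use pos that in auto)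
    have "0 \<le> f d"
      by (rule continuous_left_limit_nonneg[OF DERIV_isCont[OF eigenstateD(1)[OF f]] \<open>x1 < d\<close>])
         (use pos in \<open>auto intro: less_imp_le\<close>)
    then have fd: "f d = 0" using d by simp
    have gd: "0 \<le> g d"
      by (rule continuous_left_limit_nonneg[OF DERIV_isCont[OF eigenstateD(1)[OF g]] \<open>x1 < d\<close>])
         (use gpos in \<open>auto intro: less_imp_le\<close>)
    have "f' d \<le> 0"
    proof (rule ccontr)
      assume "\<not> f' d \<le> 0"
      then obtain e where e: "0 < e" "\<And>h. 0 < h \<Longrightarrow> h < e \<Longrightarrow> f (d - h) < f d"
        using DERIV_pos_inc_left[OF eigenstateD(1)[OF f, of d]] by auto
      define h where "h = min (e / 2) (d - x1)"
      have "0 < h" "h < e" "x1 \<le> d - h" using e \<open>x1 < d\<close> by (auto simp: h_def)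
      then show False using e(2)[of h] pos[of "d - h"] fd by simp
    qed
    then have "W d \<le> 0" using fd gd by (simp add: W_def mult_nonpos_nonneg)
    moreover have "W x1 < W d" using inc[of x1 d] \<open>x1 < d\<close> pos by simp
    ultimately show ?thesis by simp
  qed
  then show ?thesis by (simp add: W_def)
qed

locale confining =
  fixes V :: "real \<Rightarrow> real"
  assumes V_continuous: "continuous_on UNIV V"
    and V_large: "\<exists>R>0. \<forall>x. R \<le> \<bar>x\<bar> \<longrightarrow> M \<le> V x"
begin

lemma confining_reflect: "confining (\<lambda>x. V (- x))"
proof
  show "continuous_on UNIV (\<lambda>x. V (- x))"
    by (auto intro!: continuous_on_compose2[OF V_continuous] continuous_intros)
  show "\<exists>R>0. \<forall>x. R \<le> \<bar>x\<bar> \<longrightarrow> M \<le> V (- x)" for M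
    using V_large[of M] abs_minus by metis
qed

lemma V_large_right: obtains b where "0 < b" "\<And>x. b \<le> x \<Longrightarrow> M \<le> V x"
  using V_large[of M] by (metis abs_ge_self order_trans)

lemma sturm_contradiction:
  assumes f: "eigenstate V F f f'" and g: "eigenstate V G g g'" and FG: "F < G"
    and fx: "0 < f x1" and gx: "0 < g x1"
    and nz: "\<And>x. (\<And>y. y \<in> closed_segment x1 x \<Longrightarrow> f y \<noteq> 0) \<Longrightarrow> g x \<noteq> 0"
  shows False
proof -
  have no_zero: "0 < g x" if fpos: "\<And>y. y \<in> closed_segment x1 x \<Longrightarrow> 0 < f y" for x
  proof (rule ccontr)
    assume "\<not> 0 < g x"
    then have "0 \<in> closed_segment (g x1) (g x)" using gx by (simp add: closed_segment_eq_real_ivl)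
    then obtain y where y: "y \<in> closed_segment x1 x" "g y = 0"
      using IVT'_closed_segment_real[of 0 g x1 x] eigenstateD(5)[OF g] by metis
    have "closed_segment x1 y \<subseteq> closed_segment x1 x" using y by (simp add: subset_closed_segment)
    then show False using nz[of y] y fpos by (metis less_irrefl subsetD)
  qed
  obtain b where b: "\<And>x. b \<le> x \<Longrightarrow> G \<le> V x" using V_large_right by metis
  have 1: "f' x1 * g x1 < f x1 * g' x1"
  proof (rule sturm_right[OF f g FG b fx])
    fix x assume x: "x1 \<le> x" "\<And>y. y \<in> {x1..x} \<Longrightarrow> 0 < f y"
    show "0 < g x" by (rule no_zero) (use x in \<open>simp add: closed_segment_eq_real_ivl\<close>)
  qed
  interpret r: confining "\<lambda>x. V (- x)" by (rule confining_reflect)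
  obtain c where c: "\<And>x. c \<le> x \<Longrightarrow> G \<le> V (- x)" using r.V_large_right by metis
  have "- f' (- (- x1)) * g (- (- x1)) < f (- (- x1)) * - g' (- (- x1))"
  proof (rule sturm_right[OF eigenstate_reflect[OF f] eigenstate_reflect[OF g] FG c])
    fix x assume x: "- x1 \<le> x" "\<And>y. y \<in> {- x1..x} \<Longrightarrow> 0 < f (- y)"
    show "0 < g (- x)"
    proof (rule no_zero)
      fix y assume "y \<in> closed_segment x1 (- x)"
      then have "- y \<in> {- x1..x}" using x(1) by (auto simp: closed_segment_eq_real_ivl split: if_splits)
      from x(2)[OF this] show "0 < f y" by simp
    qed
  qed (use fx in auto)
  then show False using 1 by simp
qed

text \<open>
  Between \<open>x1\<close> and the ends of the nodal interval of \<open>f\<close> around it, finite or infinite, the state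
  of higher energy vanishes somewhere.
\<close>

lemma sturm_zero:
  assumes f: "eigenstate V F f f'" and g: "eigenstate V G g g'" and FG: "F < G" and fx: "f x1 \<noteq> 0"
  shows "\<exists>x. g x = 0 \<and> (\<forall>y\<in>closed_segment x1 x. f y \<noteq> 0)"
proof (cases "g x1 = 0")
  case True then show ?thesis using fx by (intro exI[of _ x1]) auto
next
  case False
  show ?thesis
  proof (rule ccontr)
    assume "\<not> ?thesis"
    then have *: "(\<And>y. y \<in> closed_segment x1 x \<Longrightarrow> f y \<noteq> 0) \<Longrightarrow> g x \<noteq> 0" for x by blast
    show False
      by (rule sturm_contradiction[OF eigenstate_scale[OF f, of "sgn (f x1)"]
              eigenstate_scale[OF g, of "sgn (g x1)"] FG, of x1])
         (use fx False * in \<open>auto simp: sgn_if split: if_splits\<close>)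
  qed
qed

lemma eigenstate_nonzero_in_interval:
  assumes f: "eigenstate V F f f'" and "a < b"
  shows "\<exists>x. a < x \<and> x < b \<and> f x \<noteq> 0"
proof (rule ccontr)
  assume "\<not> ?thesis"
  then have z: "f x = 0" if "a < x" "x < b" for x using that by blast
  obtain m where m: "a < m" "m < b" using \<open>a < b\<close> dense by blast
  have "f' m = 0"
    by (rule DERIV_local_const[OF eigenstateD(1)[OF f, of m], of "min (m - a) (b - m)"])
       (use m z in \<open>auto simp: abs_if split: if_splits\<close>)
  then show False using eigenstate_nontrivial_initial[OF f V_continuous, of m] z m by blast
qed

text \<open>
  \<open>card Z\<close> points cut the line into \<open>Suc (card Z)\<close> intervals, each of which contains a zero of
  \<open>g\<close>. Zeros of \<open>f\<close> outside \<open>Z\<close> do no harm: \<open>sturm_zero\<close> is applied at a point of the interval where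
  \<open>f\<close> does not vanish.
\<close>

lemma sturm_more_zeros:
  assumes f: "eigenstate V F f f'" and g: "eigenstate V G g g'" and FG: "F < G"
    and Z: "finite Z" "\<And>z. z \<in> Z \<Longrightarrow> f z = 0"
  shows "\<exists>Z'. finite Z' \<and> card Z' = Suc (card Z) \<and> (\<forall>z\<in>Z'. g z = 0)"
proof -
  have seg: "x < c" if "y < c" "f c = 0" "\<forall>w\<in>closed_segment y x. f w \<noteq> 0" for x y c
  proof (rule ccontr)
    assume "\<not> ?thesis"
    then have "c \<in> closed_segment y x" using that(1) by (auto simp: closed_segment_eq_real_ivl)
    then show False using that by blast
  qed
  have seg': "c < x" if "c < y" "f c = 0" "\<forall>w\<in>closed_segment y x. f w \<noteq> 0" for x y c
  proof (rule ccontr)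
    assume "\<not> ?thesis"
    then have "c \<in> closed_segment y x" using that(1) by (auto simp: closed_segment_eq_real_ivl)
    then show False using that by blast
  qed
  have left: "\<exists>Z'. finite Z' \<and> card Z' = card Z \<and> (\<forall>z\<in>Z'. g z = 0 \<and> (\<exists>w\<in>Z. z < w))"
    using Z
  proof (induction Z rule: finite_linorder_max_induct)
    case (insert c Z)
    then obtain Z' where Z': "finite Z'" "card Z' = card Z" "\<forall>z\<in>Z'. g z = 0 \<and> (\<exists>w\<in>Z. z < w)"
      by auto
    \<comment> \<open>For empty \<open>Z\<close> any point to the left of \<open>c\<close> serves as the left end of the interval.\<close>
    define l where "l = (if Z = {} then c - 1 else Max Z)"
    have lc: "l < c" using insert by (auto simp: l_def)
    obtain y where y: "l < y" "y < c" "f y \<noteq> 0" using eigenstate_nonzero_in_interval[OF f lc] by blast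
    obtain x where x: "g x = 0" "\<forall>w\<in>closed_segment y x. f w \<noteq> 0"
      using sturm_zero[OF f g FG y(3)] by blast
    have xc: "x < c" using seg[OF y(2) _ x(2)] insert by simp
    have "x \<notin> Z'"
    proof
      assume "x \<in> Z'"
      then obtain w where w: "w \<in> Z" "x < w" using Z' by blast
      then have "Z \<noteq> {}" by auto
      then have "l \<in> Z" "w \<le> l" using insert w by (auto simp: l_def)
      then have "l < x" using seg'[OF y(1) _ x(2)] insert by simp
      then show False using w \<open>w \<le> l\<close> by simp
    qed
    then show ?case using Z' xc x insert
      by (intro exI[of _ "insert x Z'"]) auto
  qed auto
  then obtain Z' where Z': "finite Z'" "card Z' = card Z" "\<forall>z\<in>Z'. g z = 0 \<and> (\<exists>w\<in>Z. z < w)" by blast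
  define l where "l = (if Z = {} then 0 else Max Z)"
  obtain y where y: "l < y" "y < l + 1" "f y \<noteq> 0" using eigenstate_nonzero_in_interval[OF f, of l "l + 1"] by auto
  obtain x where x: "g x = 0" "\<forall>w\<in>closed_segment y x. f w \<noteq> 0"
    using sturm_zero[OF f g FG y(3)] by blast
  have "x \<notin> Z'"
  proof
    assume "x \<in> Z'"
    then obtain w where w: "w \<in> Z" "x < w" using Z' by blast
    then have "Z \<noteq> {}" by auto
    then have "l \<in> Z" "w \<le> l" using Z w by (auto simp: l_def)
    then have "l < x" using seg'[OF y(1) _ x(2)] Z by simp
    then show False using w \<open>w \<le> l\<close> by simp
  qed
  then show ?thesis using Z' x by (intro exI[of _ "insert x Z'"]) auto
qed

text \<open>
  Adding the eigenvalues one at a time in increasing order gains one zero in each step.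
\<close>

lemma zeros_of_higher_eigenstate:
  assumes "finite S" "card S = k" "\<And>F. F \<in> S \<Longrightarrow> F < E \<and> (\<exists>f f'. eigenstate V F f f')"
    and "eigenstate V E g g'"
  shows "\<exists>Z. finite Z \<and> card Z = k \<and> (\<forall>z\<in>Z. g z = 0)"
  using assms
proof (induction k arbitrary: S E g g')
  case 0 then show ?case by (intro exI[of _ "{}"]) auto
next
  case (Suc k)
  define F where "F = Max S"
  have "S \<noteq> {}" using Suc.prems(2) by auto
  then have FS: "F \<in> S" using Suc.prems(1) by (simp add: F_def)
  then obtain f f' where f: "eigenstate V F f f'" and "F < E" using Suc.prems(3) by blast
  have "\<exists>Z. finite Z \<and> card Z = k \<and> (\<forall>z\<in>Z. f z = 0)"
  proof (rule Suc.IH[OF _ _ _ f])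
    show "finite (S - {F})" "card (S - {F}) = k" using Suc.prems(1,2) FS by simp_all
    fix G assume G: "G \<in> S - {F}"
    then have "G \<le> F" using Suc.prems(1) by (simp add: F_def)
    moreover have "G \<in> S" "G \<noteq> F" using G by auto
    ultimately show "G < F \<and> (\<exists>f f'. eigenstate V G f f')" using Suc.prems(3) by simp
  qed
  then obtain Z where Z: "finite Z" "card Z = k" "\<forall>z\<in>Z. f z = 0" by blast
  show ?case using sturm_more_zeros[OF f Suc.prems(4) \<open>F < E\<close> Z(1)] Z by auto
qed

end

text \<open>
  Let \<open>\<bar>f\<bar>\<close> be maximal at \<open>m\<close>. Then \<open>f' m = 0\<close> and \<open>\<bar>f''\<bar> \<le> E \<bar>f m\<bar>\<close>, so two applications of
  the mean value theorem bound \<open>\<bar>f m - f z\<bar> = \<bar>f m\<bar>\<close> by \<open>E \<bar>f m\<bar> (m - z)\<^sup>2\<close>.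
\<close>

lemma eigenstate_zero_spacing:
  assumes f: "eigenstate V E f f'" and z: "f z = 0" "f z' = 0" "z < z'"
    and V: "\<And>x. x \<in> {z..z'} \<Longrightarrow> 0 \<le> V x \<and> V x \<le> E" and nz: "\<exists>x\<in>{z..z'}. f x \<noteq> 0"
  shows "1 \<le> E * (z' - z)\<^sup>2"
proof -
  have c2: "continuous_on {z..z'} (\<lambda>x. (f x)\<^sup>2)" by (intro continuous_intros eigenstateD(5)[OF f])
  obtain m where m: "m \<in> {z..z'}" "\<And>x. x \<in> {z..z'} \<Longrightarrow> (f x)\<^sup>2 \<le> (f m)\<^sup>2"
    using continuous_attains_sup[OF compact_Icc _ c2] z(3) by auto
  have le: "\<bar>f x\<bar> \<le> \<bar>f m\<bar>" if "x \<in> {z..z'}" for x using m(2)[OF that] by (simp add: abs_le_square_iff)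
  have M: "0 < \<bar>f m\<bar>" using nz le by force
  then have mz: "z < m" "m < z'" using m z by (auto simp: order_less_le)
  have "2 * (f m * f' m) = 0"
    by (rule DERIV_local_max[OF DERIV_square[OF eigenstateD(1)[OF f]], of "min (m - z) (z' - m)"])
       (use mz m in \<open>auto simp: abs_if split: if_splits\<close>)
  then have f'm: "f' m = 0" using M by simp
  have E: "0 \<le> E" using V[of z] z by auto
  have bound: "\<bar>f' x\<bar> \<le> E * \<bar>f m\<bar> * (m - z)" if x: "z < x" "x < m" for x
  proof -
    obtain y where y: "x < y" "y < m" "f' m - f' x = (m - x) * ((V y - E) * f y)"
      using MVT2[OF x(2) eigenstateD(2)[OF f]] by blast
    have "\<bar>f' x\<bar> = \<bar>(m - x) * ((V y - E) * f y)\<bar>" using y(3) f'm by linarith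
    also have "\<dots> = (m - x) * (\<bar>V y - E\<bar> * \<bar>f y\<bar>)" using x by (simp add: abs_mult)
    also have "\<dots> \<le> (m - z) * (E * \<bar>f m\<bar>)"
      using V[of y] le[of y] x y mz E by (intro mult_mono) auto
    finally show ?thesis by (simp add: mult.commute)
  qed
  obtain x where x: "z < x" "x < m" "f m - f z = (m - z) * f' x"
    using MVT2[OF mz(1) eigenstateD(1)[OF f]] by blast
  have "\<bar>f m\<bar> = (m - z) * \<bar>f' x\<bar>" using x z by (simp add: abs_mult)
  also have "\<dots> \<le> (m - z) * (E * \<bar>f m\<bar> * (m - z))"
    using bound[OF x(1,2)] x by (intro mult_left_mono) auto
  finally have "\<bar>f m\<bar> * 1 \<le> \<bar>f m\<bar> * (E * (m - z)\<^sup>2)" by (simp add: power2_eq_square algebra_simps)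
  then have "1 \<le> E * (m - z)\<^sup>2" using M by simp
  also have "\<dots> \<le> E * (z' - z)\<^sup>2" using E mz by (intro mult_left_mono power_mono) auto
  finally show ?thesis .
qed

lemma card_separated_le:
  fixes Z :: "real set"
  assumes "finite Z" "Z \<noteq> {}" "\<And>z z'. z \<in> Z \<Longrightarrow> z' \<in> Z \<Longrightarrow> z < z' \<Longrightarrow> \<delta> \<le> z' - z"
    and "\<And>z. z \<in> Z \<Longrightarrow> l \<le> z \<and> z \<le> r"
  shows "(real (card Z) - 1) * \<delta> \<le> r - l"
proof -
  have "l + (real (card Z) - 1) * \<delta> \<le> Max Z"
    using assms
  proof (induction Z rule: finite_linorder_max_induct)
    case (insert b A)
    have Mb: "Max (insert b A) = b" using insert by (intro Max_eqI) auto
    show ?case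
    proof (cases "A = {}")
      case False
      have "l + (real (card A) - 1) * \<delta> \<le> Max A" using insert False by simp
      moreover have "\<delta> \<le> b - Max A" using insert False by simp
      moreover have "card (insert b A) = Suc (card A)" using insert by auto
      ultimately show ?thesis using Mb by (simp add: algebra_simps)
    qed (use insert in auto)
  qed auto
  moreover have "Max Z \<le> r" using assms by simp
  ultimately show ?thesis by simp
qed

section \<open>Global solutions of scalar differential equations\<close>

lemma abs_increment_le:
  fixes D g :: "real \<Rightarrow> real"
  assumes "a \<le> b"
    and "\<And>x. (D has_real_derivative D' x) (at x)" "\<And>x. (g has_real_derivative g' x) (at x)"
    and "\<And>x. a \<le> x \<Longrightarrow> x \<le> b \<Longrightarrow> \<bar>D' x\<bar> \<le> g' x"
  shows "\<bar>D b - D a\<bar> \<le> g b - g a"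
proof -
  have "(\<lambda>x. g x - D x) a \<le> (\<lambda>x. g x - D x) b"
    by (rule DERIV_nonneg_imp_nondecreasing[OF assms(1)])
       (use assms(2-4) in \<open>force intro!: derivative_intros simp: abs_le_iff\<close>)
  moreover have "(\<lambda>x. g x + D x) a \<le> (\<lambda>x. g x + D x) b"
  proof (rule DERIV_nonneg_imp_nondecreasing[OF assms(1)])
    fix x assume "a \<le> x" "x \<le> b"
    from assms(4)[OF this] have "0 \<le> g' x + D' x" by linarith
    then show "\<exists>y. ((\<lambda>x. g x + D x) has_real_derivative y) (at x) \<and> 0 \<le> y"
      using DERIV_add[OF assms(3,2)] by blast
  qed
  ultimately show ?thesis by (simp add: abs_le_iff)
qed

text \<open>
  Picard iteration on the whole line at once. With \<open>L\<close> a primitive of \<open>l\<close> and the weight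
  \<open>w = exp (2 * \<bar>L\<bar>)\<close>, the solution is sought as \<open>w\<close> times a bounded continuous function: the weight
  grows so fast that the integral operator contracts by the factor \<open>1/2\<close>.
\<close>

lemma global_solution_exists:
  fixes f :: "real \<Rightarrow> real \<Rightarrow> real"
  assumes l: "continuous_on UNIV l"
    and bound: "\<And>x y. \<bar>f x y\<bar> \<le> l x"
    and lip: "\<And>x y z. \<bar>f x y - f x z\<bar> \<le> l x * \<bar>y - z\<bar>"
    and cont: "\<And>y. continuous_on UNIV y \<Longrightarrow> continuous_on UNIV (\<lambda>x. f x (y x))"
  obtains \<theta> where "\<theta> x0 = t" "\<And>x. (\<theta> has_real_derivative f x (\<theta> x)) (at x)"
proof -
  have l0: "0 \<le> l x" for x using bound[of x 0] by linarith
  define L where "L = antiderivative x0 l"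
  have L': "(L has_real_derivative l x) (at x)" for x unfolding L_def by (rule DERIV_antiderivative[OF l])
  have L0: "L x0 = 0" by (simp add: L_def)
  have Lmono: "L x \<le> L y" if "x \<le> y" for x y
    by (rule DERIV_nonneg_imp_nondecreasing[OF that]) (use L' l0 in blast)
  have Lc: "continuous_on UNIV L" using DERIV_isCont[OF L'] by (auto intro: continuous_at_imp_continuous_on)
  define w where "w x = exp (2 * \<bar>L x\<bar>)" for x
  have w1: "1 \<le> w x" and wL: "\<bar>L x\<bar> \<le> w x" for x
    using exp_ge_add_one_self[of "2 * \<bar>L x\<bar>"] abs_ge_zero[of "L x"] unfolding w_def by linarith+
  have wc: "continuous_on UNIV w" unfolding w_def by (intro continuous_intros Lc)
  define I where "I y = antiderivative x0 (\<lambda>x. f x (w x * apply_bcontfun y x))" for y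
  have cf: "continuous_on UNIV (\<lambda>x. f x (w x * apply_bcontfun y x))" for y
    by (intro cont continuous_intros wc continuous_on_apply_bcontfun)
  have I': "(I y has_real_derivative f x (w x * apply_bcontfun y x)) (at x)" for y x
    unfolding I_def by (rule DERIV_antiderivative[OF cf])
  have I0: "I y x0 = 0" for y by (simp add: I_def)
  have Ic: "continuous_on UNIV (I y)" for y
    using DERIV_isCont[OF I'] by (auto intro: continuous_at_imp_continuous_on)
  have Ib: "\<bar>I y x\<bar> \<le> \<bar>L x\<bar>" for y x
  proof (cases "x0 \<le> x")
    case True
    have "\<bar>I y x - I y x0\<bar> \<le> L x - L x0" using abs_increment_le[OF True I' L'] bound by blast
    then show ?thesis using I0 L0 by simp
  next
    case False
    have "\<bar>I y x0 - I y x\<bar> \<le> L x0 - L x" by (rule abs_increment_le[OF _ I' L']) (use bound False in auto)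
    then show ?thesis using I0 L0 by simp
  qed
  define T where "T y x = (t + I y x) / w x" for y x
  have Tb: "T y \<in> bcontfun" for y
  proof (rule bcontfun_normI)
    show "continuous_on UNIV (T y)" unfolding T_def
      by (intro continuous_intros Ic wc) (use w1 in \<open>metis not_one_le_zero\<close>)
    fix x
    have "\<bar>t + I y x\<bar> \<le> \<bar>t\<bar> * w x + w x"
      using Ib[of y x] wL[of x] mult_left_mono[OF w1[of x], of "\<bar>t\<bar>"] by linarith
    then show "norm (T y x) \<le> \<bar>t\<bar> + 1"
      using w1[of x] by (simp add: T_def field_simps abs_if split: if_splits)
  qed
  have app: "apply_bcontfun (Bcontfun (T y)) = T y" for y using Tb by (rule Bcontfun_inverse)
  have diff: "\<bar>I y x - I z x\<bar> \<le> dist y z / 2 * w x" for y z x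
  proof -
    let ?d = "dist y z"
    have D': "((\<lambda>x. I y x - I z x) has_real_derivative
        f x (w x * apply_bcontfun y x) - f x (w x * apply_bcontfun z x)) (at x)" for x
      by (intro DERIV_diff I')
    have le: "\<bar>f x (w x * apply_bcontfun y x) - f x (w x * apply_bcontfun z x)\<bar> \<le> l x * w x * ?d" for x
    proof -
      have "\<bar>w x * apply_bcontfun y x - w x * apply_bcontfun z x\<bar> = w x * dist (apply_bcontfun y x) (apply_bcontfun z x)"
        using w1[of x] by (simp add: dist_real_def right_diff_distrib[symmetric] abs_mult)
      also have "\<dots> \<le> w x * ?d" using w1[of x] by (intro mult_left_mono dist_bounded) auto
      finally have "l x * \<bar>w x * apply_bcontfun y x - w x * apply_bcontfun z x\<bar> \<le> l x * (w x * ?d)"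
        using l0 by (intro mult_left_mono)
      then show ?thesis using lip[of x "w x * apply_bcontfun y x" "w x * apply_bcontfun z x"]
        by (simp add: mult.assoc)
    qed
    show ?thesis
    proof (cases "x0 \<le> x")
      case True
      have "\<bar>(I y x - I z x) - (I y x0 - I z x0)\<bar>
          \<le> ?d / 2 * exp (2 * L x) - ?d / 2 * exp (2 * L x0)"
      proof (rule abs_increment_le[OF True D'])
        show "((\<lambda>x. ?d / 2 * exp (2 * L x)) has_real_derivative l x * exp (2 * L x) * ?d) (at x)" for x
          by (rule derivative_eq_intros L' refl)+ simp
        show "\<bar>f s (w s * apply_bcontfun y s) - f s (w s * apply_bcontfun z s)\<bar> \<le> l s * exp (2 * L s) * ?d"
          if "x0 \<le> s" for s using le[of s] Lmono[OF that] L0 by (simp add: w_def)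
      qed
      also have "\<dots> \<le> ?d / 2 * exp (2 * L x)" by simp
      also have "exp (2 * L x) = w x" using Lmono[OF True] L0 by (simp add: w_def)
      finally show ?thesis using I0 by simp
    next
      case False
      then have "x \<le> x0" by simp
      have "\<bar>(I y x0 - I z x0) - (I y x - I z x)\<bar>
          \<le> - (?d / 2) * exp (- 2 * L x0) - - (?d / 2) * exp (- 2 * L x)"
      proof (rule abs_increment_le[OF \<open>x \<le> x0\<close> D'])
        show "((\<lambda>x. - (?d / 2) * exp (- 2 * L x)) has_real_derivative l x * exp (- 2 * L x) * ?d) (at x)" for x
          by (rule derivative_eq_intros L' refl)+ simp
        show "\<bar>f s (w s * apply_bcontfun y s) - f s (w s * apply_bcontfun z s)\<bar> \<le> l s * exp (- 2 * L s) * ?d"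
          if "s \<le> x0" for s using le[of s] Lmono[OF that] L0 by (simp add: w_def)
      qed
      also have "\<dots> \<le> ?d / 2 * exp (- 2 * L x)" by simp
      also have "exp (- 2 * L x) = w x" using Lmono[OF \<open>x \<le> x0\<close>] L0 by (simp add: w_def)
      finally show ?thesis using I0 by (simp add: abs_minus_commute)
    qed
  qed
  have "dist (Bcontfun (T y)) (Bcontfun (T z)) \<le> 1/2 * dist y z" for y z
  proof (rule dist_bound)
    fix x
    have "dist (T y x) (T z x) = \<bar>I y x - I z x\<bar> / w x"
      using w1[of x] by (simp add: T_def dist_real_def diff_divide_distrib[symmetric] abs_divide)
    also have "\<dots> \<le> 1/2 * dist y z"
      using diff[of y x z] w1[of x] by (simp add: divide_le_eq)
    finally show "dist (apply_bcontfun (Bcontfun (T y)) x) (apply_bcontfun (Bcontfun (T z)) x) \<le> 1/2 * dist y z"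
      by (simp add: app)
  qed
  then obtain y where "Bcontfun (T y) = y"
    using banach_fix_type[of "1/2" "\<lambda>y. Bcontfun (T y)"] by auto
  then have fp: "T y = apply_bcontfun y" using app by metis
  have eq: "w x * apply_bcontfun y x = t + I y x" for x
    using w1[of x] unfolding fp[symmetric] T_def by simp
  have "((\<lambda>x. t + I y x) has_real_derivative f x (t + I y x)) (at x)" for x
    using DERIV_add[OF DERIV_const I', of t y x] eq[of x] by simp
  then show ?thesis using that[of "\<lambda>x. t + I y x"] I0 by simp
qed

text \<open>
  A barrier argument: at its last zero before a negative value the function would have to leave \<open>0\<close> downwards,
  against the sign of its derivative.
\<close>

lemma crosses_zero_upwards:
  fixes g :: "real \<Rightarrow> real"
  assumes "a \<le> b" "0 \<le> g a" and g: "\<And>x. (g has_real_derivative g' x) (at x)"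
    and up: "\<And>x. a \<le> x \<Longrightarrow> x \<le> b \<Longrightarrow> g x = 0 \<Longrightarrow> 0 < g' x"
  shows "0 \<le> g b" and "a < b \<Longrightarrow> 0 < g b"
proof -
  have gc: "continuous_on A g" for A using DERIV_isCont[OF g] by (auto intro: continuous_at_imp_continuous_on)
  have nonneg: "0 \<le> g c" if "a \<le> c" "c \<le> b" for c
  proof (rule ccontr)
    assume neg: "\<not> 0 \<le> g c"
    define S where "S = {a..c} \<inter> g -` {0..}"
    have "closed S" unfolding S_def
      by (rule continuous_closed_vimage[THEN closed_Int[OF closed_atLeastAtMost]])
         (use DERIV_isCont[OF g] in auto)
    moreover have "a \<in> S" using assms that by (simp add: S_def)
    then have "S \<noteq> {}" "bdd_above S" by (auto simp: S_def)
    ultimately have sS: "Sup S \<in> S" by (rule closed_contains_Sup[rotated 2])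
    define s where "s = Sup S"
    have s: "a \<le> s" "s \<le> c" "0 \<le> g s" using sS by (auto simp: S_def s_def)
    then have "s < c" using neg by (cases "s = c") auto
    have after: "g y < 0" if "s < y" "y \<le> c" for y
    proof (rule ccontr)
      assume "\<not> g y < 0"
      then have "y \<in> S" using that s by (simp add: S_def)
      then show False using cSup_upper[OF _ \<open>bdd_above S\<close>] that by (fastforce simp: s_def)
    qed
    have "g s = 0"
    proof (rule ccontr)
      assume "g s \<noteq> 0"
      then obtain y where "s \<le> y" "y \<le> c" "g y = 0"
        using IVT2'[of g c 0 s] s neg gc by (metis less_eq_real_def not_le)
      then show False using after[of y] \<open>g s \<noteq> 0\<close> by (cases "y = s") auto
    qed
    then have "0 < g' s" using up s that by simp
    then obtain e where e: "0 < e" "\<And>h. 0 < h \<Longrightarrow> h < e \<Longrightarrow> g s < g (s + h)"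
      using DERIV_pos_inc_right[OF g[of s]] by auto
    define h where "h = min (e / 2) (c - s)"
    have "0 < h" "h < e" "s + h \<le> c" using e \<open>s < c\<close> by (auto simp: h_def)
    then show False using e(2)[of h] after[of "s + h"] \<open>g s = 0\<close> by simp
  qed
  show "0 \<le> g b" using nonneg assms by simp
  assume "a < b"
  show "0 < g b"
  proof (rule ccontr)
    assume "\<not> 0 < g b"
    then have gb: "g b = 0" using \<open>0 \<le> g b\<close> by simp
    then have "0 < g' b" using up assms(1) by simp
    then obtain e where e: "0 < e" "\<And>h. 0 < h \<Longrightarrow> h < e \<Longrightarrow> g (b - h) < g b"
      using DERIV_pos_inc_left[OF g[of b]] by auto
    define h where "h = min (e / 2) (b - a)"
    have "0 < h" "h < e" "a \<le> b - h" using e \<open>a < b\<close> by (auto simp: h_def)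
    then show False using e(2)[of h] nonneg[of "b - h"] gb by simp
  qed
qed

lemma crosses_zero_upwards_back:
  fixes g :: "real \<Rightarrow> real"
  assumes "a \<le> b" "g b \<le> 0" and g: "\<And>x. (g has_real_derivative g' x) (at x)"
    and up: "\<And>x. a \<le> x \<Longrightarrow> x \<le> b \<Longrightarrow> g x = 0 \<Longrightarrow> 0 < g' x"
  shows "g a \<le> 0"
proof -
  have "((\<lambda>x. - g (- x)) has_real_derivative g' (- x)) (at x)" for x
    using DERIV_minus[OF DERIV_mirror[THEN iffD1, OF g[of "- x"]]] by simp
  from crosses_zero_upwards(1)[of "- b" "- a" "\<lambda>x. - g (- x)", OF _ _ this]
  show ?thesis using assms by force
qed

text \<open>
  Monotone convergence along the intervals \<open>{-k..k}\<close>.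
\<close>

lemma integral_UNIV_bounded:
  fixes g :: "real \<Rightarrow> real"
  assumes g: "continuous_on UNIV g" "\<And>x. 0 \<le> g x"
    and B: "\<And>k::nat. integral {- real k..real k} g \<le> B"
  shows "g integrable_on UNIV" and "integral UNIV g \<le> B"
proof -
  define f where "f k x = (if x \<in> {- real k..real k} then g x else 0)" for k :: nat and x
  have gi: "g integrable_on {a..b}" for a b
    by (intro integrable_continuous_real continuous_on_subset[OF g(1)]) auto
  have int: "integral UNIV (f k) = integral {- real k..real k} g" for k
    unfolding f_def by (rule integral_restrict_UNIV)
  have lim: "g integrable_on UNIV \<and> ((\<lambda>k. integral UNIV (f k)) \<longlongrightarrow> integral UNIV g) sequentially"
  proof (rule monotone_convergence_increasing)
    show "f k integrable_on UNIV" for k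
      unfolding f_def integrable_restrict_UNIV by (rule gi)
    show "f k x \<le> f (Suc k) x" for k x using g(2) by (auto simp: f_def)
    show "(\<lambda>k. f k x) \<longlonglongrightarrow> g x" for x
    proof (rule tendsto_eventually)
      obtain n where "\<bar>x\<bar> \<le> real n" using real_arch_simple by blast
      then show "\<forall>\<^sub>F k in sequentially. f k x = g x"
        by (intro eventually_sequentiallyI[of n]) (auto simp: f_def)
    qed
    show "bounded (range (\<lambda>k. integral UNIV (f k)))"
      unfolding bounded_iff
    proof (intro exI[of _ B] ballI)
      fix y assume "y \<in> range (\<lambda>k. integral UNIV (f k))"
      then obtain k :: nat where "y = integral {- real k..real k} g" using int by auto
      then show "norm y \<le> B" using B[of k] integral_nonneg[OF gi g(2)] by simp
    qed
  qed
  then show "g integrable_on UNIV" by simp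
  show "integral UNIV g \<le> B" using lim B by (intro LIMSEQ_le_const2[of "\<lambda>k. integral UNIV (f k)"]) (auto simp: int)
qed

section \<open>Pruefer angles\<close>

text \<open>
  For a solution of \<open>u'' = (V - F) u\<close> written as \<open>u = r sin \<theta>\<close>, \<open>u' = r cos \<theta>\<close>, the angle satisfies
  \<open>\<theta>' = (cos \<theta>)\<^sup>2 + (F - V) (sin \<theta>)\<^sup>2\<close>; below, the cosine is eliminated.
\<close>

definition prufer_angle :: "(real \<Rightarrow> real) \<Rightarrow> real \<Rightarrow> (real \<Rightarrow> real) \<Rightarrow> bool" where
  "prufer_angle V F \<theta> \<longleftrightarrow>
     (\<forall>x. (\<theta> has_real_derivative 1 + (F - V x - 1) * (sin (\<theta> x))\<^sup>2) (at x))"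

lemma prufer_angleD:
  "prufer_angle V F \<theta> \<Longrightarrow> (\<theta> has_real_derivative 1 + (F - V x - 1) * (sin (\<theta> x))\<^sup>2) (at x)"
  by (simp add: prufer_angle_def)

lemma sin_square_diff_le: "\<bar>(sin a)\<^sup>2 - (sin b)\<^sup>2\<bar> \<le> \<bar>a - b\<bar>" for a b :: real
proof -
  have "(sin a)\<^sup>2 - (sin b)\<^sup>2 = sin (a + b) * sin (a - b)"
    unfolding sin_add sin_diff using sin_cos_squared_add[of a] sin_cos_squared_add[of b] by algebra
  also have "\<bar>\<dots>\<bar> \<le> 1 * \<bar>a - b\<bar>"
    unfolding abs_mult by (intro mult_mono abs_sin_le_one abs_sin_x_le_abs_x) auto
  finally show ?thesis by simp
qed

lemma abs_mult_sin_square_le: "\<bar>c * (sin y)\<^sup>2\<bar> \<le> \<bar>c\<bar>" for c y :: real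
proof -
  have "(sin y)\<^sup>2 \<le> 1" using sin_cos_squared_add[of y] zero_le_power2[of "cos y"] by linarith
  then show ?thesis using mult_left_mono[of "(sin y)\<^sup>2" 1 "\<bar>c\<bar>"] by (simp add: abs_mult)
qed

lemma prufer_angle_exists:
  assumes V: "continuous_on UNIV V"
  obtains \<theta> where "prufer_angle V F \<theta>" "\<theta> x0 = t"
proof -
  define l where "l x = 1 + \<bar>F - V x - 1\<bar>" for x
  define f where "f x y = 1 + (F - V x - 1) * (sin y)\<^sup>2" for x y
  have b: "\<bar>f x y\<bar> \<le> l x" for x y
    using abs_mult_sin_square_le[of "F - V x - 1" y] unfolding f_def l_def by linarith
  have lip: "\<bar>f x y - f x z\<bar> \<le> l x * \<bar>y - z\<bar>" for x y z
  proof -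
    have "\<bar>f x y - f x z\<bar> = \<bar>F - V x - 1\<bar> * \<bar>(sin y)\<^sup>2 - (sin z)\<^sup>2\<bar>"
      by (simp add: f_def abs_mult[symmetric] algebra_simps)
    also have "\<dots> \<le> l x * \<bar>y - z\<bar>"
      unfolding l_def by (intro mult_mono sin_square_diff_le) auto
    finally show ?thesis .
  qed
  show ?thesis
  proof (rule global_solution_exists[of l f x0 t])
    show "continuous_on UNIV l" unfolding l_def by (intro continuous_intros V)
    show "continuous_on UNIV (\<lambda>x. f x (y x))" if "continuous_on UNIV y" for y
      unfolding f_def by (intro continuous_intros V that)
    fix \<theta> assume "\<theta> x0 = t" and d: "\<And>x. (\<theta> has_real_derivative f x (\<theta> x)) (at x)"
    moreover have "prufer_angle V F \<theta>" unfolding prufer_angle_def using d by (simp add: f_def)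
    ultimately show thesis using that by blast
  qed (fact b lip)+
qed

text \<open>
  Gronwall's estimate for \<open>(\<theta> - \<phi>)\<^sup>2 + (F - G)\<^sup>2\<close>. It gives uniqueness as well as continuity in the
  initial value and in the energy.
\<close>

lemma prufer_angle_dependence:
  assumes th: "prufer_angle V F \<theta>" and ph: "prufer_angle V G \<phi>"
    and B: "\<And>s. s \<in> closed_segment x0 x \<Longrightarrow> \<bar>F - V s - 1\<bar> \<le> B"
  shows "(\<theta> x - \<phi> x)\<^sup>2 + (F - G)\<^sup>2 \<le> exp ((2 * B + 1) * \<bar>x - x0\<bar>) * ((\<theta> x0 - \<phi> x0)\<^sup>2 + (F - G)\<^sup>2)"
proof (rule gronwall)
  fix s assume s: "s \<in> closed_segment x0 x"
  define d where "d = (F - V s - 1) * ((sin (\<theta> s))\<^sup>2 - (sin (\<phi> s))\<^sup>2) + (F - G) * (sin (\<phi> s))\<^sup>2"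
  have "((\<lambda>s. \<theta> s - \<phi> s) has_real_derivative d) (at s)"
    using DERIV_diff[OF prufer_angleD[OF th] prufer_angleD[OF ph], of s]
    by (rule DERIV_cong) (simp add: d_def algebra_simps)
  from DERIV_add[OF DERIV_square[OF this] DERIV_const]
  show "((\<lambda>s. (\<theta> s - \<phi> s)\<^sup>2 + (F - G)\<^sup>2) has_real_derivative 2 * ((\<theta> s - \<phi> s) * d) + 0) (at s)" .
  have "\<bar>(F - V s - 1) * ((sin (\<theta> s))\<^sup>2 - (sin (\<phi> s))\<^sup>2)\<bar> \<le> B * \<bar>\<theta> s - \<phi> s\<bar>"
    unfolding abs_mult using B[OF s] sin_square_diff_le by (intro mult_mono) auto
  moreover have "\<bar>(F - G) * (sin (\<phi> s))\<^sup>2\<bar> \<le> \<bar>F - G\<bar>" by (rule abs_mult_sin_square_le)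
  ultimately have "\<bar>d\<bar> \<le> B * \<bar>\<theta> s - \<phi> s\<bar> + \<bar>F - G\<bar>" unfolding d_def by linarith
  then have "\<bar>\<theta> s - \<phi> s\<bar> * \<bar>d\<bar> \<le> \<bar>\<theta> s - \<phi> s\<bar> * (B * \<bar>\<theta> s - \<phi> s\<bar> + \<bar>F - G\<bar>)"
    by (intro mult_left_mono) auto
  also have "\<dots> = B * (\<bar>\<theta> s - \<phi> s\<bar>)\<^sup>2 + \<bar>\<theta> s - \<phi> s\<bar> * \<bar>F - G\<bar>"
    by algebra
  also have "(\<bar>\<theta> s - \<phi> s\<bar>)\<^sup>2 = (\<theta> s - \<phi> s)\<^sup>2" by (rule power2_abs)
  finally have "2 * (\<bar>\<theta> s - \<phi> s\<bar> * \<bar>d\<bar>) \<le> 2 * B * (\<theta> s - \<phi> s)\<^sup>2 + 2 * \<bar>\<theta> s - \<phi> s\<bar> * \<bar>F - G\<bar>"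
    by simp
  also have "2 * \<bar>\<theta> s - \<phi> s\<bar> * \<bar>F - G\<bar> \<le> (\<theta> s - \<phi> s)\<^sup>2 + (F - G)\<^sup>2"
    using sum_squares_bound[of "\<bar>\<theta> s - \<phi> s\<bar>" "\<bar>F - G\<bar>"] by simp
  finally have "2 * (\<bar>\<theta> s - \<phi> s\<bar> * \<bar>d\<bar>) \<le> 2 * B * (\<theta> s - \<phi> s)\<^sup>2 + ((\<theta> s - \<phi> s)\<^sup>2 + (F - G)\<^sup>2)"
    by simp
  moreover have "0 \<le> 2 * B * (F - G)\<^sup>2"
  proof -
    have "0 \<le> B" using B[OF s] by linarith
    then show ?thesis by simp
  qed
  moreover have "\<bar>2 * ((\<theta> s - \<phi> s) * d) + 0\<bar> = 2 * (\<bar>\<theta> s - \<phi> s\<bar> * \<bar>d\<bar>)" by (simp add: abs_mult)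
  ultimately show "\<bar>2 * ((\<theta> s - \<phi> s) * d) + 0\<bar> \<le> (2 * B + 1) * ((\<theta> s - \<phi> s)\<^sup>2 + (F - G)\<^sup>2)"
    unfolding distrib_right distrib_left by linarith
qed

lemma prufer_angle_shift:
  assumes "prufer_angle V F \<theta>" shows "prufer_angle V F (\<lambda>x. \<theta> x - real k * pi)"
proof -
  have s: "(sin (y - real k * pi))\<^sup>2 = (sin y)\<^sup>2" for y :: real
  proof -
    have "((- 1) ^ k)\<^sup>2 = (1 :: real)" by (simp add: power2_eq_square flip: power_mult_distrib)
    then show ?thesis by (simp add: sin_diff power_mult_distrib)
  qed
  show ?thesis
    unfolding prufer_angle_def s
  proof
    show "((\<lambda>x. \<theta> x - real k * pi) has_real_derivative 1 + (F - V x - 1) * (sin (\<theta> x))\<^sup>2) (at x)" for x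
      using DERIV_diff[OF prufer_angleD[OF assms] DERIV_const] by simp
  qed
qed

text \<open>
  At multiples of \<open>\<pi>\<close> the angle has derivative \<open>1\<close>, so it passes them only upwards: the number of
  completed half turns never decreases.
\<close>

lemma prufer_angle_ge_multiple_pi:
  assumes "prufer_angle V F \<theta>" "a \<le> b" "real k * pi \<le> \<theta> a"
  shows "real k * pi \<le> \<theta> b"
proof -
  have "0 \<le> \<theta> b - real k * pi"
    by (rule crosses_zero_upwards(1)[OF \<open>a \<le> b\<close> _ prufer_angleD[OF prufer_angle_shift[OF assms(1)]]])
       (use assms in auto)
  then show ?thesis by simp
qed

definition prufer_radius ::
  "(real \<Rightarrow> real) \<Rightarrow> real \<Rightarrow> (real \<Rightarrow> real) \<Rightarrow> (real \<Rightarrow> real) \<Rightarrow> bool" where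
  "prufer_radius V F \<theta> r \<longleftrightarrow> (\<forall>x. 0 < r x) \<and>
     (\<forall>x. ((\<lambda>x. r x * sin (\<theta> x)) has_real_derivative r x * cos (\<theta> x)) (at x)) \<and>
     (\<forall>x. ((\<lambda>x. r x * cos (\<theta> x)) has_real_derivative (V x - F) * (r x * sin (\<theta> x))) (at x))"

lemma prufer_radiusD:
  assumes "prufer_radius V F \<theta> r"
  shows "0 < r x"
    and "((\<lambda>x. r x * sin (\<theta> x)) has_real_derivative r x * cos (\<theta> x)) (at x)"
    and "((\<lambda>x. r x * cos (\<theta> x)) has_real_derivative (V x - F) * (r x * sin (\<theta> x))) (at x)"
  using assms by (simp_all add: prufer_radius_def)

text \<open>
  The radius solves the linear equation \<open>r' = (1 - F + V) sin \<theta> cos \<theta> r\<close>, so it is an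
  exponential.
\<close>

lemma prufer_radius_exists:
  assumes V: "continuous_on UNIV V" and th: "prufer_angle V F \<theta>"
  shows "\<exists>r. prufer_radius V F \<theta> r"
proof -
  have cth: "continuous_on UNIV \<theta>"
    using DERIV_isCont[OF prufer_angleD[OF th]] by (auto intro: continuous_at_imp_continuous_on)
  define q where "q x = (1 - F + V x) * sin (\<theta> x) * cos (\<theta> x)" for x
  have "continuous_on UNIV q" unfolding q_def by (intro continuous_intros V cth)
  then have Q: "(antiderivative 0 q has_real_derivative q x) (at x)" for x by (rule DERIV_antiderivative)
  define r where "r x = exp (antiderivative 0 q x)" for x
  have r: "(r has_real_derivative r x * q x) (at x)" for x
    unfolding r_def by (rule DERIV_fun_exp[OF Q])
  have alg: "R * p * S + C * (1 + (F - v - 1) * S\<^sup>2) * R = R * C"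
    "R * p * C + - S * (1 + (F - v - 1) * S\<^sup>2) * R = (v - F) * (R * S)"
    if "p = (1 - F + v) * S * C" "S\<^sup>2 + C\<^sup>2 = 1" for R S C p v :: real
    using that by algebra+
  show ?thesis
    unfolding prufer_radius_def
  proof (intro exI[of _ r] conjI allI)
    show "0 < r x" for x by (simp add: r_def)
    fix x
    note alg' = alg[of "q x" "V x" "sin (\<theta> x)" "cos (\<theta> x)" "r x", OF _ sin_cos_squared_add]
    show "((\<lambda>x. r x * sin (\<theta> x)) has_real_derivative r x * cos (\<theta> x)) (at x)"
      using DERIV_mult[OF r[of x] DERIV_fun_sin[OF prufer_angleD[OF th, of x]]]
      by (rule DERIV_cong) (rule alg'(1), simp add: q_def)
    show "((\<lambda>x. r x * cos (\<theta> x)) has_real_derivative (V x - F) * (r x * sin (\<theta> x))) (at x)"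
      using DERIV_mult[OF r[of x] DERIV_fun_cos[OF prufer_angleD[OF th, of x]]]
      by (rule DERIV_cong) (rule alg'(2), simp add: q_def)
  qed
qed

text \<open>
  Comparison with \<open>sin (s * (x - a))\<close>, which solves \<open>S'' = - s\<^sup>2 S\<close>: if the angle stayed below the next
  multiple of \<open>\<pi>\<close>, the solution would keep its sign over a full half period, against the sign of the
  Wronskian at the two ends.
\<close>

lemma prufer_angle_advances:
  assumes V: "continuous_on UNIV V" and th: "prufer_angle V E \<theta>" and s: "0 < s"
    and VE: "\<And>x. x \<in> {a..a + pi / s} \<Longrightarrow> V x \<le> E - s\<^sup>2" and a: "real k * pi \<le> \<theta> a"
  shows "real (Suc k) * pi \<le> \<theta> (a + pi / s)"
proof (rule ccontr)
  define b where "b = a + pi / s"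
  assume "\<not> ?thesis"
  then have lt: "\<theta> b < real (Suc k) * pi" by (simp add: b_def)
  define \<phi> where "\<phi> x = \<theta> x - real k * pi" for x
  have ph: "prufer_angle V E \<phi>" unfolding \<phi>_def by (rule prufer_angle_shift[OF th])
  have ab: "a < b" using s by (simp add: b_def)
  have range: "0 \<le> \<phi> x" "\<phi> x < pi" if "a \<le> x" "x \<le> b" for x
  proof -
    show "0 \<le> \<phi> x" using prufer_angle_ge_multiple_pi[OF th that(1) a] by (simp add: \<phi>_def)
    have "\<not> real (Suc k) * pi \<le> \<theta> x"
      using prufer_angle_ge_multiple_pi[OF th that(2), of "Suc k"] lt by linarith
    then show "\<phi> x < pi" by (simp add: \<phi>_def algebra_simps)
  qed
  have "0 < \<phi> b"
    by (rule crosses_zero_upwards(2)[OF _ _ prufer_angleD[OF ph] _ ab]) (use range ab in auto)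
  obtain r where "prufer_radius V E \<phi> r" using prufer_radius_exists[OF V ph] ..
  note r = prufer_radiusD[OF this]
  define S where "S x = sin (s * (x - a))" for x
  define C where "C x = s * cos (s * (x - a))" for x
  have S: "(S has_real_derivative C x) (at x)" "(C has_real_derivative - (s\<^sup>2) * S x) (at x)" for x
  proof -
    have l: "((\<lambda>x. s * (x - a)) has_real_derivative s) (at x)"
      by (rule derivative_eq_intros refl)+ simp
    show "(S has_real_derivative C x) (at x)"
      unfolding S_def C_def using DERIV_fun_sin[OF l] by (simp add: mult.commute)
    show "(C has_real_derivative - (s\<^sup>2) * S x) (at x)"
      unfolding S_def C_def using DERIV_cmult[OF DERIV_fun_cos[OF l], of s]
      by (rule DERIV_cong) (simp add: power2_eq_square)
  qed
  define W where "W x = r x * cos (\<phi> x) * S x - r x * sin (\<phi> x) * C x" for x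
  have "W b \<le> W a"
  proof (rule DERIV_nonpos_imp_nonincreasing[OF less_imp_le[OF ab]])
    fix x assume x: "a \<le> x" "x \<le> b"
    have "(W has_real_derivative (V x - E + s\<^sup>2) * (r x * sin (\<phi> x) * S x)) (at x)"
      unfolding W_def
      using DERIV_diff[OF DERIV_mult[OF r(3)[of x] S(1)[of x]] DERIV_mult[OF r(2)[of x] S(2)[of x]]]
      by (rule DERIV_cong) (simp only: algebra_simps)
    moreover have "0 \<le> sin (\<phi> x)" using range[OF x] by (intro sin_ge_zero) auto
    moreover have "s * (x - a) \<le> s * (pi / s)" using x s by (intro mult_left_mono) (auto simp: b_def)
    then have "0 \<le> S x" unfolding S_def using x s by (intro sin_ge_zero) auto
    moreover have "V x - E + s\<^sup>2 \<le> 0" using VE[of x] x by (simp add: b_def)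
    ultimately show "\<exists>y. (W has_real_derivative y) (at x) \<and> y \<le> 0"
      using r(1)[of x] by (intro exI[of _ "(V x - E + s\<^sup>2) * (r x * sin (\<phi> x) * S x)"])
        (simp add: mult_nonpos_nonneg)
  qed
  moreover have "W a \<le> 0"
    using r(1)[of a] s range[of a] ab sin_ge_zero[of "\<phi> a"] by (simp add: W_def S_def C_def)
  moreover have "W b = s * (r b * sin (\<phi> b))"
    using s by (simp add: W_def S_def C_def b_def)
  moreover have "0 < sin (\<phi> b)"
    using \<open>0 < \<phi> b\<close> range[of b] ab by (intro sin_gt_zero) auto
  then have "0 < s * (r b * sin (\<phi> b))" using s r(1)[of b] by simp
  ultimately show False by linarith
qed

section \<open>Existence of eigenvalues\<close>

lemma prufer_angle_continuous_in_parameter: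
  assumes V: "continuous_on UNIV V" and th: "\<And>F. prufer_angle V F (\<theta> F)" "\<And>F. \<theta> F x0 = t"
  shows "continuous_on {a..b} (\<lambda>F. \<theta> F x)"
proof -
  obtain B where B: "0 < B" "\<And>s. s \<in> {min x0 x..max x0 x} \<Longrightarrow> \<bar>V s\<bar> \<le> B"
    using continuous_on_Icc_bounded[OF continuous_on_subset[OF V subset_UNIV]] by blast
  define K where "K = exp ((2 * (\<bar>a\<bar> + \<bar>b\<bar> + B + 1) + 1) * \<bar>x - x0\<bar>)"
  have lip: "\<bar>\<theta> F x - \<theta> G x\<bar> \<le> sqrt K * \<bar>F - G\<bar>" if F: "F \<in> {a..b}" for F G
  proof -
    have "(\<theta> F x - \<theta> G x)\<^sup>2 + (F - G)\<^sup>2 \<le> K * ((\<theta> F x0 - \<theta> G x0)\<^sup>2 + (F - G)\<^sup>2)"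
      unfolding K_def
    proof (rule prufer_angle_dependence[OF th(1) th(1)])
      fix s assume "s \<in> closed_segment x0 x"
      then have "\<bar>V s\<bar> \<le> B" by (intro B) (auto simp: closed_segment_eq_real_ivl split: if_splits)
      then show "\<bar>F - V s - 1\<bar> \<le> \<bar>a\<bar> + \<bar>b\<bar> + B + 1" using F by auto
    qed
    then have "(\<theta> F x - \<theta> G x)\<^sup>2 + (F - G)\<^sup>2 \<le> K * (F - G)\<^sup>2" using th(2) by simp
    then have "(\<theta> F x - \<theta> G x)\<^sup>2 \<le> K * (F - G)\<^sup>2" using zero_le_power2[of "F - G"] by linarith
    then have "sqrt ((\<theta> F x - \<theta> G x)\<^sup>2) \<le> sqrt (K * (F - G)\<^sup>2)" by (rule real_sqrt_le_mono)
    then show ?thesis by (simp add: real_sqrt_mult)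
  qed
  have "(sqrt K)-lipschitz_on {a..b} (\<lambda>F. \<theta> F x)"
    by (rule lipschitz_onI) (use lip in \<open>auto simp: dist_real_def K_def\<close>)
  then show ?thesis by (rule lipschitz_on_continuous_on)
qed

text \<open>
  The hypotheses on the angle say \<open>u u' \<le> 0\<close> far to the right and \<open>u u' \<ge> 0\<close> far to the left. As
  \<open>(u u')' \<ge> u\<^sup>2\<close> there, the integral of \<open>u\<^sup>2\<close> is bounded by the values of \<open>u u'\<close> at \<open>R\<close> and
  \<open>-R\<close>.
\<close>

lemma prufer_angle_eventually_monotone_L2:
  assumes V: "continuous_on UNIV V" and r: "prufer_radius V F \<theta> r" and R: "0 \<le> R"
    and VF: "\<And>x. R \<le> \<bar>x\<bar> \<Longrightarrow> F + 1 \<le> V x"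
    and right: "\<And>x. R \<le> x \<Longrightarrow> sin (\<theta> x) * cos (\<theta> x) \<le> 0"
    and left: "\<And>x. x \<le> - R \<Longrightarrow> 0 \<le> sin (\<theta> x) * cos (\<theta> x)"
  shows "eigenstate V F (\<lambda>x. r x * sin (\<theta> x)) (\<lambda>x. r x * cos (\<theta> x))"
proof -
  define u where "u x = r x * sin (\<theta> x)" for x
  define u' where "u' x = r x * cos (\<theta> x)" for x
  note r0 = prufer_radiusD(1)[OF r]
  have u: "(u has_real_derivative u' x) (at x)" "(u' has_real_derivative (V x - F) * u x) (at x)" for x
    unfolding u_def u'_def by (rule prufer_radiusD(2,3)[OF r])+
  have uc: "continuous_on UNIV u" using DERIV_isCont[OF u(1)] by (auto intro: continuous_at_imp_continuous_on)
  have u2c: "continuous_on UNIV (\<lambda>x. (u x)\<^sup>2)" by (intro continuous_intros uc)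
  define U where "U = antiderivative 0 (\<lambda>x. (u x)\<^sup>2)"
  have U: "(U has_real_derivative (u x)\<^sup>2) (at x)" for x unfolding U_def by (rule DERIV_antiderivative[OF u2c])
  have Q: "((\<lambda>x. u x * u' x - U x) has_real_derivative (u' x)\<^sup>2 + (V x - F - 1) * (u x)\<^sup>2) (at x)" for x
    using DERIV_diff[OF DERIV_mult[OF u] U, of x]
    by (rule DERIV_cong) (simp add: power2_eq_square left_diff_distrib)
  have Qmono: "u a * u' a - U a \<le> u b * u' b - U b" if "a \<le> b" "\<And>x. x \<in> {a..b} \<Longrightarrow> R \<le> \<bar>x\<bar>" for a b
  proof (rule DERIV_nonneg_imp_nondecreasing[OF that(1)])
    fix x assume "a \<le> x" "x \<le> b"
    then have "0 \<le> V x - F - 1" using VF[of x] that(2)[of x] by simp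
    then have "0 \<le> (u' x)\<^sup>2 + (V x - F - 1) * (u x)\<^sup>2" by simp
    then show "\<exists>y. ((\<lambda>x. u x * u' x - U x) has_real_derivative y) (at x) \<and> 0 \<le> y" using Q[of x] by blast
  qed
  have rightU: "U x \<le> U R - u R * u' R" if "R \<le> x" for x
  proof -
    have "u x * u' x = (r x)\<^sup>2 * (sin (\<theta> x) * cos (\<theta> x))" by (simp add: u_def u'_def power2_eq_square)
    also have "\<dots> \<le> 0" using right[OF that] by (simp add: mult_nonneg_nonpos)
    finally show ?thesis using Qmono[OF that] R by simp
  qed
  have leftU: "U (- R) - u (- R) * u' (- R) \<le> U x" if "x \<le> - R" for x
  proof -
    have "0 \<le> (r x)\<^sup>2 * (sin (\<theta> x) * cos (\<theta> x))" using left[OF that] by simp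
    also have "\<dots> = u x * u' x" by (simp add: u_def u'_def power2_eq_square)
    finally show ?thesis using Qmono[OF that] R by simp
  qed
  have Umono: "U x \<le> U y" if "x \<le> y" for x y
    by (rule DERIV_nonneg_imp_nondecreasing[OF that]) (use U zero_le_power2 in blast)
  define B where "B = \<bar>U R - u R * u' R\<bar> + \<bar>U R\<bar> + (\<bar>U (- R) - u (- R) * u' (- R)\<bar> + \<bar>U (- R)\<bar>)"
  have "(\<lambda>x. (u x)\<^sup>2) integrable_on UNIV"
  proof (rule integral_UNIV_bounded(1)[OF u2c])
    fix k :: nat
    have "((\<lambda>x. (u x)\<^sup>2) has_integral (U (real k) - U (- real k))) {- real k..real k}"
      by (rule fundamental_theorem_of_calculus)
         (auto simp: has_real_derivative_iff_has_vector_derivative[symmetric] intro: DERIV_subset[OF U])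
    then have "integral {- real k..real k} (\<lambda>x. (u x)\<^sup>2) = U (real k) - U (- real k)"
      by (rule integral_unique)
    moreover have "U (real k) \<le> \<bar>U R - u R * u' R\<bar> + \<bar>U R\<bar>"
      using rightU[of "real k"] Umono[of "real k" R] by (cases "R \<le> real k") auto
    moreover have "- (\<bar>U (- R) - u (- R) * u' (- R)\<bar> + \<bar>U (- R)\<bar>) \<le> U (- real k)"
      using leftU[of "- real k"] Umono[of "- R" "- real k"] by (cases "- real k \<le> - R") auto
    ultimately show "integral {- real k..real k} (\<lambda>x. (u x)\<^sup>2) \<le> B" by (simp add: B_def)
  qed simp
  moreover have "\<exists>x. u x \<noteq> 0"
  proof (rule ccontr)
    assume "\<not> ?thesis"
    then have u0: "u x = 0" for x by blast
    have "u' 0 = 0"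
      by (rule DERIV_local_const[OF u(1)[of 0], of 1]) (use u0 in auto)
    then have "sin (\<theta> 0) = 0" "cos (\<theta> 0) = 0" using u0[of 0] r0[of 0] by (simp_all add: u_def u'_def)
    then show False using sin_cos_squared_add[of "\<theta> 0"] by simp
  qed
  ultimately have "eigenstate V F u u'" using u unfolding eigenstate_def by blast
  then show ?thesis unfolding u_def u'_def .
qed

context confining
begin

text \<open>
  Shooting. The angle that starts from \<open>0\<close> at \<open>-S\<close> depends continuously on the energy; at \<open>S\<close> it is
  at most \<open>\<pi>/2\<close> for the energy \<open>-1\<close> and at least \<open>k \<pi>\<close> for \<open>E\<close>, so it equals \<open>k \<pi>\<close> for some
  energy in between. As \<open>V\<close> exceeds the energy outside \<open>{-R..R}\<close>, barriers at \<open>0\<close> and \<open>\<pi>/2\<close> confine this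
  angle on the left, and barriers at \<open>k \<pi> - \<pi>/2\<close> and \<open>k \<pi>\<close>, read backwards from \<open>S\<close>, confine it on
  the right. Energies and angles at \<open>-R\<close> lie in a compact set, so a subsequence converges as
  \<open>S \<rightarrow> \<infinity>\<close>, and the limit angle is confined on both half lines.
\<close>

lemma prufer_eigenvalue:
  assumes R: "0 < R" "\<And>x. R \<le> \<bar>x\<bar> \<Longrightarrow> E + 1 \<le> V x" and V0: "\<And>x. 0 \<le> V x" and E0: "0 \<le> E"
    and k: "1 \<le> k"
    and E: "\<And>S \<theta>. R \<le> S \<Longrightarrow> prufer_angle V E \<theta> \<Longrightarrow> \<theta> (- S) = 0 \<Longrightarrow> real k * pi \<le> \<theta> S"
  obtains F \<theta> where "F \<in> {- 1..E}" "prufer_angle V F \<theta>"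
    "\<And>x. x \<le> - R \<Longrightarrow> \<theta> x \<in> {0..pi/2}"
    "\<And>x. R \<le> x \<Longrightarrow> \<theta> x \<in> {real k * pi - pi/2..real k * pi}"
proof -
  have finite_interval: "\<exists>F \<theta>. F \<in> {- 1..E} \<and> prufer_angle V F \<theta> \<and>
      (\<forall>x\<in>{- S..- R}. \<theta> x \<in> {0..pi/2}) \<and> (\<forall>x\<in>{R..S}. \<theta> x \<in> {real k * pi - pi/2..real k * pi})"
    if S: "R \<le> S" for S
  proof -
    have "\<forall>F. \<exists>\<theta>. prufer_angle V F \<theta> \<and> \<theta> (- S) = 0"
      using prufer_angle_exists[OF V_continuous] by metis
    then obtain \<theta> where th: "\<And>F. prufer_angle V F (\<theta> F)" "\<And>F. \<theta> F (- S) = 0" by metis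
    have mirror: "((\<lambda>x. c - \<theta> F x) has_real_derivative 0 - (1 + (F - V x - 1) * (sin (\<theta> F x))\<^sup>2)) (at x)" for c F x
      by (intro DERIV_diff DERIV_const prufer_angleD[OF th(1)])
    \<comment> \<open>The energy \<open>-1\<close> and not \<open>0\<close>: it lies strictly below \<open>V\<close>, which may vanish, so that \<open>\<pi>/2\<close> is a strict barrier.\<close>
    have "0 \<le> pi / 2 - \<theta> (- 1) S"
    proof (rule crosses_zero_upwards(1)[of "- S" S, OF _ _ mirror])
      show "0 < 0 - (1 + (- 1 - V x - 1) * (sin (\<theta> (- 1) x))\<^sup>2)" if "pi / 2 - \<theta> (- 1) x = 0" for x
      proof -
        have "\<theta> (- 1) x = pi / 2" using that by simp
        then have "(sin (\<theta> (- 1) x))\<^sup>2 = 1" by (simp only: sin_pi_half one_power2)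
        then show ?thesis using V0[of x] by simp
      qed
    qed (use R S th in auto)
    moreover have "1 * pi \<le> real k * pi" using k by (intro mult_right_mono) auto
    ultimately have "\<theta> (- 1) S \<le> real k * pi" using pi_gt_zero by linarith
    moreover have "real k * pi \<le> \<theta> E S" by (rule E[OF S th])
    moreover have "continuous_on {- 1..E} (\<lambda>F. \<theta> F S)"
      by (rule prufer_angle_continuous_in_parameter[OF V_continuous th])
    ultimately obtain F where F: "- 1 \<le> F" "F \<le> E" "\<theta> F S = real k * pi"
      using IVT'[of "\<lambda>F. \<theta> F S" "- 1" "real k * pi" E] E0 by force
    have VF: "F + 1 \<le> V x" if "R \<le> \<bar>x\<bar>" for x using R(2)[OF that] F by simp
    have 1: "0 \<le> \<theta> F x" if "- S \<le> x" for x
      using prufer_angle_ge_multiple_pi[OF th(1)[of F] that, of 0] th(2) by simp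
    have 2: "0 \<le> pi / 2 - \<theta> F x" if x: "- S \<le> x" "x \<le> - R" for x
    proof (rule crosses_zero_upwards(1)[OF x(1) _ mirror[of "pi / 2" F]])
      fix y assume y: "y \<le> x" "pi / 2 - \<theta> F y = 0"
      have "\<theta> F y = pi / 2" and yR: "R \<le> \<bar>y\<bar>" using x y R by auto
      then have "(sin (\<theta> F y))\<^sup>2 = 1" by (simp only: sin_pi_half one_power2)
      then show "0 < 0 - (1 + (F - V y - 1) * (sin (\<theta> F y))\<^sup>2)" using VF[OF yR] by simp
    qed (use th in auto)
    have 3: "\<theta> F x \<le> real k * pi" if x: "x \<le> S" for x
    proof -
      have "\<theta> F x - real k * pi \<le> 0"
        by (rule crosses_zero_upwards_back[OF x _ prufer_angleD[OF prufer_angle_shift[OF th(1)]]])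
           (use F in auto)
      then show ?thesis by simp
    qed
    have 4: "(real k * pi - pi / 2) - \<theta> F x \<le> 0" if x: "R \<le> x" "x \<le> S" for x
    proof (rule crosses_zero_upwards_back[OF x(2) _ mirror])
      fix y assume y: "x \<le> y" "real k * pi - pi / 2 - \<theta> F y = 0"
      have "\<theta> F y = real k * pi - pi / 2" "R \<le> \<bar>y\<bar>" using x y by auto
      moreover have "((- 1) ^ k)\<^sup>2 = (1 :: real)" by (simp add: power2_eq_square flip: power_mult_distrib)
      ultimately have "(sin (\<theta> F y))\<^sup>2 = 1" by (simp add: sin_diff)
      then show "0 < 0 - (1 + (F - V y - 1) * (sin (\<theta> F y))\<^sup>2)" using VF[OF \<open>R \<le> \<bar>y\<bar>\<close>] by simp
    qed (use F in auto)
    show ?thesis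
      using F th(1)[of F] 1 2 3 4 S R by (intro exI[of _ F] exI[of _ "\<theta> F"]) auto
  qed
  have "\<forall>j::nat. \<exists>F \<theta>. F \<in> {- 1..E} \<and> prufer_angle V F \<theta> \<and>
      (\<forall>x\<in>{- (R + real j)..- R}. \<theta> x \<in> {0..pi/2}) \<and>
      (\<forall>x\<in>{R..R + real j}. \<theta> x \<in> {real k * pi - pi/2..real k * pi})"
    by (intro allI finite_interval) simp
  then obtain F \<theta> where F: "\<And>j::nat. F j \<in> {- 1..E}" and th: "\<And>j. prufer_angle V (F j) (\<theta> j)"
    and left: "\<And>j x. x \<in> {- (R + real j)..- R} \<Longrightarrow> \<theta> j x \<in> {0..pi/2}"
    and right: "\<And>j x. x \<in> {R..R + real j} \<Longrightarrow> \<theta> j x \<in> {real k * pi - pi/2..real k * pi}"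
    by metis
  have "compact ({- 1..E} \<times> {0..pi/2})" by (intro compact_Times compact_Icc)
  then have "seq_compact ({- 1..E} \<times> {0..pi/2})" by (simp add: compact_eq_seq_compact_metric)
  moreover have "\<forall>j. (F j, \<theta> j (- R)) \<in> {- 1..E} \<times> {0..pi/2}" using F left[of "- R"] by auto
  ultimately obtain l \<sigma> where l: "l \<in> {- 1..E} \<times> {0..pi/2}" "strict_mono \<sigma>"
    "((\<lambda>j. (F j, \<theta> j (- R))) \<circ> \<sigma>) \<longlonglongrightarrow> l"
    by (rule seq_compactE)
  have F0: "(\<lambda>j. F (\<sigma> j)) \<longlonglongrightarrow> fst l" using tendsto_fst[OF l(3)] by (simp add: o_def)
  have t0: "(\<lambda>j. \<theta> (\<sigma> j) (- R)) \<longlonglongrightarrow> snd l" using tendsto_snd[OF l(3)] by (simp add: o_def)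
  \<comment> \<open>The angle with the limiting energy and the limiting value at \<open>-R\<close> is the limit of the angles at every point, by continuous dependence.\<close>
  obtain \<phi> where ph: "prufer_angle V (fst l) \<phi>" "\<phi> (- R) = snd l"
    using prufer_angle_exists[OF V_continuous] by blast
  have lim: "(\<lambda>j. \<theta> (\<sigma> j) x) \<longlonglongrightarrow> \<phi> x" for x
  proof -
    obtain B where B: "0 < B" "\<And>s. s \<in> {min (- R) x..max (- R) x} \<Longrightarrow> \<bar>V s\<bar> \<le> B"
      using continuous_on_Icc_bounded[OF continuous_on_subset[OF V_continuous subset_UNIV]] by blast
    define K where "K = exp ((2 * (\<bar>E\<bar> + B + 2) + 1) * \<bar>x - - R\<bar>)"
    have "(\<phi> x - \<theta> (\<sigma> j) x)\<^sup>2 + (fst l - F (\<sigma> j))\<^sup>2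
        \<le> K * ((\<phi> (- R) - \<theta> (\<sigma> j) (- R))\<^sup>2 + (fst l - F (\<sigma> j))\<^sup>2)" for j
      unfolding K_def
    proof (rule prufer_angle_dependence[OF ph(1) th])
      fix s assume "s \<in> closed_segment (- R) x"
      then have "\<bar>V s\<bar> \<le> B" by (intro B) (auto simp: closed_segment_eq_real_ivl split: if_splits)
      then show "\<bar>fst l - V s - 1\<bar> \<le> \<bar>E\<bar> + B + 2" using l(1) by auto
    qed
    then have le: "(\<phi> x - \<theta> (\<sigma> j) x)\<^sup>2 \<le> K * ((snd l - \<theta> (\<sigma> j) (- R))\<^sup>2 + (fst l - F (\<sigma> j))\<^sup>2)" for j
      unfolding ph(2) by (rule order_trans[rotated]) simp
    have "(\<lambda>j. K * ((snd l - \<theta> (\<sigma> j) (- R))\<^sup>2 + (fst l - F (\<sigma> j))\<^sup>2)) \<longlonglongrightarrow>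
        K * ((snd l - snd l)\<^sup>2 + (fst l - fst l)\<^sup>2)"
      by (intro tendsto_intros F0 t0)
    then have "(\<lambda>j. K * ((snd l - \<theta> (\<sigma> j) (- R))\<^sup>2 + (fst l - F (\<sigma> j))\<^sup>2)) \<longlonglongrightarrow> 0" by simp
    then have "(\<lambda>j. (\<phi> x - \<theta> (\<sigma> j) x)\<^sup>2) \<longlonglongrightarrow> 0"
      by (rule tendsto_sandwich[OF _ _ tendsto_const, rotated 2]) (use le in auto)
    from tendsto_real_sqrt[OF this] have "(\<lambda>j. \<bar>\<phi> x - \<theta> (\<sigma> j) x\<bar>) \<longlonglongrightarrow> 0" by simp
    then have "(\<lambda>j. \<phi> x - \<theta> (\<sigma> j) x) \<longlonglongrightarrow> 0" by (rule tendsto_rabs_zero_cancel)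
    from tendsto_diff[OF tendsto_const[of "\<phi> x"] this] show ?thesis by simp
  qed
  have ev: "\<forall>\<^sub>F j in sequentially. c \<le> R + real (\<sigma> j)" for c
  proof -
    obtain n where "c - R \<le> real n" using real_arch_simple by blast
    moreover have "j \<le> \<sigma> j" for j using l(2) by (rule seq_suble)
    ultimately show ?thesis
      by (intro eventually_sequentiallyI[of n]) (smt (verit) of_nat_mono order_trans)
  qed
  show ?thesis
  proof (rule that[of "fst l" \<phi>])
    show "fst l \<in> {- 1..E}" using l(1) by auto
    show "prufer_angle V (fst l) \<phi>" by (rule ph)
    show "\<phi> x \<in> {0..pi/2}" if "x \<le> - R" for x
    proof (rule Lim_in_closed_set[OF closed_atLeastAtMost _ trivial_limit_sequentially lim])
      show "\<forall>\<^sub>F j in sequentially. \<theta> (\<sigma> j) x \<in> {0..pi/2}"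
        using ev[of "- x"] by eventually_elim (rule left, use that in auto)
    qed
    show "\<phi> x \<in> {real k * pi - pi/2..real k * pi}" if "R \<le> x" for x
    proof (rule Lim_in_closed_set[OF closed_atLeastAtMost _ trivial_limit_sequentially lim])
      show "\<forall>\<^sub>F j in sequentially. \<theta> (\<sigma> j) x \<in> {real k * pi - pi/2..real k * pi}"
        using ev[of x] by eventually_elim (rule right, use that in auto)
    qed
  qed
qed

lemma prufer_eigenstate:
  assumes R: "0 < R" "\<And>x. R \<le> \<bar>x\<bar> \<Longrightarrow> F + 1 \<le> V x" and th: "prufer_angle V F \<theta>"
    and left: "\<And>x. x \<le> - R \<Longrightarrow> \<theta> x \<in> {0..pi/2}"
    and right: "\<And>x. R \<le> x \<Longrightarrow> \<theta> x \<in> {real k * pi - pi/2..real k * pi}"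
    and r: "prufer_radius V F \<theta> r"
  shows "eigenstate V F (\<lambda>x. r x * sin (\<theta> x)) (\<lambda>x. r x * cos (\<theta> x))"
proof (rule prufer_angle_eventually_monotone_L2[OF V_continuous r, of R])
  show "sin (\<theta> x) * cos (\<theta> x) \<le> 0" if "R \<le> x" for x
  proof -
    define y where "y = real k * pi - \<theta> x"
    have y: "0 \<le> y" "y \<le> pi / 2" using right[OF that] by (auto simp: y_def)
    have "\<theta> x = real k * pi - y" by (simp add: y_def)
    then have "sin (\<theta> x) * cos (\<theta> x) = - (((- 1) ^ k * (- 1) ^ k) * (sin y * cos y))"
      by (simp add: sin_diff cos_diff)
    also have "\<dots> = - (sin y * cos y)" by (simp flip: power_mult_distrib)
    also have "\<dots> \<le> 0" using y sin_ge_zero[of y] cos_ge_zero[of y] by simp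
    finally show ?thesis .
  qed
  show "0 \<le> sin (\<theta> x) * cos (\<theta> x)" if "x \<le> - R" for x
    using left[OF that] sin_ge_zero[of "\<theta> x"] cos_ge_zero[of "\<theta> x"] by simp
qed (use R in auto)

text \<open>
  Eigenvalues are simple: the Wronskian of two eigenfunctions with the same energy is constant and
  tends to \<open>0\<close>, so both angles agree modulo \<open>\<pi>\<close> at \<open>-R\<close>, hence agree there, hence
  everywhere.
\<close>

lemma prufer_winding_unique:
  assumes R: "0 < R" "\<And>x. R \<le> \<bar>x\<bar> \<Longrightarrow> F + 1 \<le> V x"
    and th: "prufer_angle V F \<theta>" "\<And>x. x \<le> - R \<Longrightarrow> \<theta> x \<in> {0..pi/2}"
      "\<And>x. R \<le> x \<Longrightarrow> \<theta> x \<in> {real j * pi - pi/2..real j * pi}"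
    and ph: "prufer_angle V F \<phi>" "\<And>x. x \<le> - R \<Longrightarrow> \<phi> x \<in> {0..pi/2}"
      "\<And>x. R \<le> x \<Longrightarrow> \<phi> x \<in> {real k * pi - pi/2..real k * pi}"
  shows "j = k"
proof -
  obtain r where r: "prufer_radius V F \<theta> r" using prufer_radius_exists[OF V_continuous th(1)] ..
  obtain q where q: "prufer_radius V F \<phi> q" using prufer_radius_exists[OF V_continuous ph(1)] ..
  note u = prufer_eigenstate[OF R th r] and v = prufer_eigenstate[OF R ph q]
  define W where "W x = r x * cos (\<theta> x) * (q x * sin (\<phi> x)) - r x * sin (\<theta> x) * (q x * cos (\<phi> x))" for x
  have "(W has_real_derivative 0) (at x)" for x
    unfolding W_def using wronskian_DERIV[OF u v, of x] by simp
  then have const: "W x = W y" for x y by (metis DERIV_isconst_all)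
  have "(W \<longlongrightarrow> 0) at_top"
    unfolding W_def using wronskian_tendsto_0[OF u v, of R] R
    by (smt (verit) abs_of_nonneg)
  moreover have "(W \<longlongrightarrow> W (- R)) at_top"
    by (rule tendsto_eventually) (use const in auto)
  ultimately have "W (- R) = 0" using tendsto_unique trivial_limit_at_top_linorder by blast
  then have "r (- R) * q (- R) * sin (\<phi> (- R) - \<theta> (- R)) = 0"
    by (simp add: W_def sin_diff algebra_simps)
  then have "sin (\<phi> (- R) - \<theta> (- R)) = 0"
    using prufer_radiusD(1)[OF r, of "- R"] prufer_radiusD(1)[OF q, of "- R"] by simp
  moreover have "\<theta> (- R) \<in> {0..pi/2}" "\<phi> (- R) \<in> {0..pi/2}" using th(2) ph(2) by simp_all
  then have "\<bar>\<phi> (- R) - \<theta> (- R)\<bar> < pi"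
    using pi_gt_zero unfolding abs_less_iff atLeastAtMost_iff by linarith
  ultimately have eq: "\<phi> (- R) = \<theta> (- R)" using sin_eq_0_pi[of "\<phi> (- R) - \<theta> (- R)"] by (simp add: abs_less_iff)
  obtain B where B: "0 < B" "\<And>s. s \<in> {- R..R} \<Longrightarrow> \<bar>V s\<bar> \<le> B"
    using continuous_on_Icc_bounded[OF continuous_on_subset[OF V_continuous subset_UNIV]] by blast
  have "(\<phi> R - \<theta> R)\<^sup>2 + (F - F)\<^sup>2 \<le> exp ((2 * (\<bar>F\<bar> + B + 1) + 1) * \<bar>R - - R\<bar>) * ((\<phi> (- R) - \<theta> (- R))\<^sup>2 + (F - F)\<^sup>2)"
  proof (rule prufer_angle_dependence[OF ph(1) th(1)])
    fix s assume "s \<in> closed_segment (- R) R"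
    then have "\<bar>V s\<bar> \<le> B" using R by (intro B) (auto simp: closed_segment_eq_real_ivl split: if_splits)
    then show "\<bar>F - V s - 1\<bar> \<le> \<bar>F\<bar> + B + 1" by linarith
  qed
  then have "\<phi> R = \<theta> R" using eq by simp
  moreover have "\<theta> R \<in> {real j * pi - pi/2..real j * pi}" "\<phi> R \<in> {real k * pi - pi/2..real k * pi}"
    using th(3) ph(3) by simp_all
  ultimately have *: "\<bar>real j * pi - real k * pi\<bar> \<le> pi / 2"
    unfolding abs_le_iff atLeastAtMost_iff by linarith
  show "j = k"
  proof (rule ccontr)
    assume "j \<noteq> k"
    then have "1 \<le> \<bar>real j - real k\<bar>" by linarith
    then have "1 * pi \<le> \<bar>real j - real k\<bar> * pi" by (intro mult_right_mono) auto
    also have "\<dots> = \<bar>real j * pi - real k * pi\<bar>" by (simp add: left_diff_distrib[symmetric] abs_mult)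
    finally show False using * pi_gt_zero by linarith
  qed
qed

text \<open>
  On \<open>{0..M * pi / s}\<close> the angle at energy \<open>E\<close> gains \<open>\<pi>\<close> over every length \<open>pi / s\<close>, and it never loses a
  half turn elsewhere, so at least \<open>M\<close> half turns are available for shooting.
\<close>

theorem many_eigenvalues:
  assumes V0: "\<And>x. 0 \<le> V x" and E: "0 < E" and s: "0 < s"
    and VE: "\<And>x. x \<in> {0..real M * pi / s} \<Longrightarrow> V x \<le> E - s\<^sup>2"
  shows "\<exists>S. finite S \<and> card S = M \<and> (\<forall>F\<in>S. F \<le> E \<and> eigenvalue V F)"
proof -
  obtain R0 where R0: "R0 > 0" "\<And>x. R0 \<le> \<bar>x\<bar> \<Longrightarrow> E + 1 \<le> V x" using V_large[of "E + 1"] by blast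
  define R where "R = max R0 (real M * pi / s)"
  have R: "0 < R" "\<And>x. R \<le> \<bar>x\<bar> \<Longrightarrow> E + 1 \<le> V x" "real M * pi / s \<le> R" using R0 by (auto simp: R_def)
  have winding: "real M * pi \<le> \<theta> S" if S: "R \<le> S" and th: "prufer_angle V E \<theta>" "\<theta> (- S) = 0" for S \<theta>
  proof -
    have "real k * pi \<le> \<theta> (real k * pi / s)" if "k \<le> M" for k
      using that
    proof (induction k)
      case 0
      then show ?case using prufer_angle_ge_multiple_pi[OF th(1), of "- S" 0 0] S R th(2) by simp
    next
      case (Suc k)
      have eq: "real k * pi / s + pi / s = real (Suc k) * pi / s"
        by (simp add: add_divide_distrib distrib_right)
      have "real (Suc k) * pi \<le> \<theta> (real k * pi / s + pi / s)"
      proof (rule prufer_angle_advances[OF V_continuous th(1) s])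
        fix x assume "x \<in> {real k * pi / s..real k * pi / s + pi / s}"
        moreover have "real (Suc k) * pi / s \<le> real M * pi / s"
          using Suc.prems s by (intro divide_right_mono mult_right_mono) auto
        moreover have "0 \<le> real k * pi / s" using s by simp
        ultimately show "V x \<le> E - s\<^sup>2" unfolding eq by (intro VE) auto
      qed (use Suc in simp)
      then show ?case unfolding eq .
    qed
    from this[of M] show ?thesis
      using prufer_angle_ge_multiple_pi[OF th(1), of "real M * pi / s" S M] S R by simp
  qed
  have "\<forall>k\<in>{1..M}. \<exists>F \<theta>. F \<in> {- 1..E} \<and> prufer_angle V F \<theta> \<and>
      (\<forall>x\<le>- R. \<theta> x \<in> {0..pi/2}) \<and> (\<forall>x\<ge>R. \<theta> x \<in> {real k * pi - pi/2..real k * pi})"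
  proof
    fix k assume k: "k \<in> {1..M}"
    have wk: "real k * pi \<le> \<theta> S" if "R \<le> S" "prufer_angle V E \<theta>" "\<theta> (- S) = 0" for S \<theta>
    proof -
      have "real k * pi \<le> real M * pi" using k by (intro mult_right_mono) auto
      then show ?thesis using winding[OF that] by linarith
    qed
    show "\<exists>F \<theta>. F \<in> {- 1..E} \<and> prufer_angle V F \<theta> \<and>
      (\<forall>x\<le>- R. \<theta> x \<in> {0..pi/2}) \<and> (\<forall>x\<ge>R. \<theta> x \<in> {real k * pi - pi/2..real k * pi})"
    proof (rule prufer_eigenvalue[of R E k])
      fix F \<theta> assume "F \<in> {- 1..E}" "prufer_angle V F \<theta>"
        "\<And>x. x \<le> - R \<Longrightarrow> \<theta> x \<in> {0..pi/2}"
        "\<And>x. R \<le> x \<Longrightarrow> \<theta> x \<in> {real k * pi - pi/2..real k * pi}"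
      then show ?thesis by (intro exI[of _ F] exI[of _ \<theta>]) simp
    qed (use R V0 E k wk in auto)
  qed
  then obtain F \<theta> where F: "\<And>k. k \<in> {1..M} \<Longrightarrow> F k \<in> {- 1..E}"
    and th: "\<And>k. k \<in> {1..M} \<Longrightarrow> prufer_angle V (F k) (\<theta> k)"
      "\<And>k x. k \<in> {1..M} \<Longrightarrow> x \<le> - R \<Longrightarrow> \<theta> k x \<in> {0..pi/2}"
      "\<And>k x. k \<in> {1..M} \<Longrightarrow> R \<le> x \<Longrightarrow> \<theta> k x \<in> {real k * pi - pi/2..real k * pi}"
    unfolding bchoice_iff by blast
  have large: "F k + 1 \<le> V x" if "k \<in> {1..M}" "R \<le> \<bar>x\<bar>" for k x
    using R(2)[OF that(2)] F[OF that(1)] by simp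
  have "inj_on F {1..M}"
  proof (rule inj_onI)
    fix j k assume jk: "j \<in> {1..M}" "k \<in> {1..M}" "F j = F k"
    show "j = k"
      by (rule prufer_winding_unique[OF R(1) large[OF jk(1)] th[OF jk(1)] th(1)[OF jk(2), folded jk(3)] th(2,3)[OF jk(2)]])
  qed
  moreover have "eigenvalue V (F k)" if k: "k \<in> {1..M}" for k
  proof -
    obtain r where r: "prufer_radius V (F k) (\<theta> k) r" using prufer_radius_exists[OF V_continuous th(1)[OF k]] ..
    show ?thesis
      using eigenstate_imp_eigenfunction[OF V_continuous prufer_eigenstate[OF R(1) large[OF k] th[OF k] r]]
      unfolding eigenvalue_def by blast
  qed
  ultimately show ?thesis
    using F by (intro exI[of _ "F ` {1..M}"]) (auto simp: card_image)
qed

end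

section \<open>Potentials of power type and their wells\<close>

text \<open>
  The class \<open>P1 \<kappa>\<close> with the derivative as a parameter, so that the reflected potential is again an
  instance and each estimate has to be proved for the right half line only.
\<close>

locale power_like =
  fixes V V' :: "real \<Rightarrow> real" and \<kappa> :: real
  assumes kappa: "1 \<le> \<kappa>" and V_continuous: "continuous_on UNIV V" and V_nonneg: "\<And>x. 0 \<le> V x"
    and V_nontrivial: "\<exists>x. V x \<noteq> 0"
    and V_deriv: "\<And>x. x \<noteq> 0 \<Longrightarrow> (V has_real_derivative V' x) (at x)"
    and V'_continuous: "continuous_on (- {0}) V'"
    and growth: "\<And>x. x \<noteq> 0 \<Longrightarrow> V x / \<kappa> \<le> x * V' x" "\<And>x. x \<noteq> 0 \<Longrightarrow> x * V' x \<le> \<kappa> * V x"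
    and nearly_even: "\<And>x. x \<noteq> 0 \<Longrightarrow> V (- x) \<le> \<kappa> * V x"

lemma P1_power_like:
  assumes "1 \<le> \<kappa>" "V \<in> P1 \<kappa>"
  shows "power_like V (deriv V) \<kappa>"
proof -
  have "V C1_differentiable_on (- {0})" using assms(2) by (simp add: P1_def)
  then obtain D where D: "\<And>x. x \<noteq> 0 \<Longrightarrow> (V has_vector_derivative D x) (at x)" "continuous_on (- {0}) D"
    unfolding C1_differentiable_on_def by auto
  have 1: "(V has_real_derivative D x) (at x)" if "x \<noteq> 0" for x
    using D(1)[OF that] by (simp add: has_real_derivative_iff_has_vector_derivative)
  then have eq: "deriv V x = D x" if "x \<noteq> 0" for x using that DERIV_imp_deriv by blast
  have "continuous_on (- {0}) (deriv V)"
    using D(2) by (rule continuous_on_eq) (simp add: eq)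
  then show ?thesis
    using assms 1 eq unfolding power_like_def P1_def by auto
qed

context power_like
begin

lemma power_like_reflect: "power_like (\<lambda>x. V (- x)) (\<lambda>x. - V' (- x)) \<kappa>"
proof
  show "continuous_on UNIV (\<lambda>x. V (- x))"
    by (auto intro!: continuous_on_compose2[OF V_continuous] continuous_intros)
  show "\<exists>x. V (- x) \<noteq> 0" using V_nontrivial by (metis minus_minus)
  show "continuous_on (- {0}) (\<lambda>x. - V' (- x))"
    by (intro continuous_intros continuous_on_compose2[OF V'_continuous]) auto
  fix x :: real assume x: "x \<noteq> 0"
  show "((\<lambda>x. V (- x)) has_real_derivative - V' (- x)) (at x)"
    using DERIV_mirror[of V "V' (- x)" x] V_deriv[of "- x"] x by simp
  show "V (- x) / \<kappa> \<le> x * - V' (- x)" "x * - V' (- x) \<le> \<kappa> * V (- x)" "V (- (- x)) \<le> \<kappa> * V (- x)"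
    using growth[of "- x"] nearly_even[of "- x"] x by auto
qed (use kappa V_nonneg in auto)

text \<open>
  The differential inequality says that \<open>V x * x powr (-1/\<kappa>)\<close> is nondecreasing.
\<close>

lemma scaling_lower:
  assumes x: "0 < x" "x \<le> y" shows "V x * (y / x) powr (1 / \<kappa>) \<le> V y"
proof -
  have "V x * x powr (- (1 / \<kappa>)) \<le> V y * y powr (- (1 / \<kappa>))"
  proof (rule DERIV_nonneg_imp_nondecreasing[OF x(2)])
    fix z assume "x \<le> z"
    then have z: "0 < z" using x by simp
    have "((\<lambda>z. V z * z powr (- (1 / \<kappa>))) has_real_derivative
        V' z * z powr (- (1 / \<kappa>)) + - (1 / \<kappa>) * z powr (- (1 / \<kappa>) - 1) * V z) (at z)"
      using DERIV_mult[OF V_deriv has_real_derivative_powr[OF z, of "- (1 / \<kappa>)"]] z by simp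
    moreover have "V' z * z powr (- (1 / \<kappa>)) + - (1 / \<kappa>) * z powr (- (1 / \<kappa>) - 1) * V z
        = (z * V' z - V z / \<kappa>) * z powr (- (1 / \<kappa>) - 1)"
      using z powr_add[of z "- (1 / \<kappa>) - 1" 1] by (simp add: algebra_simps)
    ultimately show "\<exists>d. ((\<lambda>z. V z * z powr (- (1 / \<kappa>))) has_real_derivative d) (at z) \<and> 0 \<le> d"
      using growth(1)[of z] z by (intro exI[of _ "(z * V' z - V z / \<kappa>) * z powr (- (1 / \<kappa>) - 1)"]) simp
  qed
  then have "V x * x powr (- (1 / \<kappa>)) * y powr (1 / \<kappa>) \<le> V y * y powr (- (1 / \<kappa>)) * y powr (1 / \<kappa>)"
    by (intro mult_right_mono) auto
  also have "\<dots> = V y" using x by (simp add: powr_minus)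
  also have "V x * x powr (- (1 / \<kappa>)) * y powr (1 / \<kappa>) = V x * (y / x) powr (1 / \<kappa>)"
    using x by (simp add: powr_divide powr_minus field_simps)
  finally show ?thesis .
qed

lemma scaling_down:
  assumes "0 < t" "t \<le> 1" "0 < y" shows "V (t * y) \<le> t powr (1 / \<kappa>) * V y"
proof -
  have le: "t * y \<le> y" using assms by (simp add: mult_left_le_one_le)
  have "y / (t * y) = 1 / t" using assms by simp
  then have "V (t * y) * (1 / t) powr (1 / \<kappa>) \<le> V y" using scaling_lower[of "t * y" y] assms le by simp
  then show ?thesis using assms by (simp add: powr_divide divide_le_eq mult.commute)
qed

text \<open>
  The differential inequality says that \<open>V x * x powr (-\<kappa>)\<close> is nonincreasing.
\<close>

lemma scaling_upper:
  assumes x: "0 < x" "x \<le> y" shows "V y \<le> V x * (y / x) powr \<kappa>"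
proof -
  have "V y * y powr (- \<kappa>) \<le> V x * x powr (- \<kappa>)"
  proof (rule DERIV_nonpos_imp_nonincreasing[OF x(2)])
    fix z assume "x \<le> z"
    then have z: "0 < z" using x by simp
    have "((\<lambda>z. V z * z powr (- \<kappa>)) has_real_derivative
        V' z * z powr (- \<kappa>) + - \<kappa> * z powr (- \<kappa> - 1) * V z) (at z)"
      using DERIV_mult[OF V_deriv has_real_derivative_powr[OF z, of "- \<kappa>"]] z by simp
    moreover have "V' z * z powr (- \<kappa>) + - \<kappa> * z powr (- \<kappa> - 1) * V z
        = (z * V' z - \<kappa> * V z) * z powr (- \<kappa> - 1)"
      using z powr_add[of z "- \<kappa> - 1" 1] by (simp add: algebra_simps)
    ultimately show "\<exists>d. ((\<lambda>z. V z * z powr (- \<kappa>)) has_real_derivative d) (at z) \<and> d \<le> 0"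
      using growth(2)[of z] z by (intro exI[of _ "(z * V' z - \<kappa> * V z) * z powr (- \<kappa> - 1)"])
        (simp add: mult_nonpos_nonneg)
  qed
  then have "V y * y powr (- \<kappa>) * y powr \<kappa> \<le> V x * x powr (- \<kappa>) * y powr \<kappa>"
    by (intro mult_right_mono) auto
  moreover have "V y * y powr (- \<kappa>) * y powr \<kappa> = V y" using x by (simp add: powr_minus)
  moreover have "V x * x powr (- \<kappa>) * y powr \<kappa> = V x * (y / x) powr \<kappa>"
    using x by (simp add: powr_divide powr_minus field_simps)
  ultimately show ?thesis by simp
qed

text \<open>
  Through the two scaling inequalities one positive value of \<open>V\<close> makes all values on the half line
  positive, and \<open>nearly_even\<close> transports a positive value from the left.
\<close>

lemma V_pos_right: assumes "0 < x" shows "0 < V x"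
proof -
  obtain y where y: "0 < y" "0 < V y"
  proof -
    obtain z where z: "V z \<noteq> 0" using V_nontrivial by blast
    consider "0 < z" | "z < 0" | "z = 0" by linarith
    then show ?thesis
    proof cases
      case 1 then show ?thesis using that[of z] z V_nonneg[of z] by simp
    next
      case 2
      have "0 < V z" using z V_nonneg[of z] by simp
      also have "\<dots> \<le> \<kappa> * V (- z)" using nearly_even[of "- z"] 2 by simp
      finally have "0 < V (- z)" using kappa by (simp add: zero_less_mult_iff)
      then show ?thesis using that[of "- z"] 2 by simp
    next
      case 3
      have "isCont V 0" using V_continuous continuous_on_eq_continuous_at by blast
      then have "(V \<longlongrightarrow> V 0) (at_right 0)" by (metis isCont_def filterlim_at_split)
      moreover have "0 < V 0" using z 3 V_nonneg[of 0] by simp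
      ultimately have "\<forall>\<^sub>F y in at_right 0. 0 < V y" by (rule order_tendstoD)
      then obtain y where "0 < y" "0 < V y"
        using eventually_happens'[OF trivial_limit_at_right_real eventually_conj[OF _ eventually_at_right_less]] by blast
      then show ?thesis by (rule that)
    qed
  qed
  show ?thesis
  proof (cases "y \<le> x")
    case True
    have "0 < V y * (x / y) powr (1 / \<kappa>)" using y assms by simp
    also have "\<dots> \<le> V x" using scaling_lower[OF y(1) True] .
    finally show ?thesis .
  next
    case False
    have "0 < V x * (y / x) powr \<kappa>" using scaling_upper[OF assms, of y] y False by simp
    then show ?thesis by (simp add: zero_less_mult_iff)
  qed
qed

lemma V_0: "V 0 = 0"
proof -
  have "isCont V 0" using V_continuous continuous_on_eq_continuous_at by blast
  then have "(V \<longlongrightarrow> V 0) (at_right 0)" by (metis isCont_def filterlim_at_split)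
  moreover have "((\<lambda>x. V 1 * x powr (1 / \<kappa>)) \<longlongrightarrow> V 1 * 0 powr (1 / \<kappa>)) (at_right 0)"
    using kappa by (intro tendsto_intros tendsto_powr2) (auto simp: eventually_at_right_less intro: eventually_mono[OF eventually_at_right_less])
  moreover have "\<forall>\<^sub>F x in at_right 0. V x \<le> V 1 * x powr (1 / \<kappa>)"
    unfolding eventually_at_right_field
  proof (intro exI[of _ 1] conjI allI impI)
    fix x :: real assume x: "0 < x" "x < 1"
    have "V x * (1 / x) powr (1 / \<kappa>) * x powr (1 / \<kappa>) \<le> V 1 * x powr (1 / \<kappa>)"
      using scaling_lower[of x 1] x by (intro mult_right_mono) auto
    then show "V x \<le> V 1 * x powr (1 / \<kappa>)" using x by (simp add: powr_divide)
  qed simp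
  ultimately have "V 0 \<le> V 1 * 0 powr (1 / \<kappa>)"
    by (intro tendsto_le[OF trivial_limit_at_right_real])
  then show ?thesis using V_nonneg[of 0] by simp
qed

lemma V'_pos: "0 < x \<Longrightarrow> 0 < V' x"
proof -
  assume x: "0 < x"
  have "0 < V x / \<kappa>" using V_pos_right[OF x] kappa by simp
  also have "\<dots> \<le> x * V' x" using growth(1)[of x] x by simp
  finally show "0 < V' x" using x by (simp add: zero_less_mult_iff)
qed

lemma V_strict_mono: assumes "0 \<le> x" "x < y" shows "V x < V y"
proof (rule DERIV_pos_imp_increasing_open[OF assms(2)])
  show "\<exists>d. (V has_real_derivative d) (at z) \<and> 0 < d" if "x < z" for z
    using V_deriv[of z] V'_pos[of z] that assms by auto
qed (rule continuous_on_subset[OF V_continuous], simp)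

lemma V_mono: "0 \<le> x \<Longrightarrow> x \<le> y \<Longrightarrow> V x \<le> V y"
  using V_strict_mono by (cases "x = y") (auto intro: less_imp_le)

lemma turning_point_exists:
  assumes "0 < E" obtains b where "0 < b" "V b = E"
proof -
  define y where "y = max 1 ((E / V 1) powr \<kappa>)"
  have V1: "0 < V 1" by (simp add: V_pos_right)
  have "E = V 1 * ((E / V 1) powr \<kappa>) powr (1 / \<kappa>)" using V1 assms kappa by (simp add: powr_powr)
  also have "\<dots> \<le> V 1 * (y / 1) powr (1 / \<kappa>)"
    using V1 kappa by (intro mult_left_mono powr_mono2) (auto simp: y_def)
  also have "\<dots> \<le> V y" by (rule scaling_lower) (auto simp: y_def)
  finally have "E \<le> V y" .
  moreover have "V 0 \<le> E" "0 \<le> y" using V_0 assms by (auto simp: y_def)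
  ultimately obtain b where b: "0 \<le> b" "V b = E"
    using IVT'[of V 0 E y] continuous_on_subset[OF V_continuous] by blast
  then have "0 < b" using V_0 assms by (cases "b = 0") auto
  then show ?thesis using b that by blast
qed

lemma large_right:
  obtains R where "0 < R" "\<And>x. R \<le> x \<Longrightarrow> M \<le> V x"
proof -
  obtain b where b: "0 < b" "V b = max M 1" by (rule turning_point_exists[of "max M 1"]) auto
  have "M \<le> V x" if "b \<le> x" for x using V_mono[of b x] b that by simp
  with b(1) show ?thesis by (rule that)
qed

end

sublocale power_like \<subseteq> confining V
proof
  show "continuous_on UNIV V" by (rule V_continuous)
  fix M
  interpret r: power_like "\<lambda>x. V (- x)" "\<lambda>x. - V' (- x)" \<kappa> by (rule power_like_reflect)
  obtain R where R: "0 < R" "\<And>x. R \<le> x \<Longrightarrow> M \<le> V x" using large_right by blast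
  obtain S where S: "0 < S" "\<And>x. S \<le> x \<Longrightarrow> M \<le> V (- x)" using r.large_right by blast
  have "M \<le> V x" if "max R S \<le> \<bar>x\<bar>" for x
    using R(2)[of x] S(2)[of "- x"] that by (cases "0 \<le> x") auto
  then show "\<exists>R>0. \<forall>x. R \<le> \<bar>x\<bar> \<longrightarrow> M \<le> V x" using R(1) by (intro exI[of _ "max R S"]) auto
qed

locale well = power_like +
  fixes E a b :: real
  assumes E_pos: "0 < E" and a_pos: "0 < a" and b_pos: "0 < b" and V_b: "V b = E" and V_a: "V (- a) = E"
begin

sublocale mirror: power_like "\<lambda>x. V (- x)" "\<lambda>x. - V' (- x)" \<kappa> by (rule power_like_reflect)

lemma well_reflect: "well (\<lambda>x. V (- x)) (\<lambda>x. - V' (- x)) \<kappa> E b a"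
  using E_pos a_pos b_pos V_a V_b by unfold_locales auto

lemma sublevel: "{y. V y \<le> E} = {- a..b}"
proof (rule set_eqI)
  fix y
  have right: "V y \<le> E" if "0 \<le> y" "y \<le> b" using V_mono[OF that] V_b by linarith
  have left: "V y \<le> E" if "y \<le> 0" "- a \<le> y"
  proof -
    have "0 \<le> - y" "- y \<le> a" using that by linarith+
    from mirror.V_mono[OF this] show ?thesis using V_a by simp
  qed
  have above: "E < V y" if "b < y" using V_strict_mono[OF less_imp_le[OF b_pos] that] V_b by linarith
  have below: "E < V y" if "y < - a"
  proof -
    have "a < - y" using that by linarith
    from mirror.V_strict_mono[OF less_imp_le[OF a_pos] this] show ?thesis using V_a by simp
  qed
  have "V y \<le> E \<longleftrightarrow> - a \<le> y \<and> y \<le> b" using right left above below by linarith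
  then show "y \<in> {y. V y \<le> E} \<longleftrightarrow> y \<in> {- a..b}" by simp
qed

lemma measure_sublevel: "measure lebesgue {y. V y \<le> E} = a + b"
  unfolding sublevel using a_pos b_pos by simp

lemma V_ge_right: assumes "b \<le> x" shows "E \<le> V x"
  using V_mono[OF less_imp_le[OF b_pos] assms] V_b by linarith

lemma V_ge_left: assumes "x \<le> - a" shows "E \<le> V x"
proof -
  have "a \<le> - x" using assms by linarith
  from mirror.V_mono[OF less_imp_le[OF a_pos] this] show ?thesis using V_a by simp
qed

text \<open>
  By near evenness and scaling, \<open>V\<close> is at most \<open>E\<close> at \<open>-t b\<close> for \<open>t = \<kappa> powr (-\<kappa>)\<close>, so \<open>t b \<le> a\<close>.
  Hence each of \<open>a\<close>, \<open>b\<close> is comparable to the length of the well.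
\<close>

lemma b_le_a: "b \<le> \<kappa> powr \<kappa> * a"
proof (rule ccontr)
  assume neg: "\<not> ?thesis"
  define t where "t = \<kappa> powr (- \<kappa>)"
  have t: "0 < t" "t \<le> 1" "t * \<kappa> powr \<kappa> = 1" "t powr (1 / \<kappa>) = 1 / \<kappa>"
  proof -
    show "0 < t" "t \<le> 1" using kappa powr_mono[of "- \<kappa>" 0 \<kappa>] by (simp_all add: t_def)
    show "t * \<kappa> powr \<kappa> = 1" using kappa by (simp add: t_def flip: powr_add)
    have "t powr (1 / \<kappa>) = \<kappa> powr (- 1)" unfolding t_def powr_powr using kappa by simp
    then show "t powr (1 / \<kappa>) = 1 / \<kappa>" using kappa by (simp add: powr_minus_divide)
  qed
  have "t * (\<kappa> powr \<kappa> * a) < t * b" using neg t by (intro mult_strict_left_mono) auto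
  moreover have "t * (\<kappa> powr \<kappa> * a) = a" using t(3) by (metis mult.assoc mult_1)
  ultimately have "a < t * b" by simp
  then have "V (- a) < V (- (t * b))" using mirror.V_strict_mono[of a "t * b"] a_pos by simp
  also have "\<dots> \<le> \<kappa> * V (t * b)" using nearly_even[of "t * b"] b_pos t by simp
  also have "\<dots> \<le> \<kappa> * (t powr (1 / \<kappa>) * V b)"
    using kappa b_pos t by (intro mult_left_mono scaling_down) auto
  also have "\<dots> = E" using t(4) kappa V_b by simp
  finally show False using V_a by simp
qed

lemma two_powr_kappa: "0 < (2::real) powr (- \<kappa>)" "(2::real) powr (- \<kappa>) \<le> 1"
    "((2::real) powr (- \<kappa>)) powr (1 / \<kappa>) = 1 / 2" "(2::real) powr (- \<kappa>) * 2 powr \<kappa> = 1"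
proof -
  show "(2::real) powr (- \<kappa>) \<le> 1" using kappa powr_mono[of "- \<kappa>" 0 "2::real"] by simp
  have "((2::real) powr (- \<kappa>)) powr (1 / \<kappa>) = 2 powr (- 1)" unfolding powr_powr using kappa by simp
  then show "((2::real) powr (- \<kappa>)) powr (1 / \<kappa>) = 1 / 2" by (simp add: powr_minus_divide)
  show "(2::real) powr (- \<kappa>) * 2 powr \<kappa> = 1" by (simp flip: powr_add)
qed simp

lemma V_half: assumes "x \<in> {0..2 powr (- \<kappa>) * b}" shows "V x \<le> E / 2"
proof -
  have "V x \<le> V (2 powr (- \<kappa>) * b)" using V_mono assms by simp
  also have "\<dots> \<le> (2 powr (- \<kappa>)) powr (1 / \<kappa>) * V b" by (rule scaling_down[OF two_powr_kappa(1,2) b_pos])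
  finally show ?thesis using two_powr_kappa(3) V_b by simp
qed

lemma V_double: assumes "2 powr \<kappa> * b \<le> x" shows "2 * E \<le> V x"
proof -
  have "V (2 powr (- \<kappa>) * (2 powr \<kappa> * b)) \<le> (2 powr (- \<kappa>)) powr (1 / \<kappa>) * V (2 powr \<kappa> * b)"
    using b_pos by (intro scaling_down[OF two_powr_kappa(1,2)]) simp
  moreover have "2 powr (- \<kappa>) * (2 powr \<kappa> * b) = b" using two_powr_kappa(4) by (metis mult.assoc mult_1)
  ultimately have "E \<le> 1 / 2 * V (2 powr \<kappa> * b)" using two_powr_kappa(3) V_b by simp
  then have "2 * E \<le> V (2 powr \<kappa> * b)" by simp
  also have "\<dots> \<le> V x" using assms b_pos by (intro V_mono) auto
  finally show ?thesis .
qed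

end

section \<open>Normalised eigenfunctions: amplitude and counting\<close>

locale normalised_state = well +
  fixes f f' :: "real \<Rightarrow> real"
  assumes es: "eigenstate V E f f'" and norm: "integral UNIV (\<lambda>x. (f x)\<^sup>2) = 1"
begin

lemma state_reflect: "eigenstate (\<lambda>x. V (- x)) E (\<lambda>x. f (- x)) (\<lambda>x. - f' (- x))"
  by (rule eigenstate_reflect[OF es])

lemma product_right: "b \<le> x \<Longrightarrow> f x * f' x \<le> 0"
  using product_nonpos[OF es V_ge_right] .

lemma product_left: assumes "x \<le> - a" shows "0 \<le> f x * f' x"
proof -
  have "E \<le> V (- y)" if "a \<le> y" for y using V_ge_left[of "- y"] that by simp
  from product_nonpos[OF state_reflect this, of a "- x"] show ?thesis using assms by simp
qed

lemma square_integrable: "(\<lambda>x. (f x)\<^sup>2) integrable_on S" if "S = {c..d} \<or> S = UNIV"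
  using that eigenstateD(3)[OF es] integrable_on_subinterval[OF eigenstateD(3)[OF es], of c d] by auto

lemma square_integral_le: "integral {c..d} (\<lambda>x. (f x)\<^sup>2) \<le> 1"
  unfolding norm[symmetric]
  by (rule integral_subset_le) (auto intro!: square_integrable)

lemma f_continuous: "continuous_on S f" "continuous_on S f'" "continuous_on S V"
  using eigenstateD(5,6)[OF es] continuous_on_subset[OF V_continuous] by auto

text \<open>
  Integrate \<open>(f f')' = f'\<^sup>2 + (V - E) f\<^sup>2\<close>; the boundary terms have the good sign outside the
  well.
\<close>

lemma energy_bound:
  assumes R: "a \<le> R" "b \<le> R"
  shows "integral {- R..R} (\<lambda>x. (f' x)\<^sup>2 + V x * (f x)\<^sup>2) \<le> E"
proof -
  have RR: "- R \<le> R" using R a_pos by simp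
  have i1: "((\<lambda>x. (f' x)\<^sup>2 + (V x - E) * (f x)\<^sup>2) has_integral (f R * f' R - f (- R) * f' (- R))) {- R..R}"
    using RR by (intro fundamental_theorem_of_calculus)
      (auto simp: has_real_derivative_iff_has_vector_derivative[symmetric] intro!: DERIV_subset[OF DERIV_product_eigenstate[OF es V_ge_right]])
  have i2: "((\<lambda>x. E * (f x)\<^sup>2) has_integral (E * integral {- R..R} (\<lambda>x. (f x)\<^sup>2))) {- R..R}"
    by (intro has_integral_mult_right integrable_integral square_integrable) auto
  have "((\<lambda>x. (f' x)\<^sup>2 + V x * (f x)\<^sup>2) has_integral
      (f R * f' R - f (- R) * f' (- R)) + E * integral {- R..R} (\<lambda>x. (f x)\<^sup>2)) {- R..R}"
    using has_integral_add[OF i1 i2] by (simp add: algebra_simps)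
  moreover have "E * integral {- R..R} (\<lambda>x. (f x)\<^sup>2) \<le> E * 1"
    using E_pos square_integral_le by (intro mult_left_mono) auto
  ultimately show ?thesis using product_right[of R] product_left[of "- R"] R by (simp add: integral_unique)
qed

text \<open>
  The function \<open>B = f\<^sup>2 + f'\<^sup>2 / (E - V)\<close> is nondecreasing on the right half of the well, so on the part
  where \<open>V \<le> E / 2\<close> the density \<open>f\<^sup>2 + f'\<^sup>2 / E\<close> is at least half its value at \<open>0\<close>. That part
  has length at least \<open>b * 2 powr (-\<kappa>)\<close>, and the total mass of the density is at most \<open>2\<close>.
\<close>

lemma initial_amplitude: "(f 0)\<^sup>2 + (f' 0)\<^sup>2 / E \<le> 4 * 2 powr \<kappa> / b"
proof -
  define c where "c = 2 powr (- \<kappa>) * b"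
  have c: "0 < c" "c \<le> b" using two_powr_kappa(1,2) b_pos by (simp_all add: c_def mult_left_le_one_le)
  define m where "m = (f 0)\<^sup>2 + (f' 0)\<^sup>2 / E"
  have uE: "0 < E - V x" if "0 \<le> x" "x < b" for x using V_strict_mono[OF that] V_b by simp
  define B where "B x = (f x)\<^sup>2 + (f' x)\<^sup>2 / (E - V x)" for x
  have lower: "m / 2 \<le> (f x)\<^sup>2 + (f' x)\<^sup>2 / E" if x: "x \<in> {0..c}" for x
  proof -
    have half: "E / 2 \<le> E - V x" "E - V x \<le> E" using V_half[of x] x V_nonneg[of x] by (auto simp: c_def)
    have "B 0 \<le> B x"
    proof (rule DERIV_nonneg_nondecreasing[where g = B and g' = "\<lambda>z. (f' z)\<^sup>2 * V' z / (E - V z)\<^sup>2"])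
      have "E - V z \<noteq> 0" if "z \<in> {0..x}" for z
      proof -
        have "V z \<le> E / 2" using V_half[of z] that x by (auto simp: c_def)
        then show ?thesis using E_pos by simp
      qed
      then show "continuous_on {0..x} B" unfolding B_def by (intro continuous_intros f_continuous) auto
      fix z assume z: "0 < z" "z < x"
      have nz: "E - V z \<noteq> 0" using V_half[of z] x z E_pos by (auto simp: c_def)
      have d: "((\<lambda>x. E - V x) has_real_derivative 0 - V' z) (at z)"
        using z by (intro DERIV_diff DERIV_const V_deriv) auto
      show "(B has_real_derivative (f' z)\<^sup>2 * V' z / (E - V z)\<^sup>2) (at z)"
        unfolding B_def
        using DERIV_add[OF DERIV_square[OF eigenstateD(1)[OF es, of z]]
            DERIV_divide[OF DERIV_square[OF eigenstateD(2)[OF es, of z]] d nz]]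
      proof (rule DERIV_cong)
        have "2 * p * q + (2 * (q * (- w * p)) * w - q\<^sup>2 * (0 - v)) / (w * w) = q\<^sup>2 * v / w\<^sup>2" if "w \<noteq> 0" for p q v w :: real
          using that by (simp add: field_simps power2_eq_square)
        from this[OF nz, of "f z" "f' z" "V' z"]
        show "2 * (f z * f' z) + (2 * (f' z * ((V z - E) * f z)) * (E - V z) - (f' z)\<^sup>2 * (0 - V' z)) / ((E - V z) * (E - V z))
            = (f' z)\<^sup>2 * V' z / (E - V z)\<^sup>2" by simp
      qed
      show "0 \<le> (f' z)\<^sup>2 * V' z / (E - V z)\<^sup>2" using V'_pos[OF z(1)] by simp
    qed (use x in auto)
    moreover have "B 0 = m" by (simp add: B_def m_def V_0)
    ultimately have mB: "m \<le> B x" by simp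
    have "(f' x)\<^sup>2 / (E - V x) \<le> (f' x)\<^sup>2 / (E / 2)" using half E_pos by (intro divide_left_mono) auto
    also have "(f' x)\<^sup>2 / (E / 2) = 2 * ((f' x)\<^sup>2 / E)" by simp
    finally have "B x \<le> (f x)\<^sup>2 + 2 * ((f' x)\<^sup>2 / E)" by (simp add: B_def)
    then show ?thesis using mB zero_le_power2[of "f x"] by linarith
  qed
  define R where "R = max a b"
  have ci: "continuous_on S (\<lambda>x. (f x)\<^sup>2 + (f' x)\<^sup>2 / E)" "continuous_on S (\<lambda>x. (f' x)\<^sup>2 + V x * (f x)\<^sup>2)" for S
    using E_pos by (auto intro!: continuous_intros f_continuous)
  have "integral {0..c} (\<lambda>x. m / 2) \<le> integral {0..c} (\<lambda>x. (f x)\<^sup>2 + (f' x)\<^sup>2 / E)"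
    using lower by (intro integral_le integrable_continuous_real ci continuous_on_const) blast
  also have "\<dots> \<le> integral {- R..R} (\<lambda>x. (f x)\<^sup>2 + (f' x)\<^sup>2 / E)"
    by (rule integral_subset_le) (use c a_pos E_pos in \<open>auto intro!: integrable_continuous_real ci simp: R_def\<close>)
  also have "\<dots> \<le> integral {- R..R} (\<lambda>x. (f x)\<^sup>2 + ((f' x)\<^sup>2 + V x * (f x)\<^sup>2) / E)"
    using E_pos V_nonneg
    by (intro integral_le integrable_continuous_real) (auto intro!: continuous_intros f_continuous simp: field_simps)
  also have "\<dots> = integral {- R..R} (\<lambda>x. (f x)\<^sup>2) + integral {- R..R} (\<lambda>x. (f' x)\<^sup>2 + V x * (f x)\<^sup>2) / E"
    using E_pos
    by (subst Henstock_Kurzweil_Integration.integral_add) (auto intro!: integrable_continuous_real continuous_intros f_continuous)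
  also have "\<dots> \<le> 1 + E / E"
    using E_pos by (intro add_mono square_integral_le divide_right_mono energy_bound) (auto simp: R_def)
  finally have "c * m \<le> 4" using c E_pos by simp
  then have "m \<le> 4 / c" using c by (simp add: field_simps)
  also have "4 / c = 4 * 2 powr \<kappa> / b" by (simp add: c_def powr_minus_divide)
  finally show ?thesis by (simp add: m_def)
qed

text \<open>
  Integrate \<open>(f\<^sup>2)'\<close> from \<open>x\<close> to infinity and use \<open>2 \<bar>f f'\<bar> \<le> sqrt E f\<^sup>2 + f'\<^sup>2 / sqrt E\<close>.
\<close>

lemma square_bound: "(f x)\<^sup>2 \<le> 2 * sqrt E"
proof (rule field_le_epsilon)
  fix e :: real assume "0 < e"
  have "(f \<longlongrightarrow> 0) at_top" by (rule eigenstate_tendsto_0[OF es V_ge_right])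
  then have "\<forall>\<^sub>F y in at_top. \<bar>f y\<bar> < sqrt e" using \<open>0 < e\<close> tendstoD[of f 0 at_top "sqrt e"] by simp
  then have "\<forall>\<^sub>F y in at_top. \<bar>f y\<bar> < sqrt e \<and> max (max a b) \<bar>x\<bar> \<le> y"
    by (intro eventually_conj eventually_ge_at_top)
  then obtain R where R: "\<bar>f R\<bar> < sqrt e" "max (max a b) \<bar>x\<bar> \<le> R"
    using eventually_happens trivial_limit_at_top_linorder by blast
  then have Rx: "x \<le> R" "a \<le> R" "b \<le> R" "- R \<le> x" by auto
  have "(f R)\<^sup>2 \<le> e" using R(1) \<open>0 < e\<close> by (metis abs_ge_zero less_imp_le power2_abs power_mono real_sqrt_pow2)
  have sE: "0 < sqrt E" using E_pos by simp
  have i: "((\<lambda>x. 2 * (f x * f' x)) has_integral ((f R)\<^sup>2 - (f x)\<^sup>2)) {x..R}"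
    using Rx by (intro fundamental_theorem_of_calculus)
      (auto simp: has_real_derivative_iff_has_vector_derivative[symmetric] intro!: DERIV_subset[OF DERIV_square] eigenstateD(1)[OF es])
  define g where "g x = sqrt E * (f x)\<^sup>2 + ((f' x)\<^sup>2 + V x * (f x)\<^sup>2) / sqrt E" for x
  have gc: "continuous_on S g" for S unfolding g_def
    using sE by (auto intro!: continuous_intros f_continuous)
  have g: "- (2 * (f y * f' y)) \<le> g y" for y
  proof -
    have "0 \<le> (sqrt E * f y + f' y)\<^sup>2 + V y * (f y)\<^sup>2" using V_nonneg[of y] by simp
    then have "0 \<le> ((sqrt E * f y + f' y)\<^sup>2 + V y * (f y)\<^sup>2) / sqrt E" using sE by simp
    also have "\<dots> = g y + 2 * (f y * f' y)"
      using sE E_pos by (simp add: g_def power2_eq_square field_simps)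
    finally show ?thesis by simp
  qed
  have "- ((f R)\<^sup>2 - (f x)\<^sup>2) \<le> integral {x..R} g"
    using has_integral_le[OF has_integral_neg[OF i] integrable_integral[OF integrable_continuous_real[OF gc]]] g by simp
  also have "\<dots> \<le> integral {- R..R} g"
    by (rule integral_subset_le)
       (use Rx sE V_nonneg in \<open>auto intro!: integrable_continuous_real gc simp: g_def\<close>)
  also have "\<dots> = sqrt E * integral {- R..R} (\<lambda>x. (f x)\<^sup>2) + integral {- R..R} (\<lambda>x. (f' x)\<^sup>2 + V x * (f x)\<^sup>2) / sqrt E"
    unfolding g_def using sE
    by (subst Henstock_Kurzweil_Integration.integral_add) (auto intro!: integrable_continuous_real continuous_intros f_continuous)
  also have "\<dots> \<le> sqrt E * 1 + E / sqrt E"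
    using sE Rx by (intro add_mono mult_left_mono square_integral_le divide_right_mono energy_bound) auto
  also have "\<dots> = 2 * sqrt E" using E_pos by (simp add: real_div_sqrt)
  finally show "(f x)\<^sup>2 \<le> 2 * sqrt E + e" using \<open>(f R)\<^sup>2 \<le> e\<close> by simp
qed

text \<open>
  At least half of the mass of \<open>f\<^sup>2\<close> lies where \<open>V < 2 E\<close>, an interval of length at most
  \<open>2 powr \<kappa> * (a + b)\<close>, and on it \<open>f\<^sup>2\<close> is at most \<open>2 * sqrt E\<close>.
\<close>

lemma uncertainty: "1 \<le> 4 * 2 powr \<kappa> * (sqrt E * (a + b))"
proof -
  define L where "L = 2 powr \<kappa>"
  have L: "1 \<le> L" unfolding L_def using kappa by (intro ge_one_powr_ge_zero) auto
  interpret mirror: well "\<lambda>x. V (- x)" "\<lambda>x. - V' (- x)" \<kappa> E b a by (rule well_reflect)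
  have out: "2 * E \<le> V x" if "x \<notin> {- L * a..L * b}" for x
    using V_double[of x] mirror.V_double[of "- x"] that by (auto simp: L_def not_le)
  have "integral UNIV (\<lambda>x. (f x)\<^sup>2) \<le> 1 / 2 + 2 * sqrt E * (L * (a + b))"
  proof (rule integral_UNIV_bounded(2))
    fix k :: nat
    define R where "R = max (real k) (max (L * a) (L * b))"
    have R: "max (L * a) (L * b) \<le> R" "real k \<le> R" by (simp_all add: R_def)
    have "a \<le> L * a" "b \<le> L * b" using L a_pos b_pos by simp_all
    moreover have "L * a \<le> R" "L * b \<le> R" using R by simp_all
    moreover have "- L * a = - (L * a)" by simp
    ultimately have R': "a \<le> R" "b \<le> R" "- L * a \<le> L * b" using a_pos b_pos by linarith+
    define J where "J = {- L * a..L * b}"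
    have JR: "J \<subseteq> {- R..R}" using R by (auto simp: J_def)
    have iJ: "((\<lambda>x. if x \<in> J then (2 * sqrt E) else 0) has_integral (2 * sqrt E * (L * (a + b)))) {- R..R}"
    proof (subst has_integral_restrict[OF JR])
      show "((\<lambda>x. 2 * sqrt E) has_integral 2 * sqrt E * (L * (a + b))) J"
        using has_integral_const_real[of "2 * sqrt E" "- L * a" "L * b"] R' unfolding J_def
        by (simp add: algebra_simps)
    qed
    have iV: "((\<lambda>x. ((f' x)\<^sup>2 + V x * (f x)\<^sup>2) / (2 * E)) has_integral
        (integral {- R..R} (\<lambda>x. (f' x)\<^sup>2 + V x * (f x)\<^sup>2) / (2 * E))) {- R..R}"
      by (intro has_integral_divide integrable_integral integrable_continuous_real continuous_intros f_continuous)
    have "integral {- R..R} (\<lambda>x. (f x)\<^sup>2)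
        \<le> integral {- R..R} (\<lambda>x. (f' x)\<^sup>2 + V x * (f x)\<^sup>2) / (2 * E) + 2 * sqrt E * (L * (a + b))"
    proof (rule has_integral_le[OF integrable_integral[OF square_integrable] has_integral_add[OF iV iJ]])
      fix x
      have nn: "0 \<le> (f' x)\<^sup>2 / (2 * E)" "0 \<le> V x * (f x)\<^sup>2 / (2 * E)" using V_nonneg[of x] E_pos by simp_all
      show "(f x)\<^sup>2 \<le> ((f' x)\<^sup>2 + V x * (f x)\<^sup>2) / (2 * E) + (if x \<in> J then 2 * sqrt E else 0)"
      proof (cases "x \<in> J")
        case True
        then show ?thesis using square_bound[of x] nn unfolding add_divide_distrib by simp
      next
        case False
        have "(2 * E) * (f x)\<^sup>2 \<le> V x * (f x)\<^sup>2" using out[of x] False by (intro mult_right_mono) (auto simp: J_def)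
        then have "(f x)\<^sup>2 \<le> V x * (f x)\<^sup>2 / (2 * E)" using E_pos by (simp add: field_simps)
        then show ?thesis using False nn unfolding add_divide_distrib by simp
      qed
    qed auto
    also have "\<dots> \<le> E / (2 * E) + 2 * sqrt E * (L * (a + b))"
      using E_pos R' by (intro add_mono divide_right_mono energy_bound) auto
    finally have "integral {- R..R} (\<lambda>x. (f x)\<^sup>2) \<le> 1 / 2 + 2 * sqrt E * (L * (a + b))" using E_pos by simp
    moreover have "integral {- real k..real k} (\<lambda>x. (f x)\<^sup>2) \<le> integral {- R..R} (\<lambda>x. (f x)\<^sup>2)"
      using R by (intro integral_subset_le square_integrable) auto
    ultimately show "integral {- real k..real k} (\<lambda>x. (f x)\<^sup>2) \<le> 1 / 2 + 2 * sqrt E * (L * (a + b))" by linarith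
  qed (auto intro!: continuous_intros f_continuous)
  then show ?thesis unfolding norm L_def[symmetric] by (simp add: algebra_simps)
qed

text \<open>
  Outside the well \<open>f\<^sup>2\<close> is monotone, so a zero there would make \<open>f\<close> vanish on a half line.
\<close>

lemma zeros_in_well: assumes "f z = 0" shows "z \<in> {- a..b}"
proof -
  have "z \<le> b"
  proof (rule ccontr)
    assume "\<not> z \<le> b"
    then have z: "b < z" by simp
    have "f x = 0" if "z \<le> x" for x
      using square_antimono[OF es V_ge_right _ that] z assms by simp
    then show False using eigenstate_nonzero_in_interval[OF es, of z "z + 1"] by force
  qed
  moreover have "- a \<le> z"
  proof (rule ccontr)
    assume "\<not> - a \<le> z"
    then have z: "a < - z" by simp
    have VE: "E \<le> V (- y)" if "a \<le> y" for y using V_ge_left[of "- y"] that by simp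
    have "f x = 0" if "x \<le> z" for x
      using square_antimono[OF state_reflect VE, of a "- z" "- x"] z that assms by simp
    then show False using eigenstate_nonzero_in_interval[OF es, of "z - 1" z] by force
  qed
  ultimately show ?thesis by simp
qed

lemma eigenvalue_iff: "eigenvalue V F \<longleftrightarrow> (\<exists>g g'. eigenstate V F g g')"
  unfolding eigenvalue_def
  using eigenfunction_imp_eigenstate[OF V_continuous] eigenstate_imp_eigenfunction[OF V_continuous] by blast

text \<open>
  A state with \<open>n - 1\<close> smaller eigenvalues has \<open>n - 1\<close> zeros in the well, at mutual distance at least
  \<open>1 / sqrt E\<close>. This gives \<open>n \<le> sqrt E * (a + b) + 2\<close>, and \<open>uncertainty\<close> absorbs the \<open>2\<close>.
\<close>

lemma index_upper:
  assumes n: "nth_eigenvalue V n E"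
  shows "real n \<le> (1 + 8 * 2 powr \<kappa>) * (sqrt E * (a + b))"
proof -
  define S where "S = {F. eigenvalue V F \<and> F \<le> E}"
  have S: "finite S" "card S = n" "E \<in> S" using n by (auto simp: nth_eigenvalue_def S_def)
  have "\<exists>Z. finite Z \<and> card Z = n - 1 \<and> (\<forall>z\<in>Z. f z = 0)"
  proof (rule zeros_of_higher_eigenstate[OF _ _ _ es, of "S - {E}"])
    show "finite (S - {E})" "card (S - {E}) = n - 1" using S by simp_all
    show "F < E \<and> (\<exists>g g'. eigenstate V F g g')" if "F \<in> S - {E}" for F
      using that by (auto simp: S_def eigenvalue_iff)
  qed
  then obtain Z where Z: "finite Z" "card Z = n - 1" "\<And>z. z \<in> Z \<Longrightarrow> f z = 0" by blast
  have sE: "0 < sqrt E" using E_pos by simp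
  have N: "real n \<le> sqrt E * (a + b) + 2"
  proof (cases "Z = {}")
    case True
    then have "n \<le> 1" using Z by simp
    moreover have "0 \<le> sqrt E * (a + b)" using sE a_pos b_pos by simp
    ultimately show ?thesis by linarith
  next
    case False
    have "(real (card Z) - 1) * (1 / sqrt E) \<le> b - (- a)"
    proof (rule card_separated_le[OF Z(1) False])
      fix z z' assume zz: "z \<in> Z" "z' \<in> Z" "z < z'"
      have "1 \<le> E * (z' - z)\<^sup>2"
      proof (rule eigenstate_zero_spacing[OF es Z(3)[OF zz(1)] Z(3)[OF zz(2)] zz(3)])
        show "0 \<le> V x \<and> V x \<le> E" if "x \<in> {z..z'}" for x
        proof -
          have "x \<in> {- a..b}" using that zeros_in_well[OF Z(3)[OF zz(1)]] zeros_in_well[OF Z(3)[OF zz(2)]] by auto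
          then show ?thesis using sublevel V_nonneg by auto
        qed
        show "\<exists>x\<in>{z..z'}. f x \<noteq> 0" using eigenstate_nonzero_in_interval[OF es zz(3)] by force
      qed
      then have "sqrt 1 \<le> sqrt (E * (z' - z)\<^sup>2)" by (rule real_sqrt_le_mono)
      then have "1 \<le> sqrt E * (z' - z)" using zz by (simp add: real_sqrt_mult)
      then show "1 / sqrt E \<le> z' - z" using sE by (simp add: field_simps)
    next
      show "- a \<le> z \<and> z \<le> b" if "z \<in> Z" for z using zeros_in_well[OF Z(3)[OF that]] by simp
    qed
    then have "real (card Z) - 1 \<le> sqrt E * (a + b)" using sE by (simp add: field_simps)
    then show ?thesis using Z(2) by linarith
  qed
  then show ?thesis using uncertainty by (simp add: algebra_simps)
qed

text \<open>
  Apply \<open>many_eigenvalues\<close> with \<open>s\<^sup>2 = E / 2\<close> on the part of the right half of the well where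
  \<open>V \<le> E / 2\<close>.
\<close>

lemma index_lower:
  assumes n: "nth_eigenvalue V n E" and n1: "1 \<le> n"
  shows "sqrt E * b \<le> 10 * 2 powr \<kappa> * real n"
proof -
  define s where "s = sqrt (E / 2)"
  have s: "0 < s" "s\<^sup>2 = E / 2" using E_pos by (simp_all add: s_def)
  define c where "c = 2 powr (- \<kappa>) * b"
  have c: "0 < c" using b_pos by (simp add: c_def)
  define M where "M = nat \<lfloor>c * s / pi\<rfloor>"
  have pos: "0 \<le> c * s / pi" using c s by simp
  then have M: "real M \<le> c * s / pi" "c * s / pi < real M + 1" unfolding M_def by linarith+
  have "\<exists>S. finite S \<and> card S = M \<and> (\<forall>F\<in>S. F \<le> E \<and> eigenvalue V F)"
  proof (rule many_eigenvalues[OF V_nonneg E_pos s(1)])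
    fix x assume x: "x \<in> {0..real M * pi / s}"
    have "real M * pi / s \<le> c" using M(1) s(1) by (simp add: field_simps)
    then have "V x \<le> E / 2" using V_half[of x] x by (auto simp: c_def)
    then show "V x \<le> E - s\<^sup>2" using s(2) by simp
  qed
  then obtain S where S: "finite S" "card S = M" "\<forall>F\<in>S. F \<le> E \<and> eigenvalue V F" by blast
  have "card S \<le> card {F. eigenvalue V F \<and> F \<le> E}"
    using n S(3) by (intro card_mono) (auto simp: nth_eigenvalue_def)
  then have "M \<le> n" using n S(2) by (simp add: nth_eigenvalue_def)
  then have "c * s / pi \<le> 2 * real n" using M(2) n1 by linarith
  then have "c * s \<le> 2 * real n * pi" using pi_gt_zero by (simp add: field_simps)
  \<comment> \<open>The number \<open>16/5\<close> exceeds \<open>\<pi>\<close>, and below \<open>3/2\<close> exceeds \<open>sqrt 2\<close>; their product with \<open>2\<close> is less than \<open>10\<close>.\<close>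
  also have "\<dots> \<le> 2 * real n * (16/5)" by (intro mult_left_mono) (use pi_approx in simp_all)
  finally have cs: "c * s \<le> real n * (32/5)" by simp
  have "sqrt E = sqrt 2 * s" by (simp add: s_def real_sqrt_divide)
  also have "\<dots> \<le> 3/2 * s" using s(1) by (intro mult_right_mono real_le_lsqrt) (auto simp: power2_eq_square)
  finally have "c * sqrt E \<le> c * (3/2 * s)" using c by (intro mult_left_mono) auto
  also have "\<dots> \<le> 10 * real n" using cs by simp
  finally have le: "c * sqrt E \<le> 10 * real n" .
  have "b = 2 powr \<kappa> * c" using two_powr_kappa(4) unfolding c_def by (metis mult.assoc mult.commute mult_1)
  then have "sqrt E * b = 2 powr \<kappa> * (c * sqrt E)" by simp
  also have "\<dots> \<le> 2 powr \<kappa> * (10 * real n)" by (intro mult_left_mono le) simp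
  finally show ?thesis by simp
qed

text \<open>
  The function \<open>f'\<^sup>2 - (V - E) f\<^sup>2\<close> is nonincreasing. If it were negative somewhere, then
  \<open>(V - E) f\<^sup>2\<close> would be bounded below by a positive constant from there on.
\<close>

lemma energy_function_nonneg: assumes "b \<le> x" shows "(V x - E) * (f x)\<^sup>2 \<le> (f' x)\<^sup>2"
proof (rule ccontr)
  assume neg: "\<not> ?thesis"
  define A where "A y = (f' y)\<^sup>2 - (V y - E) * (f y)\<^sup>2" for y
  have e: "0 < - A x" using neg by (simp add: A_def)
  have le: "A y \<le> A x" if "x \<le> y" for y
  proof (rule DERIV_nonpos_imp_nonincreasing[OF that])
    fix z assume "x \<le> z"
    then have z: "0 < z" using assms b_pos by simp
    have "((\<lambda>y. V y - E) has_real_derivative V' z - 0) (at z)"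
      using z by (intro DERIV_diff V_deriv DERIV_const) simp
    from DERIV_diff[OF DERIV_square[OF eigenstateD(2)[OF es]] DERIV_mult[OF this DERIV_square[OF eigenstateD(1)[OF es]]]]
    have "(A has_real_derivative - V' z * (f z)\<^sup>2) (at z)"
      unfolding A_def by (rule DERIV_cong) (simp add: algebra_simps)
    then show "\<exists>d. (A has_real_derivative d) (at z) \<and> d \<le> 0" using V'_pos[OF z] by (intro exI[of _ "- V' z * (f z)\<^sup>2"]) simp
  qed
  obtain y where y: "x \<le> y" "(f' y)\<^sup>2 + (V y - E) * (f y)\<^sup>2 < - A x"
    using energy_not_bounded_below[OF es V_ge_right e, where y = x] by auto
  have "- A x \<le> - A y" using le[OF y(1)] by simp
  also have "\<dots> \<le> (V y - E) * (f y)\<^sup>2" by (simp add: A_def)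
  also have "\<dots> \<le> (f' y)\<^sup>2 + (V y - E) * (f y)\<^sup>2" by simp
  finally show False using y(2) by simp
qed

end

section \<open>Solutions near a turning point\<close>

text \<open>
  The second mean value theorem replaces the integral by boundary terms of \<open>K\<close>, whatever the
  oscillations of \<open>D\<close>.
\<close>

lemma monotone_weight_integral_bound:
  fixes g K D :: "real \<Rightarrow> real"
  assumes ab: "a \<le> b"
    and K: "\<And>x. a \<le> x \<Longrightarrow> x \<le> b \<Longrightarrow> (K has_real_derivative D x) (at x)"
    and Kb: "\<And>x. a \<le> x \<Longrightarrow> x \<le> b \<Longrightarrow> \<bar>K x\<bar> \<le> k"
    and g: "0 \<le> g a" "\<And>x y. a \<le> x \<Longrightarrow> x \<le> y \<Longrightarrow> y \<le> b \<Longrightarrow> g x \<le> g y"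
  obtains J where "((\<lambda>x. g x * D x) has_integral J) {a..b}" "\<bar>J\<bar> \<le> 4 * k * g b"
proof -
  have ftc: "(D has_integral K d - K c) {c..d}" if "a \<le> c" "c \<le> d" "d \<le> b" for c d
    using that K
    by (intro fundamental_theorem_of_calculus)
       (auto simp: has_real_derivative_iff_has_vector_derivative[symmetric] intro!: DERIV_subset[OF K])
  obtain c where c: "c \<in> {a..b}"
    "((\<lambda>x. g x * D x) has_integral g a * integral {a..c} D + g b * integral {c..b} D) {a..b}"
    by (rule second_mean_value_theorem_full[of D a b g]) (use ftc[of a b] ab g in \<open>auto simp: has_integral_integrable\<close>)
  have "integral {a..c} D = K c - K a" "integral {c..b} D = K b - K c"
    using ftc[of a c] ftc[of c b] c(1) by (auto intro: integral_unique)
  with c(2) have J: "((\<lambda>x. g x * D x) has_integral g a * (K c - K a) + g b * (K b - K c)) {a..b}" by simp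
  have "\<bar>K c - K a\<bar> \<le> 2 * k" "\<bar>K b - K c\<bar> \<le> 2 * k"
    using Kb[of a] Kb[of b] Kb[of c] c(1) ab by auto
  moreover have "0 \<le> g b" "g a \<le> g b" using g ab by (auto intro: order_trans)
  moreover have "0 \<le> k" using Kb[of a] ab by auto
  ultimately have "\<bar>g a * (K c - K a)\<bar> \<le> g b * (2 * k)" "\<bar>g b * (K b - K c)\<bar> \<le> g b * (2 * k)"
    unfolding abs_mult using g(1) by (auto intro!: mult_mono)
  then have "\<bar>g a * (K c - K a) + g b * (K b - K c)\<bar> \<le> 4 * k * g b" by (simp add: algebra_simps)
  with J show ?thesis using that by blast
qed

text \<open>
  The common hypothesis that the classes of potentials share near a turning point, which is normalised to
  lie at \<open>1\<close>. For \<open>\<alpha> = 1/4\<close> the slope is a difference of nondecreasing functions exactly; a larger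
  \<open>\<alpha>\<close> leaves room for a relative error \<open>4 * \<alpha> - 1\<close>.
\<close>

definition almost_monotone_slope :: "real \<Rightarrow> real \<Rightarrow> real \<Rightarrow> (real \<Rightarrow> real) \<Rightarrow> bool" where
  "almost_monotone_slope \<alpha> \<eta> \<Lambda> W' \<longleftrightarrow> (\<exists>p q.
     (\<forall>x y. 1 - \<eta> \<le> x \<longrightarrow> x \<le> y \<longrightarrow> y \<le> 1 \<longrightarrow> 0 \<le> p x \<and> p x \<le> p y \<and> 0 \<le> q x \<and> q x \<le> q y) \<and>
     p 1 + q 1 \<le> \<Lambda> \<and>
     (\<forall>x. 1 - \<eta> \<le> x \<longrightarrow> x \<le> 1 \<longrightarrow> \<bar>W' x - (p x - q x)\<bar> \<le> (4 * \<alpha> - 1) * W' x))"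

lemma almost_monotone_slopeI:
  assumes "\<And>x y. 1 - \<eta> \<le> x \<Longrightarrow> x \<le> y \<Longrightarrow> y \<le> 1 \<Longrightarrow> 0 \<le> p x \<and> p x \<le> p y \<and> 0 \<le> q x \<and> q x \<le> q y"
    and "p 1 + q 1 \<le> \<Lambda>"
    and "\<And>x. 1 - \<eta> \<le> x \<Longrightarrow> x \<le> 1 \<Longrightarrow> \<bar>W' x - (p x - q x)\<bar> \<le> (4 * \<alpha> - 1) * W' x"
  shows "almost_monotone_slope \<alpha> \<eta> \<Lambda> W'"
  unfolding almost_monotone_slope_def
  by (rule exI[of _ p], rule exI[of _ q]) (use assms in simp)

text \<open>
  The eigenvalue equation on a half line in units in which the turning point is \<open>1\<close> and the energy is \<open>1\<close>:
  \<open>\<Psi> x = f (b * x)\<close>, \<open>P x = f' (b * x) / sqrt E\<close>, and the large parameter is \<open>lam = sqrt E * b\<close>.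
\<close>

locale turning_point =
  fixes W W' \<Psi> P :: "real \<Rightarrow> real" and lam c0 :: real
  assumes lam: "0 < lam" and c0: "0 < c0"
    and W_continuous: "continuous_on UNIV W" and W_0: "W 0 = 0" and W_1: "W 1 = 1"
    and W_deriv: "\<And>x. 0 < x \<Longrightarrow> (W has_real_derivative W' x) (at x)"
    and W'_continuous: "continuous_on {0<..} W'"
    and W'_nonneg: "\<And>x. 0 < x \<Longrightarrow> 0 \<le> W' x"
    and W'_lower: "\<And>x. 1/2 \<le> x \<Longrightarrow> x \<le> 1 \<Longrightarrow> c0 \<le> W' x"
    and Psi_deriv: "\<And>x. (\<Psi> has_real_derivative lam * P x) (at x)"
    and P_deriv: "\<And>x. (P has_real_derivative lam * ((W x - 1) * \<Psi> x)) (at x)"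
    and decreasing: "\<And>x. 1 \<le> x \<Longrightarrow> \<Psi> x * P x \<le> 0"
    and energy_nonneg: "\<And>x. 1 \<le> x \<Longrightarrow> (W x - 1) * (\<Psi> x)\<^sup>2 \<le> (P x)\<^sup>2"
begin

definition u :: "real \<Rightarrow> real" where "u x = 1 - W x"
definition A :: "real \<Rightarrow> real" where "A x = u x * (\<Psi> x)\<^sup>2 + (P x)\<^sup>2"

lemma W_mono: assumes "0 \<le> x" "x \<le> y" shows "W x \<le> W y"
  by (rule DERIV_nonneg_nondecreasing[where g = W and g' = W'])
     (use assms W_deriv W'_nonneg continuous_on_subset[OF W_continuous] in auto)

lemma u_antimono: "0 \<le> x \<Longrightarrow> x \<le> y \<Longrightarrow> u y \<le> u x"
  using W_mono by (simp add: u_def)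

lemma u_le_1: "0 \<le> x \<Longrightarrow> u x \<le> 1"
  using u_antimono[of 0 x] by (simp add: u_def W_0)

lemma u_lower:
  assumes "1/2 \<le> x" "x \<le> 1" shows "c0 * (1 - x) \<le> u x"
proof -
  have "W x - c0 * x \<le> W 1 - c0 * 1"
  proof (rule DERIV_nonneg_imp_nondecreasing[OF assms(2)])
    fix z assume "x \<le> z" "z \<le> 1"
    then have "((\<lambda>x. W x - c0 * x) has_real_derivative W' z - c0) (at z)" "0 \<le> W' z - c0"
      using assms W'_lower[of z] DERIV_diff[OF W_deriv DERIV_cmult_Id, of z c0] by auto
    then show "\<exists>y. ((\<lambda>x. W x - c0 * x) has_real_derivative y) (at z) \<and> 0 \<le> y" by blast
  qed
  then show ?thesis by (simp add: u_def W_1 algebra_simps)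
qed

lemma u_pos: assumes "0 \<le> x" "x < 1" shows "0 < u x"
proof -
  have "0 < c0 * (1 - max x (1/2))" using assms c0 by simp
  also have "\<dots> \<le> u (max x (1/2))" using assms by (intro u_lower) auto
  also have "\<dots> \<le> u x" using assms by (intro u_antimono) auto
  finally show ?thesis .
qed

lemma u_deriv: "0 < x \<Longrightarrow> (u has_real_derivative - W' x) (at x)"
  using DERIV_diff[OF DERIV_const W_deriv] unfolding u_def by simp

lemma A_deriv:
  assumes "0 < x" shows "(A has_real_derivative - W' x * (\<Psi> x)\<^sup>2) (at x)"
  using DERIV_add[OF DERIV_mult[OF u_deriv[OF assms] DERIV_square[OF Psi_deriv]] DERIV_square[OF P_deriv]]
  unfolding A_def by (rule DERIV_cong) (simp add: u_def algebra_simps power2_eq_square)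

lemma Psi_P_continuous: "continuous_on S \<Psi>" "continuous_on S P"
  using DERIV_isCont[OF Psi_deriv] DERIV_isCont[OF P_deriv]
  by (auto intro: continuous_at_imp_continuous_on)

lemma u_continuous: "continuous_on S u"
  unfolding u_def by (intro continuous_intros continuous_on_subset[OF W_continuous]) auto

lemma A_antimono: assumes "0 \<le> x" "x \<le> y" shows "A y \<le> A x"
proof -
  have "continuous_on {x..y} (\<lambda>x. - A x)" unfolding A_def
    by (intro continuous_intros u_continuous Psi_P_continuous)
  moreover have "((\<lambda>x. - A x) has_real_derivative W' z * (\<Psi> z)\<^sup>2) (at z)" if "x < z" for z
    using DERIV_minus[OF A_deriv[of z]] assms that by simp
  ultimately have "- A x \<le> - A y"
    using assms W'_nonneg
    by (intro DERIV_nonneg_nondecreasing[where g = "\<lambda>x. - A x" and g' = "\<lambda>z. W' z * (\<Psi> z)\<^sup>2", OF assms(2)]) auto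
  then show ?thesis by simp
qed

lemma P_le_A: "0 \<le> x \<Longrightarrow> x \<le> 1 \<Longrightarrow> (P x)\<^sup>2 \<le> A x"
  using u_antimono[of x 1] by (simp add: A_def) (simp add: u_def W_1)

lemma A_nonneg: "0 \<le> x \<Longrightarrow> x \<le> 1 \<Longrightarrow> 0 \<le> A x"
  using P_le_A[of x] by (meson order_trans zero_le_power2)

lemma Psi_square_antimono:
  assumes "1 \<le> x" shows "(\<Psi> x)\<^sup>2 \<le> (\<Psi> 1)\<^sup>2"
proof (rule DERIV_nonpos_imp_nonincreasing[OF assms])
  fix z :: real assume "1 \<le> z"
  then have "2 * (\<Psi> z * (lam * P z)) \<le> 0"
    using mult_nonneg_nonpos[of lam "\<Psi> z * P z"] decreasing[of z] lam by (simp add: algebra_simps)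
  then show "\<exists>y. ((\<lambda>x. (\<Psi> x)\<^sup>2) has_real_derivative y) (at z) \<and> y \<le> 0"
    using DERIV_square[OF Psi_deriv] by blast
qed

lemma P_square_antimono:
  assumes "1 \<le> x" shows "(P x)\<^sup>2 \<le> (P 1)\<^sup>2"
proof (rule DERIV_nonpos_imp_nonincreasing[OF assms])
  fix z :: real assume z: "1 \<le> z"
  have "0 \<le> lam * (W z - 1)" using lam W_mono[of 1 z] z W_1 by simp
  then have "(lam * (W z - 1)) * (\<Psi> z * P z) \<le> 0" using decreasing[OF z] by (rule mult_nonneg_nonpos)
  then have "2 * (P z * (lam * ((W z - 1) * \<Psi> z))) \<le> 0" by (simp add: algebra_simps)
  then show "\<exists>y. ((\<lambda>x. (P x)\<^sup>2) has_real_derivative y) (at z) \<and> y \<le> 0"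
    using DERIV_square[OF P_deriv] by blast
qed

text \<open>
  Put \<open>D = P\<^sup>2 - u \<Psi>\<^sup>2\<close>, which is the derivative of \<open>\<Psi> P / lam\<close>. The derivative of
  \<open>G = u powr (2 * \<alpha> - 1) * A\<close> is
  \<open>u powr (2 * \<alpha> - 2) * W' * (D / 2 - (2 * \<alpha> - 1/2) * A)\<close>, and \<open>\<bar>D\<bar> \<le> A\<close>, so replacing \<open>W'\<close> by
  \<open>p - q\<close> in front of \<open>D\<close> costs no more than the negative term pays. The weights
  \<open>p * u powr (2 * \<alpha> - 2)\<close> and \<open>q * u powr (2 * \<alpha> - 2)\<close> are nondecreasing, so the integral of what
  remains is bounded by boundary terms, and these are at most half the maximum of \<open>G\<close> because of the lower
  bound on \<open>u X\<close>.
\<close>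

lemma amplitude_bound:
  assumes al: "1/4 \<le> \<alpha>" "\<alpha> \<le> 1/2" and X: "1/2 \<le> x0" "x0 \<le> X" "X < 1"
    and pq: "\<And>x y. x0 \<le> x \<Longrightarrow> x \<le> y \<Longrightarrow> y \<le> X \<Longrightarrow> 0 \<le> p x \<and> p x \<le> p y \<and> 0 \<le> q x \<and> q x \<le> q y"
    and W': "\<And>x. x0 \<le> x \<Longrightarrow> x \<le> X \<Longrightarrow> \<bar>W' x - (p x - q x)\<bar> \<le> (4 * \<alpha> - 1) * W' x"
    and L: "p X + q X \<le> \<Lambda>" "2 * \<Lambda> \<le> lam * u X powr (3/2)"
    and x: "x0 \<le> x" "x \<le> X"
  shows "u x powr (2 * \<alpha> - 1) * A x \<le> 2 * (u x0 powr (2 * \<alpha> - 1) * A x0)"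
proof -
  define G where "G x = u x powr (2 * \<alpha> - 1) * A x" for x
  define D where "D x = (P x)\<^sup>2 - u x * (\<Psi> x)\<^sup>2" for x
  define m where "m x = u x powr (2 * \<alpha> - 2)" for x
  have up: "0 < u y" if "x0 \<le> y" "y \<le> X" for y using that X by (intro u_pos) auto
  have y0: "0 < y" if "x0 \<le> y" for y using that X by linarith
  define G' where "G' y = m y * (W' y * ((1 - 2 * \<alpha>) * A y - u y * (\<Psi> y)\<^sup>2))" for y
  have mu: "u y powr (2 * \<alpha> - 1) = m y * u y" if "x0 \<le> y" "y \<le> X" for y
    using up[OF that] powr_add[of "u y" "2 * \<alpha> - 2" 1] by (simp add: m_def)
  have G': "(G has_real_derivative G' y) (at y)" if y: "x0 \<le> y" "y \<le> X" for y
  proof -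
    have "((\<lambda>y. u y powr (2 * \<alpha> - 1)) has_real_derivative (2 * \<alpha> - 1) * u y powr (2 * \<alpha> - 1 - 1) * - W' y) (at y)"
      using DERIV_fun_powr[OF u_deriv[OF y0[OF y(1)]] up[OF y], of "2 * \<alpha> - 1"] by simp
    from DERIV_mult[OF this A_deriv[OF y0[OF y(1)]]] show ?thesis
      unfolding G_def
    proof (rule DERIV_cong)
      have e: "u y powr (2 * \<alpha> - 1 - 1) = m y" by (simp add: m_def)
      have "(2 * a - 1) * M * - w * A0 + - w * s * (M * v) = M * (w * ((1 - 2 * a) * A0 - v * s))" for a M w A0 s v :: real
        by (simp add: algebra_simps)
      then show "(2 * \<alpha> - 1) * u y powr (2 * \<alpha> - 1 - 1) * - W' y * A y + - W' y * (\<Psi> y)\<^sup>2 * u y powr (2 * \<alpha> - 1) = G' y"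
        unfolding G'_def e mu[OF y] .
    qed
  qed
  have Gc: "continuous_on {x0..X} G"
    using DERIV_isCont[OF G'] by (auto intro: continuous_at_imp_continuous_on)
  \<comment> \<open>Work up to the maximum of \<open>G\<close>, so that the maximum also bounds the boundary terms.\<close>
  obtain x1 where x1: "x0 \<le> x1" "x1 \<le> X" "\<And>y. x0 \<le> y \<Longrightarrow> y \<le> X \<Longrightarrow> G y \<le> G x1"
    using continuous_attains_sup[OF compact_Icc _ Gc] X(2) by auto
  have G0: "0 \<le> G y" if "x0 \<le> y" "y \<le> X" for y
    unfolding G_def using that X by (intro mult_nonneg_nonneg A_nonneg) auto
  define K where "K y = \<Psi> y * P y / lam" for y
  have K: "(K has_real_derivative D y) (at y)" for y
  proof -
    have "((\<lambda>y. \<Psi> y * P y) has_real_derivative lam * D y) (at y)"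
      using DERIV_mult[OF Psi_deriv P_deriv] by (rule DERIV_cong) (simp add: D_def u_def power2_eq_square algebra_simps)
    from DERIV_cdivide[OF this, of lam] show ?thesis unfolding K_def using lam by simp
  qed
  define k where "k = u x1 powr (1/2 - 2 * \<alpha>) * G x1 / (2 * lam)"
  have Kb: "\<bar>K y\<bar> \<le> k" if y: "x0 \<le> y" "y \<le> x1" for y
  proof -
    have yX: "y \<le> X" using y x1 by linarith
    have uy: "0 < u y" by (rule up[OF y(1) yX])
    \<comment> \<open>The arithmetic-geometric mean inequality for the two terms of \<open>A\<close>.\<close>
    have "2 * (\<bar>\<Psi> y * P y\<bar> * sqrt (u y)) \<le> A y"
      using sum_squares_bound[of "sqrt (u y) * \<bar>\<Psi> y\<bar>" "\<bar>P y\<bar>"] uy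
      by (simp add: A_def power_mult_distrib abs_mult mult.commute mult.left_commute)
    moreover have "A y = u y powr (1 - 2 * \<alpha>) * G y"
      using uy by (simp add: G_def powr_add[symmetric] mult.assoc[symmetric])
    moreover have "u y powr (1 - 2 * \<alpha>) = u y powr (1/2 - 2 * \<alpha>) * sqrt (u y)"
      using uy powr_add[of "u y" "1/2 - 2 * \<alpha>" "1/2"] by (simp add: powr_half_sqrt)
    ultimately have "2 * \<bar>\<Psi> y * P y\<bar> * sqrt (u y) \<le> u y powr (1/2 - 2 * \<alpha>) * G y * sqrt (u y)" by (simp add: mult_ac)
    then have "2 * \<bar>\<Psi> y * P y\<bar> \<le> u y powr (1/2 - 2 * \<alpha>) * G y" using uy by simp
    also have "\<dots> \<le> u x1 powr (1/2 - 2 * \<alpha>) * G x1"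
      using al y x1 yX X G0[of y] up[of x1] by (intro mult_mono powr_mono2' u_antimono) auto
    finally show ?thesis using lam by (simp add: K_def k_def abs_mult field_simps)
  qed
  have mmono: "m y \<le> m z" if "x0 \<le> y" "y \<le> z" "z \<le> X" for y z
    unfolding m_def using that al up[of z] X by (intro powr_mono2' u_antimono) auto
  have m0: "0 \<le> m y" for y by (simp add: m_def)
  obtain J1 where J1: "((\<lambda>y. (p y * m y) * D y) has_integral J1) {x0..x1}" "\<bar>J1\<bar> \<le> 4 * k * (p x1 * m x1)"
  proof (rule monotone_weight_integral_bound[OF x1(1) K Kb, of "\<lambda>y. p y * m y"])
    fix y z assume "x0 \<le> y" "y \<le> z" "z \<le> x1"
    then show "p y * m y \<le> p z * m z" using pq[of y z] pq[of z z] x1 mmono[of y z] m0 by (intro mult_mono) auto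
  qed (use pq[of x0 x0] X m0 in auto)
  obtain J2 where J2: "((\<lambda>y. (q y * m y) * D y) has_integral J2) {x0..x1}" "\<bar>J2\<bar> \<le> 4 * k * (q x1 * m x1)"
  proof (rule monotone_weight_integral_bound[OF x1(1) K Kb, of "\<lambda>y. q y * m y"])
    fix y z assume "x0 \<le> y" "y \<le> z" "z \<le> x1"
    then show "q y * m y \<le> q z * m z" using pq[of y z] pq[of z z] x1 mmono[of y z] m0 by (intro mult_mono) auto
  qed (use pq[of x0 x0] X m0 in auto)
  have "(G' has_integral G x1 - G x0) {x0..x1}"
    using x1 by (intro fundamental_theorem_of_calculus)
      (auto simp: has_real_derivative_iff_has_vector_derivative[symmetric] intro!: DERIV_subset[OF G'])
  moreover have "((\<lambda>y. 1/2 * ((p y * m y) * D y - (q y * m y) * D y)) has_integral 1/2 * (J1 - J2)) {x0..x1}"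
    by (intro has_integral_mult_right has_integral_diff J1 J2)
  moreover have "G' y \<le> 1/2 * ((p y * m y) * D y - (q y * m y) * D y)" if "y \<in> {x0..x1}" for y
  proof -
    have y: "x0 \<le> y" "y \<le> X" using that x1 by auto
    have "\<bar>D y\<bar> \<le> A y" using up[OF y] by (simp add: D_def A_def abs_le_iff)
    then have "\<bar>(W' y - (p y - q y)) * D y\<bar> \<le> ((4 * \<alpha> - 1) * W' y) * A y"
      unfolding abs_mult using W'[OF y] A_nonneg[of y] y0[OF y(1)] y X by (intro mult_mono) auto
    then have "(W' y - (p y - q y)) * D y \<le> ((4 * \<alpha> - 1) * W' y) * A y" by linarith
    then have "W' y * ((1 - 2 * \<alpha>) * A y - u y * (\<Psi> y)\<^sup>2) \<le> 1/2 * ((p y - q y) * D y)"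
      by (simp add: D_def A_def algebra_simps)
    then have "G' y \<le> m y * (1/2 * ((p y - q y) * D y))"
      unfolding G'_def using m0 by (intro mult_left_mono) auto
    then show ?thesis by (simp add: algebra_simps)
  qed
  ultimately have "G x1 - G x0 \<le> 1/2 * (J1 - J2)" by (rule has_integral_le)
  also have "\<dots> \<le> 1/2 * (4 * k * (p x1 * m x1) + 4 * k * (q x1 * m x1))"
    using order_trans[OF abs_ge_self J1(2)] order_trans[OF abs_ge_minus_self J2(2)] by simp
  also have "\<dots> = 2 * k * ((p x1 + q x1) * m x1)" by (simp add: algebra_simps)
  also have "\<dots> \<le> 2 * k * (\<Lambda> * m x1)"
  proof (intro mult_left_mono mult_right_mono m0)
    show "p x1 + q x1 \<le> \<Lambda>" using pq[of x1 X] x1 L by simp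
    show "0 \<le> 2 * k" using lam G0[OF x1(1,2)] by (simp add: k_def)
  qed
  also have "\<dots> = (\<Lambda> / lam) * (u x1 powr (1/2 - 2 * \<alpha>) * m x1) * G x1" by (simp add: k_def)
  also have "u x1 powr (1/2 - 2 * \<alpha>) * m x1 = u x1 powr (- (3/2))"
    by (simp add: m_def powr_add[symmetric])
  also have "(\<Lambda> / lam) * u x1 powr (- (3/2)) * G x1 \<le> 1/2 * G x1"
  proof (rule mult_right_mono[OF _ G0[OF x1(1,2)]])
    have "u X powr (3/2) \<le> u x1 powr (3/2)"
      using up[of X] u_antimono[of x1 X] x1 X by (intro powr_mono2) auto
    then have "lam * u X powr (3/2) \<le> lam * u x1 powr (3/2)" using lam by (intro mult_left_mono) auto
    then have "2 * \<Lambda> \<le> lam * u x1 powr (3/2)" using L(2) by linarith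
    then show "(\<Lambda> / lam) * u x1 powr (- (3/2)) \<le> 1/2"
      using lam up[OF x1(1,2)] by (simp add: powr_minus field_simps)
  qed
  finally have "G x1 \<le> 2 * G x0" by simp
  then show ?thesis using x1(3)[OF x] unfolding G_def by linarith
qed

text \<open>
  Up to \<open>X\<close> everything follows from the bound on \<open>u powr (2 * \<alpha> - 1) * A\<close>. Between \<open>X\<close> and \<open>1\<close> the
  energy function controls \<open>P\<close>, and \<open>\<Psi>\<close> changes by at most \<open>lam * (1 - X)\<close> times the maximum of
  \<open>\<bar>P\<bar>\<close>. Beyond \<open>1\<close> both squares decrease, and where \<open>W - 1 \<ge> \<nu>\<close> the inequality
  \<open>(W - 1) * \<Psi>\<^sup>2 \<le> P\<^sup>2\<close> is stronger than the bound on \<open>\<Psi>\<close>. In the application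
  \<open>\<nu> = n powr (-2/3)\<close>.
\<close>

lemma bounds_from_cutoff:
  assumes al: "1/4 \<le> \<alpha>" "\<alpha> \<le> 1/2" and X: "1/2 \<le> X" "X < 1"
    and amp: "\<And>x. 0 \<le> x \<Longrightarrow> x \<le> X \<Longrightarrow> u x powr (2 * \<alpha> - 1) * A x \<le> C4 * m"
    and m: "0 \<le> m" and nu: "0 < \<nu>" "\<nu> \<le> 1"
    and cl: "0 < cl" "cl * \<nu> \<le> u X" and Cu: "u X \<le> Cu * \<nu>" and C2: "lam * \<nu> powr (3/2) \<le> C2"
    and C3: "C3 = C4 * Cu powr (1 - 2 * \<alpha>)"
    and Ca: "Ca = 2 * C4 * cl powr (- 2 * \<alpha>) + 2 * (Cu * C2 / c0)\<^sup>2 * C3"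
    and Cb: "Cb = C4 + Cu powr (2 * \<alpha>) * Ca + Ca + C3" and x: "0 \<le> x"
  shows "(\<Psi> x)\<^sup>2 \<le> Ca * m * \<nu> powr (- 2 * \<alpha>)"
    and "\<bar>u x\<bar> powr (2 * \<alpha>) * (\<Psi> x)\<^sup>2 \<le> Cb * m"
    and "(P x)\<^sup>2 \<le> (C3 + C4) * m * max (\<nu> powr (1 - 2 * \<alpha>)) (max 0 (u x) powr (1 - 2 * \<alpha>))"
proof -
  have uX: "0 < u X" using u_pos X by simp
  have Cu0: "0 < Cu"
  proof -
    have "0 < Cu * \<nu>" using uX Cu by linarith
    then show ?thesis using nu by (simp add: zero_less_mult_iff)
  qed
  have inner: "A y = u y powr (1 - 2 * \<alpha>) * (u y powr (2 * \<alpha> - 1) * A y)" if "0 \<le> y" "y \<le> X" for y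
    using u_pos[of y] that X by (simp add: powr_add[symmetric] mult.assoc[symmetric])
  have C4m: "0 \<le> C4 * m"
  proof -
    have "0 \<le> u X powr (2 * \<alpha> - 1) * A X" using A_nonneg[of X] X by simp
    also have "\<dots> \<le> C4 * m" using amp[of X] X by simp
    finally show ?thesis .
  qed
  have C3m: "0 \<le> C3 * m" using C4m Cu0 mult_nonneg_nonneg[OF C4m powr_ge_zero[of Cu "1 - 2 * \<alpha>"]] by (simp add: C3 mult_ac)
  have Psi_in: "u y powr (2 * \<alpha>) * (\<Psi> y)\<^sup>2 \<le> C4 * m" if "0 \<le> y" "y \<le> X" for y
  proof -
    have uy: "0 < u y" using u_pos that X by simp
    have "u y powr (2 * \<alpha>) * (\<Psi> y)\<^sup>2 = u y powr (2 * \<alpha> - 1) * (u y * (\<Psi> y)\<^sup>2)"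
      using uy powr_add[of "u y" "2 * \<alpha> - 1" 1] by simp
    also have "\<dots> \<le> u y powr (2 * \<alpha> - 1) * A y" by (intro mult_left_mono) (auto simp: A_def)
    finally show ?thesis using amp[OF that] by linarith
  qed
  have Psi_in2: "(\<Psi> y)\<^sup>2 \<le> C4 * m * (cl powr (- 2 * \<alpha>) * \<nu> powr (- 2 * \<alpha>))" if y: "0 \<le> y" "y \<le> X" for y
  proof -
    have uy: "0 < u y" using u_pos that X by simp
    have "(\<Psi> y)\<^sup>2 = u y powr (- 2 * \<alpha>) * (u y powr (2 * \<alpha>) * (\<Psi> y)\<^sup>2)"
      using uy by (simp add: powr_add[symmetric] mult.assoc[symmetric])
    also have "\<dots> \<le> (cl * \<nu>) powr (- 2 * \<alpha>) * (C4 * m)"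
      by (rule mult_mono[OF powr_mono2' Psi_in[OF y]]) (use al cl nu u_antimono[OF y] in auto)
    finally show ?thesis using cl nu by (simp add: powr_mult mult_ac)
  qed
  have P_in: "(P y)\<^sup>2 \<le> C4 * m * u y powr (1 - 2 * \<alpha>)" if y: "0 \<le> y" "y \<le> X" for y
  proof -
    have "(P y)\<^sup>2 \<le> A y" using P_le_A y X by simp
    also have "\<dots> = u y powr (1 - 2 * \<alpha>) * (u y powr (2 * \<alpha> - 1) * A y)" by (rule inner[OF y])
    also have "\<dots> \<le> u y powr (1 - 2 * \<alpha>) * (C4 * m)" by (intro mult_left_mono amp y) auto
    finally show ?thesis by (simp add: mult_ac)
  qed
  have AX: "A X \<le> C3 * m * \<nu> powr (1 - 2 * \<alpha>)"
  proof -
    have "A X = u X powr (1 - 2 * \<alpha>) * (u X powr (2 * \<alpha> - 1) * A X)" using X by (intro inner) auto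
    also have "\<dots> \<le> (Cu * \<nu>) powr (1 - 2 * \<alpha>) * (C4 * m)"
      by (rule mult_mono[OF powr_mono2 amp]) (use Cu uX al X C4m A_nonneg[of X] in auto)
    finally show ?thesis using Cu0 nu by (simp add: powr_mult C3 mult_ac)
  qed
  have P_near: "(P y)\<^sup>2 \<le> C3 * m * \<nu> powr (1 - 2 * \<alpha>)" if "X \<le> y" "y \<le> 1" for y
    using P_le_A[of y] A_antimono[of X y] AX that X by simp
  have Psi_near: "(\<Psi> y)\<^sup>2 \<le> Ca * m * \<nu> powr (- 2 * \<alpha>)" if y: "X \<le> y" "y \<le> 1" for y
  proof -
    define M where "M = C3 * m * \<nu> powr (1 - 2 * \<alpha>)"
    have M0: "0 \<le> M" using C3m by (simp add: M_def)
    have "\<bar>\<Psi> y - \<Psi> X\<bar> \<le> (lam * sqrt M) * \<bar>y - X\<bar>"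
    proof (cases "X = y")
      case False
      then obtain z where z: "X < z" "z < y" "\<Psi> y - \<Psi> X = (y - X) * (lam * P z)"
        using MVT2[of X y \<Psi> "\<lambda>z. lam * P z"] y Psi_deriv by force
      have "sqrt ((P z)\<^sup>2) \<le> sqrt M" using P_near[of z] z y unfolding M_def by (intro real_sqrt_le_mono) auto
      then have "(y - X) * (lam * \<bar>P z\<bar>) \<le> (y - X) * (lam * sqrt M)"
        using y lam by (intro mult_left_mono) auto
      then show ?thesis using z(3) lam y by (simp add: abs_mult mult_ac)
    qed simp
    also have "\<bar>y - X\<bar> \<le> Cu * \<nu> / c0"
    proof -
      have "c0 * (1 - X) \<le> Cu * \<nu>" using u_lower[of X] X Cu by linarith
      then have "1 - X \<le> Cu * \<nu> / c0" using c0 by (simp add: field_simps)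
      then show ?thesis using y by simp
    qed
    finally have d: "\<bar>\<Psi> y - \<Psi> X\<bar> \<le> (lam * sqrt M) * (Cu * \<nu> / c0)"
      using lam M0 by (simp add: mult_left_mono)
    have "(\<Psi> y - \<Psi> X)\<^sup>2 \<le> ((lam * sqrt M) * (Cu * \<nu> / c0))\<^sup>2"
      using power_mono[OF d, of 2] by simp
    also have "\<dots> = (lam * \<nu>)\<^sup>2 * (Cu / c0)\<^sup>2 * M"
      using M0 by (simp add: power_mult_distrib power_divide mult_ac)
    also have "(lam * \<nu>)\<^sup>2 * (Cu / c0)\<^sup>2 * M \<le> (C2\<^sup>2 / \<nu>) * (Cu / c0)\<^sup>2 * M"
    proof (intro mult_right_mono M0 zero_le_power2)
      have "(lam * \<nu> powr (3/2))\<^sup>2 \<le> C2\<^sup>2" using C2 lam by (intro power_mono) auto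
      moreover have "(\<nu> powr (3/2))\<^sup>2 = \<nu> ^ 3"
        using nu powr_powr[of \<nu> "3/2" 2] by (simp add: powr_numeral[symmetric] powr_realpow[symmetric] del: powr_numeral)
      ultimately have "(lam * \<nu>)\<^sup>2 * \<nu> \<le> C2\<^sup>2"
        by (simp add: power_mult_distrib power2_eq_square power3_eq_cube mult_ac)
      then show "(lam * \<nu>)\<^sup>2 \<le> C2\<^sup>2 / \<nu>" using nu by (simp add: field_simps)
    qed
    also have "\<dots> = (Cu * C2 / c0)\<^sup>2 * C3 * m * \<nu> powr (- 2 * \<alpha>)"
    proof -
      have "\<nu> powr (1 - 2 * \<alpha>) = \<nu> * \<nu> powr (- 2 * \<alpha>)" using nu powr_add[of \<nu> 1 "- 2 * \<alpha>"] by simp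
      then show ?thesis using nu by (simp add: M_def power_mult_distrib power_divide mult_ac)
    qed
    finally have "(\<Psi> y - \<Psi> X)\<^sup>2 \<le> (Cu * C2 / c0)\<^sup>2 * C3 * m * \<nu> powr (- 2 * \<alpha>)" .
    moreover have "(\<Psi> X)\<^sup>2 \<le> C4 * m * (cl powr (- 2 * \<alpha>) * \<nu> powr (- 2 * \<alpha>))" using Psi_in2 X by simp
    moreover have "(\<Psi> y)\<^sup>2 \<le> 2 * (\<Psi> X)\<^sup>2 + 2 * (\<Psi> y - \<Psi> X)\<^sup>2"
      using zero_le_power2[of "(\<Psi> y - \<Psi> X) - \<Psi> X"] by (simp add: power2_eq_square algebra_simps)
    ultimately show ?thesis unfolding Ca by (simp add: algebra_simps)
  qed
  have Ca_ge: "C4 * m * (cl powr (- 2 * \<alpha>) * \<nu> powr (- 2 * \<alpha>)) \<le> Ca * m * \<nu> powr (- 2 * \<alpha>)"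
  proof -
    have "0 \<le> (C4 * m) * (cl powr (- 2 * \<alpha>) * \<nu> powr (- 2 * \<alpha>))"
      "0 \<le> (2 * (Cu * C2 / c0)\<^sup>2) * (C3 * m) * \<nu> powr (- 2 * \<alpha>)"
      by (rule mult_nonneg_nonneg[OF C4m], simp)
        (rule mult_nonneg_nonneg[OF mult_nonneg_nonneg[OF _ C3m]], simp_all)
    then show ?thesis unfolding Ca by (simp add: algebra_simps)
  qed
  have all: "(\<Psi> y)\<^sup>2 \<le> Ca * m * \<nu> powr (- 2 * \<alpha>)" if "0 \<le> y" for y
  proof -
    consider "y \<le> X" | "X \<le> y" "y \<le> 1" | "1 \<le> y" by linarith
    then show ?thesis
    proof cases
      case 1 then show ?thesis using Psi_in2[OF that 1] Ca_ge by linarith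
    next
      case 2 then show ?thesis by (rule Psi_near)
    next
      case 3 then show ?thesis using Psi_square_antimono[OF 3] Psi_near[of 1] X by simp
    qed
  qed
  show "(\<Psi> x)\<^sup>2 \<le> Ca * m * \<nu> powr (- 2 * \<alpha>)" by (rule all[OF x])
  have Cam: "0 \<le> Ca * m"
  proof -
    have "0 \<le> (Ca * m) * \<nu> powr (- 2 * \<alpha>)" using all[OF x] zero_le_power2[of "\<Psi> x"] by linarith
    then show ?thesis using nu by (simp add: zero_le_mult_iff)
  qed
  have nunu: "\<nu> powr (2 * \<alpha>) * \<nu> powr (- 2 * \<alpha>) = 1" using nu by (simp add: powr_add[symmetric])
  have Cb_ge: "C4 * m \<le> Cb * m" "Cu powr (2 * \<alpha>) * (Ca * m) \<le> Cb * m" "Ca * m \<le> Cb * m" "C3 * m \<le> Cb * m"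
    using C4m C3m Cam mult_nonneg_nonneg[OF powr_ge_zero[of Cu "2 * \<alpha>"] Cam] by (simp_all add: Cb algebra_simps)
  show "\<bar>u x\<bar> powr (2 * \<alpha>) * (\<Psi> x)\<^sup>2 \<le> Cb * m"
  proof -
    consider "x \<le> X" | "X \<le> x" "\<bar>u x\<bar> \<le> max Cu 1 * \<nu>" | "1 \<le> x" "\<nu> \<le> \<bar>u x\<bar>"
    proof -
      have "\<bar>u x\<bar> \<le> max Cu 1 * \<nu>" if "X \<le> x" "x < 1"
      proof -
        have "\<bar>u x\<bar> = u x" using u_pos[OF x that(2)] by simp
        also have "\<dots> \<le> Cu * \<nu>" using u_antimono[of X x] Cu X that by linarith
        also have "\<dots> \<le> max Cu 1 * \<nu>" using nu by (intro mult_right_mono) auto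
        finally show ?thesis .
      qed
      moreover have "\<bar>u x\<bar> \<le> max Cu 1 * \<nu>" if "\<bar>u x\<bar> \<le> \<nu>"
      proof -
        have "1 * \<nu> \<le> max Cu 1 * \<nu>" using nu by (intro mult_right_mono) auto
        then show ?thesis using that by linarith
      qed
      ultimately show ?thesis using that by (metis linorder_le_cases not_le)
    qed
    then show ?thesis
    proof cases
      case 1
      then have "\<bar>u x\<bar> = u x" using u_pos[of x] x X by simp
      then show ?thesis using Psi_in[OF x 1] Cb_ge(1) by simp
    next
      case 2
      have "\<bar>u x\<bar> powr (2 * \<alpha>) * (\<Psi> x)\<^sup>2 \<le> (max Cu 1 * \<nu>) powr (2 * \<alpha>) * (Ca * m * \<nu> powr (- 2 * \<alpha>))"
        using 2 al by (intro mult_mono all x powr_mono2) auto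
      also have "\<dots> = max Cu 1 powr (2 * \<alpha>) * (Ca * m) * (\<nu> powr (2 * \<alpha>) * \<nu> powr (- 2 * \<alpha>))"
        using nu by (simp add: powr_mult mult_ac)
      also have "\<dots> = max Cu 1 powr (2 * \<alpha>) * (Ca * m)" unfolding nunu by simp
      also have "\<dots> \<le> Cb * m" using Cb_ge(2,3) by (simp add: max_def)
      finally show ?thesis .
    next
      case 3
      have v: "\<bar>u x\<bar> = W x - 1" using W_mono[of 1 x] W_1 3 by (simp add: u_def)
      have pos: "0 < \<bar>u x\<bar>" using 3 nu by linarith
      have "\<bar>u x\<bar> * (\<Psi> x)\<^sup>2 \<le> (P x)\<^sup>2" using energy_nonneg[OF 3(1)] v by simp
      also have "\<dots> \<le> (P 1)\<^sup>2" by (rule P_square_antimono[OF 3(1)])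
      also have "\<dots> \<le> C3 * m * \<nu> powr (1 - 2 * \<alpha>)" using P_near[of 1] X by simp
      finally have far: "\<bar>u x\<bar> * (\<Psi> x)\<^sup>2 \<le> C3 * m * \<nu> powr (1 - 2 * \<alpha>)" .
      have "\<bar>u x\<bar> powr (2 * \<alpha> - 1) * (\<bar>u x\<bar> * (\<Psi> x)\<^sup>2) \<le> \<nu> powr (2 * \<alpha> - 1) * (C3 * m * \<nu> powr (1 - 2 * \<alpha>))"
        by (rule mult_mono[OF powr_mono2' far]) (use 3 al nu in auto)
      also have "\<dots> = C3 * m * (\<nu> powr (2 * \<alpha> - 1) * \<nu> powr (1 - 2 * \<alpha>))" by (simp add: mult_ac)
      also have "\<nu> powr (2 * \<alpha> - 1) * \<nu> powr (1 - 2 * \<alpha>) = 1" using nu by (simp add: powr_add[symmetric])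
      finally have "\<bar>u x\<bar> powr (2 * \<alpha> - 1) * (\<bar>u x\<bar> * (\<Psi> x)\<^sup>2) \<le> C3 * m" by simp
      moreover have "\<bar>u x\<bar> powr (2 * \<alpha> - 1) * \<bar>u x\<bar> = \<bar>u x\<bar> powr (2 * \<alpha>)"
        using pos powr_add[of "\<bar>u x\<bar>" "2 * \<alpha> - 1" 1] by simp
      ultimately show ?thesis using Cb_ge(4) by (simp add: mult.assoc[symmetric])
    qed
  qed
  define mx where "mx = max (\<nu> powr (1 - 2 * \<alpha>)) (max 0 (u x) powr (1 - 2 * \<alpha>))"
  have mx0: "0 \<le> mx" "\<nu> powr (1 - 2 * \<alpha>) \<le> mx" "max 0 (u x) powr (1 - 2 * \<alpha>) \<le> mx"
    using powr_ge_zero[of \<nu> "1 - 2 * \<alpha>"] unfolding mx_def by linarith+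
  have "(P x)\<^sup>2 \<le> (C3 * m + C4 * m) * mx"
  proof (cases "x \<le> X")
    case True
    have "(P x)\<^sup>2 \<le> C4 * m * u x powr (1 - 2 * \<alpha>)" by (rule P_in[OF x True])
    also have "\<dots> \<le> (C3 * m + C4 * m) * mx"
      using mx0(3) u_pos[of x] x True X C4m C3m by (intro mult_mono) auto
    finally show ?thesis .
  next
    case False
    have "(P x)\<^sup>2 \<le> C3 * m * \<nu> powr (1 - 2 * \<alpha>)"
      using P_near[of x] P_near[of 1] P_square_antimono[of x] False X by (cases "x \<le> 1") auto
    also have "\<dots> \<le> (C3 * m + C4 * m) * mx"
      using mx0 C4m C3m by (intro mult_mono) auto
    finally show ?thesis .
  qed
  then show "(P x)\<^sup>2 \<le> (C3 + C4) * m * max (\<nu> powr (1 - 2 * \<alpha>)) (max 0 (u x) powr (1 - 2 * \<alpha>))"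
    by (simp add: mx_def distrib_right)
qed

text \<open>
  The point where \<open>u = C1 * \<nu>\<close> is the last one that \<open>amplitude_bound\<close> reaches. If \<open>C1 * \<nu>\<close>
  exceeds the lower bound \<open>\<rho>\<close> for \<open>u\<close> at the left end of the window \<open>{1 - \<eta>..1}\<close>, then \<open>\<nu>\<close> is
  bounded below, and that end serves instead.
\<close>

lemma cutoff_exists:
  assumes al: "1/4 \<le> \<alpha>" "\<alpha> \<le> 1/2" and eta: "0 < \<eta>" "\<eta> \<le> 1/2" and L: "0 < \<Lambda>"
    and slope: "almost_monotone_slope \<alpha> \<eta> \<Lambda> W'"
    and nu: "0 < \<nu>" "\<nu> \<le> 1" and c1: "0 < c1" "c1 \<le> lam * \<nu> powr (3/2)"
    and m: "A 0 \<le> m"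
    and \<rho>: "\<rho> = c0 * \<eta>" and C1: "C1 = (2 * \<Lambda> / c1) powr (2/3)"
  obtains X where "1/2 \<le> X" "X < 1" "min \<rho> C1 * \<nu> \<le> u X" "u X \<le> max C1 (C1 / \<rho>) * \<nu>"
    "\<And>x. 0 \<le> x \<Longrightarrow> x \<le> X \<Longrightarrow> u x powr (2 * \<alpha> - 1) * A x \<le> (2 * \<rho> powr (2 * \<alpha> - 1)) * m"
proof -
  define x0 where "x0 = 1 - \<eta>"
  have x0: "1/2 \<le> x0" "x0 < 1" using eta by (auto simp: x0_def)
  have rho0: "0 < \<rho>" using eta c0 by (simp add: \<rho>)
  have C10: "0 < C1" using L c1 by (simp add: C1)
  have ux0: "\<rho> \<le> u x0" using u_lower[of x0] x0 by (simp add: x0_def \<rho>)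
  have m0: "0 \<le> m" using A_nonneg[of 0] m by simp
  have early: "u x powr (2 * \<alpha> - 1) * A x \<le> \<rho> powr (2 * \<alpha> - 1) * m" if "0 \<le> x" "x \<le> x0" for x
  proof (rule mult_mono[OF powr_mono2'])
    show "A x \<le> m" using A_antimono[of 0 x] that m by simp
    show "\<rho> \<le> u x" using u_antimono[OF that] ux0 by simp
  qed (use al rho0 A_nonneg[of x] that x0 in auto)
  have early2: "\<rho> powr (2 * \<alpha> - 1) * m \<le> (2 * \<rho> powr (2 * \<alpha> - 1)) * m"
    using m0 by (intro mult_right_mono) auto
  show ?thesis
  proof (cases "C1 * \<nu> \<le> \<rho>")
    case True
    have "u 1 \<le> C1 * \<nu>" "C1 * \<nu> \<le> u x0" using C10 nu True ux0 by (auto simp: u_def W_1)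
    then obtain X where X: "x0 \<le> X" "X \<le> 1" "u X = C1 * \<nu>"
      using IVT2'[of u 1 "C1 * \<nu>" x0] x0 u_continuous by auto
    have "X \<noteq> 1" using X(3) C10 nu by (auto simp: u_def W_1)
    then have X1: "X < 1" using X by simp
    obtain p q where pq: "\<And>x y. 1 - \<eta> \<le> x \<Longrightarrow> x \<le> y \<Longrightarrow> y \<le> 1 \<Longrightarrow> 0 \<le> p x \<and> p x \<le> p y \<and> 0 \<le> q x \<and> q x \<le> q y"
      and pq1: "p 1 + q 1 \<le> \<Lambda>"
      and W': "\<And>x. 1 - \<eta> \<le> x \<Longrightarrow> x \<le> 1 \<Longrightarrow> \<bar>W' x - (p x - q x)\<bar> \<le> (4 * \<alpha> - 1) * W' x"
      using slope unfolding almost_monotone_slope_def by auto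
    have late: "u x powr (2 * \<alpha> - 1) * A x \<le> 2 * (u x0 powr (2 * \<alpha> - 1) * A x0)" if x: "x0 \<le> x" "x \<le> X" for x
    proof (rule amplitude_bound[OF al x0(1) X(1) X1 _ _ _ _ x, of p q \<Lambda>])
      show "p X + q X \<le> \<Lambda>" using pq[of X 1] pq1 X by (simp add: x0_def)
      have "u X powr (3/2) = (2 * \<Lambda> / c1) * \<nu> powr (3/2)"
        using X(3) C10 nu L c1 by (simp add: powr_mult C1 powr_powr)
      then have "lam * u X powr (3/2) = (2 * \<Lambda> / c1) * (lam * \<nu> powr (3/2))" by simp
      also have "\<dots> \<ge> (2 * \<Lambda> / c1) * c1" using c1 L by (intro mult_left_mono) auto
      finally show "2 * \<Lambda> \<le> lam * u X powr (3/2)" using c1 by simp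
    qed (use pq W' X X1 in \<open>auto simp: x0_def\<close>)
    show ?thesis
    proof (rule that[of X])
      fix x :: real assume x: "0 \<le> x" "x \<le> X"
      show "u x powr (2 * \<alpha> - 1) * A x \<le> (2 * \<rho> powr (2 * \<alpha> - 1)) * m"
      proof (cases "x \<le> x0")
        case True
        then show ?thesis using early[OF x(1)] early2 by linarith
      next
        case False
        then have "u x powr (2 * \<alpha> - 1) * A x \<le> 2 * (u x0 powr (2 * \<alpha> - 1) * A x0)" using late x by simp
        moreover have "u x0 powr (2 * \<alpha> - 1) * A x0 \<le> \<rho> powr (2 * \<alpha> - 1) * m" using early x0 by simp
        ultimately show ?thesis by linarith
      qed
    next
      show "min \<rho> C1 * \<nu> \<le> u X" "u X \<le> max C1 (C1 / \<rho>) * \<nu>"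
        unfolding X(3) using nu by (auto intro!: mult_right_mono)
    qed (use X x0 X1 in auto)
  next
    case False
    show ?thesis
    proof (rule that[of x0])
      have "\<rho> * \<nu> \<le> \<rho> * 1" using rho0 nu by (intro mult_left_mono) auto
      moreover have "min \<rho> C1 * \<nu> \<le> \<rho> * \<nu>" using nu by (intro mult_right_mono) auto
      ultimately show "min \<rho> C1 * \<nu> \<le> u x0" using ux0 by simp
      have "u x0 \<le> 1" using u_le_1 x0 by simp
      also have "1 \<le> (C1 / \<rho>) * \<nu>" using False rho0 by (simp add: field_simps)
      also have "\<dots> \<le> max C1 (C1 / \<rho>) * \<nu>" using nu by (intro mult_right_mono) auto
      finally show "u x0 \<le> max C1 (C1 / \<rho>) * \<nu>" .
      show "u x powr (2 * \<alpha> - 1) * A x \<le> (2 * \<rho> powr (2 * \<alpha> - 1)) * m" if "0 \<le> x" "x \<le> x0" for x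
        using early[OF that] early2 by linarith
    qed (use x0 in auto)
  qed
qed

end

text \<open>
  Collects the constants; what matters is that \<open>C\<close> is chosen before the potential, the solution and
  \<open>\<nu>\<close>.
\<close>

theorem turning_point_bounds:
  assumes al: "1/4 \<le> \<alpha>" "\<alpha> \<le> 1/2" and eta: "0 < \<eta>" "\<eta> \<le> 1/2" and L: "0 < \<Lambda>"
    and c: "0 < c0" "0 < c1"
  shows "\<exists>C>0. \<forall>W W' \<Psi> P lam \<nu> m. turning_point W W' \<Psi> P lam c0 \<longrightarrow> almost_monotone_slope \<alpha> \<eta> \<Lambda> W' \<longrightarrow>
     0 < \<nu> \<longrightarrow> \<nu> \<le> 1 \<longrightarrow> c1 \<le> lam * \<nu> powr (3/2) \<longrightarrow> lam * \<nu> powr (3/2) \<le> C2 \<longrightarrow>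
     (\<Psi> 0)\<^sup>2 + (P 0)\<^sup>2 \<le> m \<longrightarrow>
     (\<forall>x\<ge>0. (\<Psi> x)\<^sup>2 \<le> C * m * \<nu> powr (- 2 * \<alpha>) \<and>
        \<bar>1 - W x\<bar> powr (2 * \<alpha>) * (\<Psi> x)\<^sup>2 \<le> C * m \<and>
        (P x)\<^sup>2 \<le> C * m * max (\<nu> powr (1 - 2 * \<alpha>)) (max 0 (1 - W x) powr (1 - 2 * \<alpha>)))"
proof -
  define \<rho> C1 where "\<rho> = c0 * \<eta>" and "C1 = (2 * \<Lambda> / c1) powr (2/3)"
  define cl Cu where "cl = min \<rho> C1" and "Cu = max C1 (C1 / \<rho>)"
  define C4 where "C4 = 2 * \<rho> powr (2 * \<alpha> - 1)"
  define C3 where "C3 = C4 * Cu powr (1 - 2 * \<alpha>)"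
  define Ca where "Ca = 2 * C4 * cl powr (- 2 * \<alpha>) + 2 * (Cu * C2 / c0)\<^sup>2 * C3"
  define Cb where "Cb = C4 + Cu powr (2 * \<alpha>) * Ca + Ca + C3"
  have pos: "0 < \<rho>" "0 < C1" "0 < C4" "0 < cl" using c eta L by (auto simp: \<rho>_def C1_def C4_def cl_def)
  have nonneg: "0 \<le> C3" using pos by (simp add: C3_def)
  have nonneg2: "0 \<le> Ca" using pos nonneg by (simp add: Ca_def)
  have nonneg3: "0 \<le> Cb" using pos nonneg nonneg2 by (simp add: Cb_def)
  define C where "C = Ca + Cb + C3 + C4"
  have "0 < C" using pos nonneg nonneg2 nonneg3 by (simp add: C_def)
  moreover have "(\<Psi> x)\<^sup>2 \<le> C * m * \<nu> powr (- 2 * \<alpha>) \<and>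
        \<bar>1 - W x\<bar> powr (2 * \<alpha>) * (\<Psi> x)\<^sup>2 \<le> C * m \<and>
        (P x)\<^sup>2 \<le> C * m * max (\<nu> powr (1 - 2 * \<alpha>)) (max 0 (1 - W x) powr (1 - 2 * \<alpha>))"
    if "turning_point W W' \<Psi> P lam c0" and slope: "almost_monotone_slope \<alpha> \<eta> \<Lambda> W'"
      and nu: "0 < \<nu>" "\<nu> \<le> 1" and lam': "c1 \<le> lam * \<nu> powr (3/2)" "lam * \<nu> powr (3/2) \<le> C2"
      and m: "(\<Psi> 0)\<^sup>2 + (P 0)\<^sup>2 \<le> m" and x: "0 \<le> x" for W W' \<Psi> P lam \<nu> m x
  proof -
    interpret turning_point W W' \<Psi> P lam c0 by fact
    have A0: "A 0 \<le> m" using m by (simp add: A_def u_def W_0)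
    have m0: "0 \<le> m" using A_nonneg[of 0] A0 by simp
    obtain X where X: "1/2 \<le> X" "X < 1" "cl * \<nu> \<le> u X" "u X \<le> Cu * \<nu>"
      "\<And>x. 0 \<le> x \<Longrightarrow> x \<le> X \<Longrightarrow> u x powr (2 * \<alpha> - 1) * A x \<le> C4 * m"
      using cutoff_exists[OF al eta L slope nu c(2) lam'(1) A0 \<rho>_def C1_def] unfolding cl_def Cu_def C4_def by metis
    note b = bounds_from_cutoff[OF al X(1,2,5) m0 nu pos(4) X(3,4) lam'(2) C3_def Ca_def Cb_def x]
    have le: "Ca * m \<le> C * m" "Cb * m \<le> C * m" "(C3 + C4) * m \<le> C * m"
      using m0 pos nonneg nonneg2 nonneg3 by (auto simp: C_def intro!: mult_right_mono)
    have "Ca * m * \<nu> powr (- 2 * \<alpha>) \<le> C * m * \<nu> powr (- 2 * \<alpha>)" by (intro mult_right_mono le) simp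
    moreover have "(C3 + C4) * m * max (\<nu> powr (1 - 2 * \<alpha>)) (max 0 (u x) powr (1 - 2 * \<alpha>))
        \<le> C * m * max (\<nu> powr (1 - 2 * \<alpha>)) (max 0 (u x) powr (1 - 2 * \<alpha>))"
      by (intro mult_right_mono le) (simp add: le_max_iff_disj)
    ultimately show ?thesis using b le(2) unfolding u_def by (intro conjI) linarith+
  qed
  ultimately show ?thesis by blast
qed

section \<open>Bounds for eigenfunctions of a given well\<close>

text \<open>
  The slope condition at every energy: \<open>b\<close> runs through all turning points, at energy \<open>V b\<close>.
\<close>

definition regular_slope :: "real \<Rightarrow> real \<Rightarrow> real \<Rightarrow> (real \<Rightarrow> real) \<Rightarrow> (real \<Rightarrow> real) \<Rightarrow> bool" where
  "regular_slope \<alpha> \<eta> \<Lambda> V V' \<longleftrightarrow> (\<forall>b>0. almost_monotone_slope \<alpha> \<eta> \<Lambda> (\<lambda>x. b * V' (b * x) / V b))"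

lemma (in well) well_turning_point:
  assumes es: "eigenstate V E f f'"
    and energy: "\<And>x. b \<le> x \<Longrightarrow> (V x - E) * (f x)\<^sup>2 \<le> (f' x)\<^sup>2"
  shows "turning_point (\<lambda>x. V (b * x) / E) (\<lambda>x. b * V' (b * x) / E) (\<lambda>x. f (b * x))
    (\<lambda>x. f' (b * x) / sqrt E) (sqrt E * b) (2 powr (- \<kappa>) / \<kappa>)"
proof
  have sE: "0 < sqrt E" "sqrt E * sqrt E = E" using E_pos by simp_all
  show "0 < sqrt E * b" "0 < 2 powr (- \<kappa>) / \<kappa>" using sE b_pos kappa by simp_all
  show "continuous_on UNIV (\<lambda>x. V (b * x) / E)"
    using E_pos by (intro continuous_intros continuous_on_compose2[OF V_continuous]) auto
  show "V (b * 0) / E = 0" "V (b * 1) / E = 1" using V_0 V_b E_pos by simp_all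
  have lin: "((\<lambda>x. b * x) has_real_derivative b) (at x)" for x by (rule DERIV_cmult_Id)
  show "((\<lambda>x. V (b * x) / E) has_real_derivative b * V' (b * x) / E) (at x)" if "0 < x" for x
    using DERIV_cdivide[OF DERIV_chain2[OF V_deriv lin], of x E] that b_pos by (simp add: mult.commute)
  show "continuous_on {0<..} (\<lambda>x. b * V' (b * x) / E)"
    using b_pos E_pos by (intro continuous_intros continuous_on_compose2[OF V'_continuous]) auto
  show "0 \<le> b * V' (b * x) / E" if "0 < x" for x
    using V'_pos[of "b * x"] that b_pos E_pos by simp
  show "2 powr (- \<kappa>) / \<kappa> \<le> b * V' (b * x) / E" if x: "1/2 \<le> x" "x \<le> 1" for x
  proof -
    have bx: "0 < b * x" "b * x \<le> b" using b_pos x by (simp_all add: mult_left_le)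
    have "V b \<le> V (b * x) * (b / (b * x)) powr \<kappa>" by (rule scaling_upper[OF bx])
    also have "\<dots> \<le> V (b * x) * 2 powr \<kappa>"
      using b_pos x kappa V_nonneg by (intro mult_left_mono powr_mono2) (auto simp: field_simps)
    finally have "E * 2 powr (- \<kappa>) \<le> V (b * x) * 2 powr \<kappa> * 2 powr (- \<kappa>)"
      using V_b by (intro mult_right_mono) auto
    also have "V (b * x) * 2 powr \<kappa> * 2 powr (- \<kappa>) = V (b * x)"
      using two_powr_kappa(4) by (metis mult.assoc mult.commute mult_1)
    finally have "E * 2 powr (- \<kappa>) \<le> V (b * x)" .
    then have "E * 2 powr (- \<kappa>) / \<kappa> \<le> V (b * x) / \<kappa>" using kappa by (intro divide_right_mono) auto
    also have "\<dots> \<le> (b * x) * V' (b * x)" using growth(1)[of "b * x"] bx by (metis less_irrefl)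
    also have "\<dots> \<le> b * V' (b * x)" using bx b_pos V'_pos[OF bx(1)] by (intro mult_right_mono) auto
    finally show ?thesis using E_pos kappa by (simp add: field_simps)
  qed
  note d = eigenstateD(1,2)[OF es]
  show "((\<lambda>x. f (b * x)) has_real_derivative sqrt E * b * (f' (b * x) / sqrt E)) (at x)" for x
    using DERIV_chain2[OF d(1) lin, of x] sE by (simp add: mult.commute)
  have "((\<lambda>x. f' (b * x)) has_real_derivative (V (b * x) - E) * f (b * x) * b) (at x)" for x
    by (rule DERIV_chain2[OF d(2) lin])
  note d2 = DERIV_cdivide[OF this, where c = "sqrt E"]
  show "((\<lambda>x. f' (b * x) / sqrt E) has_real_derivative sqrt E * b * ((V (b * x) / E - 1) * f (b * x))) (at x)" for x
    using d2[of x]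
  proof (rule DERIV_cong)
    have "(w - r * r) * p * c / r = r * c * ((w / (r * r) - 1) * p)" if "r \<noteq> 0" for w p r c :: real
      using that by (simp add: field_simps)
    from this[of "sqrt E" "V (b * x)" "f (b * x)" b] sE
    show "(V (b * x) - E) * f (b * x) * b / sqrt E = sqrt E * b * ((V (b * x) / E - 1) * f (b * x))" by simp
  qed
  fix x :: real assume "1 \<le> x"
  then have x: "b \<le> b * x" using b_pos by simp
  show "f (b * x) * (f' (b * x) / sqrt E) \<le> 0"
    using product_nonpos[OF es V_ge_right x] sE by (simp add: divide_nonpos_pos)
  have "(V (b * x) - E) * (f (b * x))\<^sup>2 / E \<le> (f' (b * x))\<^sup>2 / E" using energy[OF x] E_pos by (intro divide_right_mono) auto
  moreover have "(f' (b * x) / sqrt E)\<^sup>2 = (f' (b * x))\<^sup>2 / E" using E_pos by (simp add: power_divide)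
  moreover have "(V (b * x) / E - 1) * (f (b * x))\<^sup>2 = (V (b * x) - E) * (f (b * x))\<^sup>2 / E"
    using E_pos by (simp add: field_simps)
  ultimately show "(V (b * x) / E - 1) * (f (b * x))\<^sup>2 \<le> (f' (b * x) / sqrt E)\<^sup>2" by simp
qed

lemma (in normalised_state) normalised_state_reflect:
  "normalised_state (\<lambda>x. V (- x)) (\<lambda>x. - V' (- x)) \<kappa> E b a (\<lambda>x. f (- x)) (\<lambda>x. - f' (- x))"
proof -
  interpret m: well "\<lambda>x. V (- x)" "\<lambda>x. - V' (- x)" \<kappa> E b a by (rule well_reflect)
  have "(\<lambda>x. (f x)\<^sup>2) absolutely_integrable_on UNIV"
    using eigenstateD(3)[OF es] nonnegative_absolutely_integrable_1 by fastforce
  then have "integral UNIV (\<lambda>x. (f (- x))\<^sup>2) = integral UNIV (\<lambda>x. (f x)\<^sup>2)"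
    using has_absolute_integral_reflect_real[of UNIV UNIV "\<lambda>x. (f x)\<^sup>2" "integral UNIV (\<lambda>x. (f x)\<^sup>2)"] by simp
  then show ?thesis using state_reflect norm by unfold_locales simp_all
qed

text \<open>
  The squared bounds, with a constant that depends on the class only. The estimates at the two turning
  points are brought to the scale of \<open>n\<close> by \<open>index_upper\<close> and \<open>index_lower\<close>.
\<close>

theorem eigenstate_bounds:
  assumes kappa: "1 \<le> \<kappa>" and al: "1/4 \<le> \<alpha>" "\<alpha> \<le> 1/2" and eta: "0 < \<eta>" "\<eta> \<le> 1/2" and L: "0 < \<Lambda>"
  shows "\<exists>C>0. \<forall>V V' E a b f f' n x. normalised_state V V' \<kappa> E a b f f' \<longrightarrow>
     regular_slope \<alpha> \<eta> \<Lambda> V V' \<longrightarrow> regular_slope \<alpha> \<eta> \<Lambda> (\<lambda>x. V (- x)) (\<lambda>x. - V' (- x)) \<longrightarrow>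
     nth_eigenvalue V n E \<longrightarrow> 1 \<le> n \<longrightarrow>
     (f x)\<^sup>2 \<le> C / (a + b) * real n powr (4 * \<alpha> / 3) \<and>
     \<bar>1 - V x / E\<bar> powr (2 * \<alpha>) * (f x)\<^sup>2 \<le> C / (a + b) \<and>
     (f' x)\<^sup>2 \<le> C * E / (a + b) * max (real n powr ((4 * \<alpha> - 2) / 3)) (max 0 (1 - V x / E) powr (1 - 2 * \<alpha>))"
proof -
  define \<mu> where "\<mu> = \<kappa> powr \<kappa>"
  have mu: "1 \<le> \<mu>" using kappa by (simp add: \<mu>_def ge_one_powr_ge_zero)
  define N where "N = 1 + 8 * 2 powr \<kappa>"
  have N: "0 < N" by (simp add: N_def add_pos_pos)
  \<comment> \<open>These constants arrange \<open>c1 * n \<le> sqrt E * b \<le> C2 * n\<close>, and the same for \<open>a\<close> in place of \<open>b\<close>.\<close>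
  define c1 where "c1 = 1 / (N * (1 + \<mu>))"
  define C2 where "C2 = \<mu> * (10 * 2 powr \<kappa>)"
  define c0 where "c0 = 2 powr (- \<kappa>) / \<kappa>"
  define Cm where "Cm = 4 * 2 powr \<kappa> * (1 + \<mu>)"
  have pos: "0 < c1" "0 < c0" "0 < Cm" using N mu kappa by (auto simp: c1_def c0_def Cm_def)
  obtain C where C: "C > 0" and bounds: "\<And>W W' \<Psi> P lam \<nu> m x. turning_point W W' \<Psi> P lam c0 \<Longrightarrow> almost_monotone_slope \<alpha> \<eta> \<Lambda> W' \<Longrightarrow>
     0 < \<nu> \<Longrightarrow> \<nu> \<le> 1 \<Longrightarrow> c1 \<le> lam * \<nu> powr (3/2) \<Longrightarrow> lam * \<nu> powr (3/2) \<le> C2 \<Longrightarrow>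
     (\<Psi> 0)\<^sup>2 + (P 0)\<^sup>2 \<le> m \<Longrightarrow> 0 \<le> x \<Longrightarrow>
     (\<Psi> x)\<^sup>2 \<le> C * m * \<nu> powr (- 2 * \<alpha>) \<and>
        \<bar>1 - W x\<bar> powr (2 * \<alpha>) * (\<Psi> x)\<^sup>2 \<le> C * m \<and>
        (P x)\<^sup>2 \<le> C * m * max (\<nu> powr (1 - 2 * \<alpha>)) (max 0 (1 - W x) powr (1 - 2 * \<alpha>))"
    using turning_point_bounds[OF al eta L pos(2,1), of C2] by metis
  have half: "(f x)\<^sup>2 \<le> C * Cm / (a + b) * real n powr (4 * \<alpha> / 3) \<and>
     \<bar>1 - V x / E\<bar> powr (2 * \<alpha>) * (f x)\<^sup>2 \<le> C * Cm / (a + b) \<and>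
     (f' x)\<^sup>2 \<le> C * Cm * E / (a + b) * max (real n powr ((4 * \<alpha> - 2) / 3)) (max 0 (1 - V x / E) powr (1 - 2 * \<alpha>))"
    if "normalised_state V V' \<kappa> E a b f f'" and slope: "regular_slope \<alpha> \<eta> \<Lambda> V V'"
      and lo: "c1 * real n \<le> sqrt E * b" and up: "sqrt E * b \<le> C2 * real n" and ba: "a + b \<le> (1 + \<mu>) * b"
      and n: "1 \<le> n" and x: "0 \<le> x" for V V' E a b f f' n x
  proof -
    interpret normalised_state V V' \<kappa> E a b f f' by fact
    define \<nu> where "\<nu> = real n powr (- (2/3))"
    have n0: "0 < real n" using n by simp
    have nu: "0 < \<nu>" "\<nu> \<le> 1" using n powr_mono[of "- (2/3)" 0 "real n"] by (simp_all add: \<nu>_def)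
    have "\<nu> powr (3/2) = real n powr (- 1)" unfolding \<nu>_def powr_powr by simp
    then have nu32: "\<nu> powr (3/2) = 1 / real n" using n0 by (simp add: powr_minus_divide)
    have nua: "\<nu> powr (- 2 * \<alpha>) = real n powr (4 * \<alpha> / 3)" "\<nu> powr (1 - 2 * \<alpha>) = real n powr ((4 * \<alpha> - 2) / 3)"
      unfolding \<nu>_def powr_powr by (rule arg_cong[where f = "\<lambda>t. real n powr t"], simp add: field_simps)+
    have ab: "0 < a + b" using a_pos b_pos by simp
    have m: "(f (b * 0))\<^sup>2 + (f' (b * 0) / sqrt E)\<^sup>2 \<le> Cm / (a + b)"
    proof -
      have "1 / b \<le> (1 + \<mu>) / (a + b)" using ba b_pos ab by (simp add: field_simps)
      then have "4 * 2 powr \<kappa> * (1 / b) \<le> 4 * 2 powr \<kappa> * ((1 + \<mu>) / (a + b))" by (intro mult_left_mono) auto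
      then show ?thesis using initial_amplitude E_pos by (simp add: Cm_def power_divide)
    qed
    have tp: "turning_point (\<lambda>x. V (b * x) / E) (\<lambda>x. b * V' (b * x) / E) (\<lambda>x. f (b * x)) (\<lambda>x. f' (b * x) / sqrt E) (sqrt E * b) c0"
      unfolding c0_def by (rule well_turning_point[OF es energy_function_nonneg])
    have sl: "almost_monotone_slope \<alpha> \<eta> \<Lambda> (\<lambda>x. b * V' (b * x) / E)"
      using slope b_pos V_b unfolding regular_slope_def by auto
    have "c1 \<le> sqrt E * b * \<nu> powr (3/2)" "sqrt E * b * \<nu> powr (3/2) \<le> C2"
      using lo up n0 unfolding nu32 by (simp_all add: field_simps)
    note b0 = bounds[OF tp sl nu this m, of "x / b"]
    have bx: "b * (x / b) = x" using b_pos by simp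
    have "0 \<le> x / b" using x b_pos by simp
    from b0[OF this] have B: "(f x)\<^sup>2 \<le> C * (Cm / (a + b)) * real n powr (4 * \<alpha> / 3)"
      "\<bar>1 - V x / E\<bar> powr (2 * \<alpha>) * (f x)\<^sup>2 \<le> C * (Cm / (a + b))"
      "(f' x / sqrt E)\<^sup>2 \<le> C * (Cm / (a + b)) * max (real n powr ((4 * \<alpha> - 2) / 3)) (max 0 (1 - V x / E) powr (1 - 2 * \<alpha>))"
      unfolding bx nua by blast+
    define mx where "mx = max (real n powr ((4 * \<alpha> - 2) / 3)) (max 0 (1 - V x / E) powr (1 - 2 * \<alpha>))"
    have "(f' x)\<^sup>2 = E * (f' x / sqrt E)\<^sup>2" using E_pos by (simp add: power_divide)
    also have "\<dots> \<le> E * (C * (Cm / (a + b)) * mx)" using B(3) E_pos unfolding mx_def by (intro mult_left_mono) auto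
    finally have "(f' x)\<^sup>2 \<le> C * Cm * E / (a + b) * mx" by (simp add: mult_ac)
    then show ?thesis using B(1,2) unfolding mx_def by simp
  qed
  have "(f x)\<^sup>2 \<le> C * Cm / (a + b) * real n powr (4 * \<alpha> / 3) \<and>
     \<bar>1 - V x / E\<bar> powr (2 * \<alpha>) * (f x)\<^sup>2 \<le> C * Cm / (a + b) \<and>
     (f' x)\<^sup>2 \<le> C * Cm * E / (a + b) * max (real n powr ((4 * \<alpha> - 2) / 3)) (max 0 (1 - V x / E) powr (1 - 2 * \<alpha>))"
    if ns: "normalised_state V V' \<kappa> E a b f f'" and slope: "regular_slope \<alpha> \<eta> \<Lambda> V V'"
      "regular_slope \<alpha> \<eta> \<Lambda> (\<lambda>x. V (- x)) (\<lambda>x. - V' (- x))"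
      and n: "nth_eigenvalue V n E" "1 \<le> n" for V V' E a b f f' n x
  proof -
    interpret normalised_state V V' \<kappa> E a b f f' by fact
    interpret m: normalised_state "\<lambda>x. V (- x)" "\<lambda>x. - V' (- x)" \<kappa> E b a "\<lambda>x. f (- x)" "\<lambda>x. - f' (- x)"
      by (rule normalised_state_reflect)
    have ba: "b \<le> \<mu> * a" "a \<le> \<mu> * b" using b_le_a m.b_le_a by (simp_all add: \<mu>_def)
    have sE: "0 \<le> sqrt E" using E_pos by simp
    have Nn: "real n \<le> N * (sqrt E * (a + b))" using index_upper[OF n(1)] by (simp add: N_def)
    have lower: "c1 * real n \<le> sqrt E * c" if "a + b \<le> (1 + \<mu>) * c" for c
    proof -
      have "c1 * real n \<le> c1 * (N * (sqrt E * (a + b)))" using Nn pos by (intro mult_left_mono) auto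
      also have "\<dots> = (sqrt E * (a + b)) / (1 + \<mu>)" using N by (simp add: c1_def)
      also have "\<dots> \<le> sqrt E * ((1 + \<mu>) * c) / (1 + \<mu>)"
        using that sE mu by (intro divide_right_mono mult_left_mono) auto
      also have "\<dots> = sqrt E * c" using mu by simp
      finally show ?thesis .
    qed
    have up: "sqrt E * b \<le> 10 * 2 powr \<kappa> * real n" by (rule index_lower[OF n])
    have upb: "sqrt E * b \<le> C2 * real n"
    proof -
      have "1 * (10 * 2 powr \<kappa> * real n) \<le> \<mu> * (10 * 2 powr \<kappa> * real n)" using mu by (intro mult_right_mono) auto
      moreover have "\<mu> * (10 * 2 powr \<kappa> * real n) = C2 * real n" by (simp add: C2_def)
      ultimately show ?thesis using up by linarith
    qed
    have upa: "sqrt E * a \<le> C2 * real n"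
    proof -
      have "sqrt E * a \<le> sqrt E * (\<mu> * b)" using ba sE by (intro mult_left_mono) auto
      also have "\<dots> = \<mu> * (sqrt E * b)" by simp
      also have "\<dots> \<le> \<mu> * (10 * 2 powr \<kappa> * real n)" using up mu by (intro mult_left_mono) auto
      finally show ?thesis by (simp add: C2_def mult.assoc)
    qed
    show ?thesis
    proof (cases "0 \<le> x")
      case True
      have "a + b \<le> (1 + \<mu>) * b" using ba by (simp add: distrib_right)
      from half[OF ns slope(1) lower[OF this] upb this n(2) True] show ?thesis .
    next
      case False
      then have x: "0 \<le> - x" by simp
      have le: "a + b \<le> (1 + \<mu>) * a" "b + a \<le> (1 + \<mu>) * a" using ba by (simp_all add: distrib_right)
      from half[OF m.normalised_state_axioms slope(2) lower[OF le(1)] upa le(2) n(2) x]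
      show ?thesis by (simp add: add.commute)
    qed
  qed
  moreover have "0 < C * Cm" using C pos by simp
  ultimately show ?thesis by blast
qed

section \<open>The slope condition for the classes of potentials\<close>

context power_like
begin

lemma rescaled_slope:
  assumes b: "0 < b" and x: "1/2 \<le> x" "x \<le> 1"
  shows "0 \<le> b * V' (b * x) / V b" and "x * (b * V' (b * x) / V b) \<le> \<kappa>"
proof -
  have bx: "0 < b * x" "b * x \<le> b" using b x by (simp_all add: mult_left_le)
  have Vb: "0 < V b" by (rule V_pos_right[OF b])
  show "0 \<le> b * V' (b * x) / V b" using V'_pos[OF bx(1)] b Vb by simp
  have "b * x * V' (b * x) \<le> \<kappa> * V (b * x)" using growth(2)[of "b * x"] bx by (metis less_irrefl)
  also have "\<dots> \<le> \<kappa> * V b" using V_mono[of "b * x" b] bx kappa by (intro mult_left_mono) auto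
  finally show "x * (b * V' (b * x) / V b) \<le> \<kappa>" using Vb by (simp add: field_simps)
qed

text \<open>
  For \<open>\<alpha> = 1/2\<close> the admissible error is the whole slope, so \<open>p = q = 0\<close> will do.
\<close>

lemma regular_slope_half: "regular_slope (1/2) (1/2) 1 V V'"
  unfolding regular_slope_def
proof (intro allI impI)
  fix b :: real assume b: "0 < b"
  define W' where "W' x = b * V' (b * x) / V b" for x
  have "almost_monotone_slope (1/2) (1/2) 1 W'"
    by (rule almost_monotone_slopeI[of _ "\<lambda>_. 0" "\<lambda>_. 0"])
       (use rescaled_slope(1)[OF b, folded W'_def] in auto)
  then show "almost_monotone_slope (1/2) (1/2) 1 (\<lambda>x. b * V' (b * x) / V b)" unfolding W'_def .
qed

lemma regular_slope_monotone:
  assumes mono: "\<And>x y. 0 < x \<Longrightarrow> x \<le> y \<Longrightarrow> V' x \<le> V' y"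
  shows "regular_slope (1/4) (1/2) \<kappa> V V'"
  unfolding regular_slope_def
proof (intro allI impI)
  fix b :: real assume b: "0 < b"
  define W' where "W' x = b * V' (b * x) / V b" for x
  have "W' x \<le> W' y" if "1/2 \<le> x" "x \<le> y" for x y
    unfolding W'_def using that b V_pos_right[OF b]
    by (intro divide_right_mono mult_left_mono mono) auto
  then have "almost_monotone_slope (1/4) (1/2) \<kappa> W'"
    using rescaled_slope[OF b, folded W'_def] rescaled_slope(2)[OF b, of 1]
    by (intro almost_monotone_slopeI[of _ W' "\<lambda>_. 0"]) (auto simp: W'_def)
  then show "almost_monotone_slope (1/4) (1/2) \<kappa> (\<lambda>x. b * V' (b * x) / V b)" unfolding W'_def .
qed

text \<open>
  The bound on the second derivative makes \<open>W' x + 4 * \<kappa> * x\<close> nondecreasing on \<open>{1/2..1}\<close>, so the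
  slope differs from a nondecreasing function by a linear one.
\<close>

lemma regular_slope_C2:
  assumes d2: "\<And>x. 0 < x \<Longrightarrow> (V' has_real_derivative V2 x) (at x)"
    and le: "\<And>x. 0 < x \<Longrightarrow> \<bar>x\<^sup>2 * V2 x\<bar> \<le> \<kappa> * V x"
  shows "regular_slope (1/4) (1/2) (9 * \<kappa>) V V'"
  unfolding regular_slope_def
proof (intro allI impI)
  fix b :: real assume b: "0 < b"
  have Vb: "0 < V b" by (rule V_pos_right[OF b])
  define W' where "W' x = b * V' (b * x) / V b" for x
  have W'': "(W' has_real_derivative b * (V2 (b * x) * b) / V b) (at x)" if "0 < x" for x
  proof -
    have "((\<lambda>x. V' (b * x)) has_real_derivative V2 (b * x) * b) (at x)"
      using that b by (intro DERIV_chain2[OF d2 DERIV_cmult_Id]) simp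
    from DERIV_cdivide[OF DERIV_cmult[OF this, of b], where c = "V b"] show ?thesis unfolding W'_def .
  qed
  have bound: "\<bar>b * (V2 (b * x) * b) / V b\<bar> \<le> 4 * \<kappa>" if x: "1/2 \<le> x" "x \<le> 1" for x
  proof -
    have bx: "0 < b * x" "b * x \<le> b" using b x by (simp_all add: mult_left_le)
    have "x\<^sup>2 * \<bar>b * (V2 (b * x) * b)\<bar> = \<bar>(b * x)\<^sup>2 * V2 (b * x)\<bar>"
      using b x by (simp add: abs_mult power2_eq_square mult_ac)
    also have "\<dots> \<le> \<kappa> * V (b * x)" by (rule le[OF bx(1)])
    also have "\<dots> \<le> \<kappa> * V b" using V_mono[of "b * x" b] bx kappa by (intro mult_left_mono) auto
    finally have "x\<^sup>2 * \<bar>b * (V2 (b * x) * b)\<bar> \<le> \<kappa> * V b" .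
    moreover have "(1/2)\<^sup>2 * \<bar>b * (V2 (b * x) * b)\<bar> \<le> x\<^sup>2 * \<bar>b * (V2 (b * x) * b)\<bar>"
      using x by (intro mult_right_mono power_mono) auto
    ultimately have "\<bar>b * (V2 (b * x) * b)\<bar> \<le> 4 * \<kappa> * V b" by (simp add: power2_eq_square)
    then show ?thesis using Vb by (simp add: field_simps)
  qed
  have mono: "W' x + 4 * \<kappa> * x \<le> W' y + 4 * \<kappa> * y" if "1/2 \<le> x" "x \<le> y" "y \<le> 1" for x y
  proof (rule DERIV_nonneg_imp_nondecreasing[OF that(2)])
    fix z assume z: "x \<le> z" "z \<le> y"
    have "0 \<le> b * (V2 (b * z) * b) / V b + 4 * \<kappa>" using bound[of z] z that unfolding abs_le_iff by linarith
    moreover have "((\<lambda>x. W' x + 4 * \<kappa> * x) has_real_derivative b * (V2 (b * z) * b) / V b + 4 * \<kappa>) (at z)"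
      using z that by (intro DERIV_add W'' DERIV_cmult_Id) auto
    ultimately show "\<exists>d. ((\<lambda>x. W' x + 4 * \<kappa> * x) has_real_derivative d) (at z) \<and> 0 \<le> d" by blast
  qed
  have mono2: "4 * \<kappa> * x \<le> 4 * \<kappa> * y" if "x \<le> y" for x y
    using that kappa by (intro mult_left_mono) auto
  have pos: "0 \<le> W' x" "0 \<le> 4 * \<kappa> * x" if "1/2 \<le> x" "x \<le> 1" for x
    using rescaled_slope(1)[OF b that] that kappa by (simp_all add: W'_def)
  have "W' 1 \<le> \<kappa>" using rescaled_slope(2)[OF b, of 1] by (simp add: W'_def)
  then have one: "(W' 1 + 4 * \<kappa> * 1) + 4 * \<kappa> * 1 \<le> 9 * \<kappa>" by linarith
  have "almost_monotone_slope (1/4) (1/2) (9 * \<kappa>) W'"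
    by (rule almost_monotone_slopeI[of _ "\<lambda>x. W' x + 4 * \<kappa> * x" "\<lambda>x. 4 * \<kappa> * x"])
       (use mono mono2 pos one in \<open>auto intro!: add_nonneg_nonneg\<close>)
  then show "almost_monotone_slope (1/4) (1/2) (9 * \<kappa>) (\<lambda>x. b * V' (b * x) / V b)" unfolding W'_def .
qed

text \<open>
  In the window the slope stays within the factor \<open>4 * \<alpha>\<close> of its value at the turning point, so
  \<open>p\<close> can be taken constant.
\<close>

lemma regular_slope_slowly_varying:
  assumes al: "1/4 < \<alpha>" and eta: "0 < \<eta>" "\<eta> \<le> 1/2"
    and slow: "\<And>b x. 0 < b \<Longrightarrow> 1 - \<eta> \<le> x \<Longrightarrow> x \<le> 1 \<Longrightarrow> \<bar>ln (V' (b * x) / V' b)\<bar> \<le> ln (4 * \<alpha>)"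
  shows "regular_slope \<alpha> \<eta> \<kappa> V V'"
  unfolding regular_slope_def
proof (intro allI impI)
  fix b :: real assume b: "0 < b"
  define w where "w = b * V' (b * 1) / V b"
  have w: "0 \<le> w" "w \<le> \<kappa>" using rescaled_slope[OF b, of 1] by (simp_all add: w_def)
  have "\<bar>b * V' (b * x) / V b - w\<bar> \<le> (4 * \<alpha> - 1) * (b * V' (b * x) / V b)" if x: "1 - \<eta> \<le> x" "x \<le> 1" for x
  proof -
    define v where "v = b * V' (b * x) / V b"
    have Vp: "0 < V b" "0 < V' b" "0 < V' (b * x)" using b x eta V_pos_right V'_pos by simp_all
    define r where "r = V' (b * x) / V' b"
    have r: "0 < r" "v = r * w" using Vp by (simp_all add: r_def v_def w_def)
    have "ln r \<le> ln (4 * \<alpha>)" "ln (1 / r) \<le> ln (4 * \<alpha>)"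
      using slow[OF b x] r(1) by (simp_all add: r_def[symmetric] ln_div abs_le_iff)
    then have r2: "r \<le> 4 * \<alpha>" "1 / r \<le> 4 * \<alpha>" using r(1) al by simp_all
    have up: "w \<le> 4 * \<alpha> * v"
    proof -
      have "w = 1 / r * v" using r by simp
      also have "\<dots> \<le> 4 * \<alpha> * v" using r2(2) r w(1) by (intro mult_right_mono) auto
      finally show ?thesis .
    qed
    have "(4 * \<alpha> - 1) * v - (v - w) = w * ((4 * \<alpha> - 2) * r + 1)" using r(2) by (simp add: algebra_simps)
    moreover have "0 \<le> (4 * \<alpha> - 2) * r + 1"
    proof (cases "2 \<le> 4 * \<alpha>")
      case True
      then show ?thesis using r(1) by simp
    next
      case False
      have "(2 - 4 * \<alpha>) * r \<le> (2 - 4 * \<alpha>) * (4 * \<alpha>)" using False r2(1) by (intro mult_left_mono) auto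
      also have "\<dots> \<le> 1" using zero_le_power2[of "4 * \<alpha> - 1"] by (simp add: power2_eq_square algebra_simps)
      finally show ?thesis by (simp add: algebra_simps)
    qed
    ultimately have "v - w \<le> (4 * \<alpha> - 1) * v" using w(1) mult_nonneg_nonneg[OF w(1)] by (metis diff_ge_0_iff_ge)
    moreover have "w - v \<le> (4 * \<alpha> - 1) * v" using up by (simp add: algebra_simps)
    ultimately show ?thesis unfolding v_def[symmetric] by (simp add: abs_le_iff)
  qed
  then show "almost_monotone_slope \<alpha> \<eta> \<kappa> (\<lambda>x. b * V' (b * x) / V b)"
    using w by (intro almost_monotone_slopeI[of _ "\<lambda>_. w" "\<lambda>_. 0"]) auto
qed

end

text \<open>
  The points \<open>b * x\<close> and \<open>b\<close> are at logarithmic distance \<open>\<bar>ln x\<bar>\<close>, whatever \<open>b\<close>, so the modulus of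
  continuity determines the width of the window.
\<close>

lemma P1_uc_slowly_varying:
  assumes om: "modulus_of_continuity \<omega>" and e: "0 < \<epsilon>"
  shows "\<exists>\<eta>. 0 < \<eta> \<and> \<eta> \<le> 1/2 \<and>
    (\<forall>V\<in>P1_uc \<kappa> \<omega>. \<forall>\<sigma>\<in>{1, -1}. \<forall>b>0. \<forall>x. 1 - \<eta> \<le> x \<longrightarrow> x \<le> 1 \<longrightarrow>
       deriv V (\<sigma> * b) \<noteq> 0 \<longrightarrow> \<bar>ln (deriv V (\<sigma> * (b * x)) / deriv V (\<sigma> * b))\<bar> \<le> \<epsilon>)"
proof -
  have "filterlim ennreal (at 0) (at_right 0)"
    unfolding filterlim_at
  proof
    show "(ennreal \<longlongrightarrow> 0) (at_right 0)"
      using tendsto_ennrealI[OF tendsto_ident_at, of 0 "{0<..}"] by simp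
    show "\<forall>\<^sub>F x in at_right 0. ennreal x \<in> UNIV \<and> ennreal x \<noteq> 0"
      using eventually_at_right_less[of 0] by eventually_elim auto
  qed
  then have "((\<lambda>s. \<omega> (ennreal s)) \<longlongrightarrow> 0) (at_right 0)"
    using om unfolding modulus_of_continuity_def by (rule filterlim_compose[rotated])
  then have "\<forall>\<^sub>F s in at_right 0. \<omega> (ennreal s) < ennreal \<epsilon>"
    using e by (intro order_tendstoD) auto
  then obtain d where d: "0 < d" "\<And>s. 0 < s \<Longrightarrow> s < d \<Longrightarrow> \<omega> (ennreal s) < ennreal \<epsilon>"
    unfolding eventually_at_right_field by auto
  define \<eta> where "\<eta> = min (1/2) (1 - exp (- (d / 2)))"
  show ?thesis
  proof (intro exI[of _ \<eta>] conjI ballI allI impI)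
    show "0 < \<eta>" using d(1) by (simp add: \<eta>_def)
    show "\<eta> \<le> 1/2" unfolding \<eta>_def by (rule min.cobounded1)
    fix V \<sigma> b x
    assume V: "V \<in> P1_uc \<kappa> \<omega>" "\<sigma> \<in> {1, -1::real}" and b: "(0::real) < b" and x: "1 - \<eta> \<le> x" "x \<le> 1"
      and nz: "deriv V (\<sigma> * b) \<noteq> 0"
    show "\<bar>ln (deriv V (\<sigma> * (b * x)) / deriv V (\<sigma> * b))\<bar> \<le> \<epsilon>"
    proof (cases "x = 1")
      case True
      then show ?thesis using e nz by simp
    next
      case False
      have x0: "exp (- (d / 2)) \<le> x" using x by (auto simp: \<eta>_def min_def split: if_splits)
      then have xp: "0 < x" by (rule less_le_trans[rotated]) simp
      have "ln (exp (- (d / 2))) \<le> ln x" using x0 xp by (subst ln_le_cancel_iff) auto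
      moreover have lx: "ln x < 0" using False x xp by simp
      ultimately have s: "0 < \<bar>ln x\<bar>" "\<bar>ln x\<bar> < d" using d(1) by auto
      have "ennreal \<bar>ln (deriv V (\<sigma> * exp (ln (b * x))) / deriv V (\<sigma> * exp (ln b)))\<bar> \<le> \<omega> (ennreal \<bar>ln (b * x) - ln b\<bar>)"
        using V unfolding P1_uc_def by blast
      also have "\<bar>ln (b * x) - ln b\<bar> = \<bar>ln x\<bar>" using b xp by (simp add: ln_mult)
      also have "\<omega> (ennreal \<bar>ln x\<bar>) < ennreal \<epsilon>" by (rule d(2)[OF s])
      finally show ?thesis using b xp by (simp add: ennreal_less_iff)
    qed
  qed
qed

lemma convex_deriv_mono:
  fixes V :: "real \<Rightarrow> real"
  assumes cv: "convex_on UNIV V" and d: "\<And>x. 0 < x \<Longrightarrow> (V has_real_derivative V' x) (at x)"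
    and xy: "0 < x" "x \<le> y"
  shows "V' x \<le> V' y"
proof (cases "x = y")
  case False
  have 1: "V y - V x \<ge> V' x * (y - x)"
    by (rule convex_on_imp_above_tangent[OF cv]) (use d[OF xy(1)] in auto)
  have 2: "V x - V y \<ge> V' y * (x - y)"
    by (rule convex_on_imp_above_tangent[OF cv]) (use d[of y] xy in auto)
  have "V' x * (y - x) \<le> V' y * (y - x)" using 1 2 by (simp add: algebra_simps)
  then show ?thesis using False xy by simp
qed simp

lemma class_regular_slope:
  assumes kappa: "1 \<le> \<kappa>"
    and K: "(\<alpha> = 1/2 \<and> K = P1 \<kappa>) \<or>
         (1/4 < \<alpha> \<and> \<alpha> < 1/2 \<and> (\<exists>\<omega>. modulus_of_continuity \<omega> \<and> K = P1_uc \<kappa> \<omega>)) \<or>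
         (\<alpha> = 1/4 \<and> K = P1_cv \<kappa>) \<or>
         (\<alpha> = 1/4 \<and> K = P3 \<kappa>)"
  shows "\<exists>\<eta> \<Lambda>. 0 < \<eta> \<and> \<eta> \<le> 1/2 \<and> 0 < \<Lambda> \<and>
    (\<forall>V\<in>K. power_like V (deriv V) \<kappa> \<and> regular_slope \<alpha> \<eta> \<Lambda> V (deriv V) \<and>
       regular_slope \<alpha> \<eta> \<Lambda> (\<lambda>x. V (- x)) (\<lambda>x. - deriv V (- x)))"
proof -
  have witness: ?thesis if "0 < \<eta>" "\<eta> \<le> 1/2" "0 < \<Lambda>"
    and V: "\<And>V. V \<in> K \<Longrightarrow> power_like V (deriv V) \<kappa> \<and> regular_slope \<alpha> \<eta> \<Lambda> V (deriv V) \<and>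
       regular_slope \<alpha> \<eta> \<Lambda> (\<lambda>x. V (- x)) (\<lambda>x. - deriv V (- x))" for \<eta> \<Lambda>
    by (rule exI[of _ \<eta>], rule exI[of _ \<Lambda>]) (use that(1-3) in \<open>intro conjI ballI V[THEN conjunct1] V[THEN conjunct2, THEN conjunct1] V[THEN conjunct2, THEN conjunct2]\<close>)
  have mirror: "power_like (\<lambda>x. V (- x)) (\<lambda>x. - deriv V (- x)) \<kappa>" if "V \<in> P1 \<kappa>" for V
    by (rule power_like.power_like_reflect[OF P1_power_like[OF kappa that]])
  consider "\<alpha> = 1/2" "K = P1 \<kappa>"
    | \<omega> where "1/4 < \<alpha>" "\<alpha> < 1/2" "modulus_of_continuity \<omega>" "K = P1_uc \<kappa> \<omega>"
    | "\<alpha> = 1/4" "K = P1_cv \<kappa>" | "\<alpha> = 1/4" "K = P3 \<kappa>"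
    using K by blast
  then show ?thesis
  proof cases
    case 1
    show ?thesis
    proof (rule witness[of "1/2" 1])
      fix V assume "V \<in> K"
      then have V: "V \<in> P1 \<kappa>" using 1 by simp
      show "power_like V (deriv V) \<kappa> \<and> regular_slope \<alpha> (1/2) 1 V (deriv V) \<and>
       regular_slope \<alpha> (1/2) 1 (\<lambda>x. V (- x)) (\<lambda>x. - deriv V (- x))"
        using P1_power_like[OF kappa V] power_like.regular_slope_half[OF P1_power_like[OF kappa V]]
          power_like.regular_slope_half[OF mirror[OF V]] unfolding 1(1) by blast
    qed auto
  next
    case (2 \<omega>)
    have "0 < ln (4 * \<alpha>)" using 2 by simp
    from P1_uc_slowly_varying[OF 2(3) this, of \<kappa>]
    obtain \<eta> where R: "0 < \<eta> \<and> \<eta> \<le> 1/2 \<and>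
      (\<forall>V\<in>P1_uc \<kappa> \<omega>. \<forall>\<sigma>\<in>{1, -1}. \<forall>b>0. \<forall>x. 1 - \<eta> \<le> x \<longrightarrow> x \<le> 1 \<longrightarrow>
       deriv V (\<sigma> * b) \<noteq> 0 \<longrightarrow> \<bar>ln (deriv V (\<sigma> * (b * x)) / deriv V (\<sigma> * b))\<bar> \<le> ln (4 * \<alpha>))" ..
    then have eta: "0 < \<eta>" "\<eta> \<le> 1/2" by simp_all
    note slow = R[THEN conjunct2, THEN conjunct2, rule_format]
    show ?thesis
    proof (rule witness[of \<eta> \<kappa>])
      fix V assume "V \<in> K"
      then have Vu: "V \<in> P1_uc \<kappa> \<omega>" and V: "V \<in> P1 \<kappa>" using 2 by (auto simp: P1_uc_def)
      interpret power_like V "deriv V" \<kappa> by (rule P1_power_like[OF kappa V])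
      interpret m: power_like "\<lambda>x. V (- x)" "\<lambda>x. - deriv V (- x)" \<kappa> by (rule mirror[OF V])
      have "regular_slope \<alpha> \<eta> \<kappa> V (deriv V)"
      proof (rule regular_slope_slowly_varying[OF 2(1) eta])
        fix b x :: real assume bx: "0 < b" "1 - \<eta> \<le> x" "x \<le> 1"
        show "\<bar>ln (deriv V (b * x) / deriv V b)\<bar> \<le> ln (4 * \<alpha>)"
          using slow[OF Vu, of 1, OF _ bx] V'_pos[OF bx(1)] by simp
      qed
      moreover have "regular_slope \<alpha> \<eta> \<kappa> (\<lambda>x. V (- x)) (\<lambda>x. - deriv V (- x))"
      proof (rule m.regular_slope_slowly_varying[OF 2(1) eta])
        fix b x :: real assume bx: "0 < b" "1 - \<eta> \<le> x" "x \<le> 1"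
        show "\<bar>ln (- deriv V (- (b * x)) / - deriv V (- b))\<bar> \<le> ln (4 * \<alpha>)"
          using slow[OF Vu, of "- 1", OF _ bx] m.V'_pos[OF bx(1)] by simp
      qed
      ultimately show "power_like V (deriv V) \<kappa> \<and> regular_slope \<alpha> \<eta> \<kappa> V (deriv V) \<and>
       regular_slope \<alpha> \<eta> \<kappa> (\<lambda>x. V (- x)) (\<lambda>x. - deriv V (- x))" using power_like_axioms by simp
    qed (use eta kappa in auto)
  next
    case 3
    show ?thesis
    proof (rule witness[of "1/2" \<kappa>])
      fix V assume "V \<in> K"
      then have cv: "convex_on UNIV V" and V: "V \<in> P1 \<kappa>" using 3 by (auto simp: P1_cv_def)
      interpret power_like V "deriv V" \<kappa> by (rule P1_power_like[OF kappa V])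
      interpret m: power_like "\<lambda>x. V (- x)" "\<lambda>x. - deriv V (- x)" \<kappa> by (rule mirror[OF V])
      have cvm: "convex_on UNIV (\<lambda>x. V (- x))"
      proof (rule convex_onI)
        fix t x y :: real assume t: "0 < t" "t < 1"
        have "- ((1 - t) *\<^sub>R x + t *\<^sub>R y) = (1 - t) *\<^sub>R (- x) + t *\<^sub>R (- y)" by simp
        then show "V (- ((1 - t) *\<^sub>R x + t *\<^sub>R y)) \<le> (1 - t) * V (- x) + t * V (- y)"
          using convex_onD[OF cv, of t "- x" "- y"] t by simp
      qed simp
      have "regular_slope (1/4) (1/2) \<kappa> V (deriv V)"
        by (rule regular_slope_monotone, rule convex_deriv_mono[OF cv]) (use V_deriv in auto)
      moreover have "regular_slope (1/4) (1/2) \<kappa> (\<lambda>x. V (- x)) (\<lambda>x. - deriv V (- x))"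
        by (rule m.regular_slope_monotone, rule convex_deriv_mono[OF cvm]) (use m.V_deriv in auto)
      ultimately show "power_like V (deriv V) \<kappa> \<and> regular_slope \<alpha> (1/2) \<kappa> V (deriv V) \<and>
       regular_slope \<alpha> (1/2) \<kappa> (\<lambda>x. V (- x)) (\<lambda>x. - deriv V (- x))" using power_like_axioms unfolding 3(1) by blast
    qed (use kappa in auto)
  next
    case 4
    show ?thesis
    proof (rule witness[of "1/2" "9 * \<kappa>"])
      fix V assume "V \<in> K"
      then have V3: "V \<in> P3 \<kappa>" and V: "V \<in> P1 \<kappa>" using 4 by (auto simp: P3_def)
      interpret power_like V "deriv V" \<kappa> by (rule P1_power_like[OF kappa V])
      interpret m: power_like "\<lambda>x. V (- x)" "\<lambda>x. - deriv V (- x)" \<kappa> by (rule mirror[OF V])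
      define V2 where "V2 = (deriv ^^ 2) V"
      have "\<forall>k<3. (deriv ^^ k) V C1_differentiable_on (- {0})"
        and le3: "\<forall>x l. x \<noteq> 0 \<longrightarrow> l \<in> {2, 3} \<longrightarrow> \<bar>x ^ l * (deriv ^^ l) V x\<bar> \<le> \<kappa> * V x"
        using V3 unfolding P3_def mem_Collect_eq by - (elim conjE, assumption)+
      then have "deriv V C1_differentiable_on (- {0})" by (auto dest!: spec[of _ 1])
      then obtain D where "\<And>x. x \<noteq> 0 \<Longrightarrow> (deriv V has_vector_derivative D x) (at x)"
        unfolding C1_differentiable_on_def by auto
      then have D: "(deriv V has_real_derivative D x) (at x)" if "x \<noteq> 0" for x
        using that by (simp add: has_real_derivative_iff_has_vector_derivative)
      have d2: "(deriv V has_real_derivative V2 x) (at x)" if "x \<noteq> 0" for x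
        using D[OF that] DERIV_imp_deriv[OF D[OF that]] by (simp add: V2_def numeral_2_eq_2)
      have le2: "\<bar>x\<^sup>2 * V2 x\<bar> \<le> \<kappa> * V x" if "x \<noteq> 0" for x
        using le3[rule_format, OF that, of 2] by (simp add: V2_def)
      have "regular_slope (1/4) (1/2) (9 * \<kappa>) V (deriv V)"
        by (rule regular_slope_C2[of V2]) (use d2 le2 in auto)
      moreover have "regular_slope (1/4) (1/2) (9 * \<kappa>) (\<lambda>x. V (- x)) (\<lambda>x. - deriv V (- x))"
      proof (rule m.regular_slope_C2[of "\<lambda>x. V2 (- x)"])
        fix x :: real assume x: "0 < x"
        have "((\<lambda>x. deriv V (- x)) has_real_derivative - V2 (- x)) (at x)"
          using DERIV_mirror[of "deriv V" "V2 (- x)" x] d2[of "- x"] x by simp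
        from DERIV_minus[OF this] show "((\<lambda>x. - deriv V (- x)) has_real_derivative V2 (- x)) (at x)" by simp
        show "\<bar>x\<^sup>2 * V2 (- x)\<bar> \<le> \<kappa> * V (- x)" using le2[of "- x"] x by simp
      qed
      ultimately show "power_like V (deriv V) \<kappa> \<and> regular_slope \<alpha> (1/2) (9 * \<kappa>) V (deriv V) \<and>
       regular_slope \<alpha> (1/2) (9 * \<kappa>) (\<lambda>x. V (- x)) (\<lambda>x. - deriv V (- x))" using power_like_axioms unfolding 4(1) by blast
    qed (use kappa in auto)
  qed
qed

section \<open>The pointwise estimates\<close>

lemma abs_le_of_square_le: "x\<^sup>2 \<le> y\<^sup>2 \<Longrightarrow> 0 \<le> y \<Longrightarrow> \<bar>x\<bar> \<le> y" for x y :: real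
  using abs_le_square_iff[of x y] by simp

lemma powr_square: "(z powr p)\<^sup>2 = z powr (2 * p)" for z p :: real
  by (simp add: power2_eq_square powr_add[symmetric])

theorem theorem3p5:
  fixes \<kappa> \<alpha> :: real and K :: "(real \<Rightarrow> real) set"
  assumes "\<kappa> \<ge> 1"
    and "(\<alpha> = 1/2 \<and> K = P1 \<kappa>) \<or>
         (1/4 < \<alpha> \<and> \<alpha> < 1/2 \<and> (\<exists>\<omega>. modulus_of_continuity \<omega> \<and> K = P1_uc \<kappa> \<omega>)) \<or>
         (\<alpha> = 1/4 \<and> K = P1_cv \<kappa>) \<or>
         (\<alpha> = 1/4 \<and> K = P3 \<kappa>)"
  shows "\<exists>C>0. \<forall>V\<in>K. \<forall>n\<ge>1. \<forall>E \<psi>.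
     nth_eigenvalue V n E \<longrightarrow> eigenfunction V E \<psi> \<longrightarrow> norm_L2 \<psi> = 1 \<longrightarrow>
     (\<forall>x. ereal \<bar>\<psi> x\<bar> \<le> ereal (C * (1 / measure lebesgue {y. V y \<le> E} powr (1/2))) *
              min (ereal (real n powr (2 * \<alpha> / 3))) (epowr \<bar>1 - V x / E\<bar> (- \<alpha>)) \<and>
          \<bar>deriv \<psi> x\<bar> \<le> C * (E powr (1/2) / measure lebesgue {y. V y \<le> E} powr (1/2)) *
              max (real n powr ((2 * \<alpha> - 1) / 3)) ((max 0 (1 - V x / E)) powr (1/2 - \<alpha>)))"
proof -
  have al: "1/4 \<le> \<alpha>" "\<alpha> \<le> 1/2" using assms(2) by auto
  obtain \<eta> where "\<exists>\<Lambda>. 0 < \<eta> \<and> \<eta> \<le> 1/2 \<and> 0 < \<Lambda> \<and>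
    (\<forall>V\<in>K. power_like V (deriv V) \<kappa> \<and> regular_slope \<alpha> \<eta> \<Lambda> V (deriv V) \<and>
       regular_slope \<alpha> \<eta> \<Lambda> (\<lambda>x. V (- x)) (\<lambda>x. - deriv V (- x)))"
    using class_regular_slope[OF assms] ..
  then obtain \<Lambda> where R: "0 < \<eta> \<and> \<eta> \<le> 1/2 \<and> 0 < \<Lambda> \<and>
    (\<forall>V\<in>K. power_like V (deriv V) \<kappa> \<and> regular_slope \<alpha> \<eta> \<Lambda> V (deriv V) \<and>
       regular_slope \<alpha> \<eta> \<Lambda> (\<lambda>x. V (- x)) (\<lambda>x. - deriv V (- x)))" ..
  then have eta: "0 < \<eta>" "\<eta> \<le> 1/2" "0 < \<Lambda>" by simp_all
  note reg = R[THEN conjunct2, THEN conjunct2, THEN conjunct2, rule_format]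
  obtain C where CB: "0 < C \<and> (\<forall>V V' E a b f f' n x. normalised_state V V' \<kappa> E a b f f' \<longrightarrow>
     regular_slope \<alpha> \<eta> \<Lambda> V V' \<longrightarrow> regular_slope \<alpha> \<eta> \<Lambda> (\<lambda>x. V (- x)) (\<lambda>x. - V' (- x)) \<longrightarrow>
     nth_eigenvalue V n E \<longrightarrow> 1 \<le> n \<longrightarrow>
     (f x)\<^sup>2 \<le> C / (a + b) * real n powr (4 * \<alpha> / 3) \<and>
     \<bar>1 - V x / E\<bar> powr (2 * \<alpha>) * (f x)\<^sup>2 \<le> C / (a + b) \<and>
     (f' x)\<^sup>2 \<le> C * E / (a + b) * max (real n powr ((4 * \<alpha> - 2) / 3)) (max 0 (1 - V x / E) powr (1 - 2 * \<alpha>)))"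
    using eigenstate_bounds[OF assms(1) al eta] ..
  note C = CB[THEN conjunct1] and bounds = CB[THEN conjunct2, rule_format]
  define D where "D = sqrt C"
  have D: "0 < D" "D\<^sup>2 = C" using C by (simp_all add: D_def)
  show ?thesis
  proof (intro exI[of _ D] conjI ballI allI impI)
    show "0 < D" by (rule D(1))
    fix V n E \<psi> x
    assume V: "V \<in> K" and n: "1 \<le> n" "nth_eigenvalue V n E" and ef: "eigenfunction V E \<psi>" and nm: "norm_L2 \<psi> = 1"
    interpret power_like V "deriv V" \<kappa> using reg[OF V] by blast
    interpret m: power_like "\<lambda>x. V (- x)" "\<lambda>x. - deriv V (- x)" \<kappa> by (rule power_like_reflect)
    have es: "eigenstate V E \<psi> (deriv \<psi>)" by (rule eigenfunction_imp_eigenstate[OF V_continuous ef])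
    have E: "0 < E" by (rule eigenstate_energy_pos[OF es V_nonneg])
    obtain b where b: "0 < b" "V b = E" by (rule turning_point_exists[OF E])
    obtain a where a: "0 < a" "V (- a) = E" by (rule m.turning_point_exists[OF E])
    interpret normalised_state V "deriv V" \<kappa> E a b \<psi> "deriv \<psi>"
      using E a b es nm norm_L2_eigenstate[OF es] by unfold_locales auto
    have ab: "0 < a + b" using a b by simp
    have B: "(\<psi> x)\<^sup>2 \<le> C / (a + b) * real n powr (4 * \<alpha> / 3)"
      "\<bar>1 - V x / E\<bar> powr (2 * \<alpha>) * (\<psi> x)\<^sup>2 \<le> C / (a + b)"
      "(deriv \<psi> x)\<^sup>2 \<le> C * E / (a + b) * max (real n powr ((4 * \<alpha> - 2) / 3)) (max 0 (1 - V x / E) powr (1 - 2 * \<alpha>))"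
      using bounds[OF normalised_state_axioms _ _ n(2,1), of x] reg[OF V] by simp_all
    define S where "S = D * (1 / (a + b) powr (1/2))"
    have S0: "0 \<le> S" using D by (simp add: S_def)
    have S2: "S\<^sup>2 = C / (a + b)" using D ab by (simp add: S_def power_mult_distrib power_divide powr_square)
    have 1: "\<bar>\<psi> x\<bar> \<le> S * real n powr (2 * \<alpha> / 3)"
      by (rule abs_le_of_square_le) (use B(1) S0 in \<open>simp_all add: power_mult_distrib S2 powr_square\<close>)
    define u where "u = \<bar>1 - V x / E\<bar>"
    have "\<bar>u powr \<alpha> * \<psi> x\<bar> \<le> S"
      by (rule abs_le_of_square_le) (use B(2) S0 in \<open>simp_all add: power_mult_distrib S2 powr_square u_def\<close>)
    then have S': "u powr \<alpha> * \<bar>\<psi> x\<bar> \<le> S" by (simp add: abs_mult)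
    have 2: "\<bar>\<psi> x\<bar> \<le> S * u powr (- \<alpha>)" if "u \<noteq> 0"
    proof -
      have "0 < u" using that by (simp add: u_def)
      then have "u powr \<alpha> * u powr (- \<alpha>) = 1" by (simp flip: powr_add)
      then have "\<bar>\<psi> x\<bar> = (u powr \<alpha> * \<bar>\<psi> x\<bar>) * u powr (- \<alpha>)" by algebra
      also have "\<dots> \<le> S * u powr (- \<alpha>)" using S' by (rule mult_right_mono) simp
      finally show ?thesis .
    qed
    have "ereal \<bar>\<psi> x\<bar> \<le> ereal S * min (ereal (real n powr (2 * \<alpha> / 3))) (epowr u (- \<alpha>))"
    proof (cases "u = 0")
      case True
      then show ?thesis using 1 al by (simp add: epowr_def)
    next
      case False
      then show ?thesis using 1 2[OF False] by (simp add: epowr_def min_def)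
    qed
    then show "ereal \<bar>\<psi> x\<bar> \<le> ereal (D * (1 / measure lebesgue {y. V y \<le> E} powr (1/2))) *
              min (ereal (real n powr (2 * \<alpha> / 3))) (epowr \<bar>1 - V x / E\<bar> (- \<alpha>))"
      unfolding measure_sublevel S_def u_def .
    define p q where "p = real n powr ((2 * \<alpha> - 1) / 3)" and "q = max 0 (1 - V x / E) powr (1/2 - \<alpha>)"
    have pq: "p\<^sup>2 = real n powr ((4 * \<alpha> - 2) / 3)" "q\<^sup>2 = max 0 (1 - V x / E) powr (1 - 2 * \<alpha>)" "0 \<le> p" "0 \<le> q"
      unfolding p_def q_def powr_square by (simp_all add: diff_divide_distrib right_diff_distrib)
    have mx: "(max p q)\<^sup>2 = max (p\<^sup>2) (q\<^sup>2)" using abs_le_square_iff[of p q] pq(3,4) by (simp add: max_def)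
    have E2: "(E powr (1/2))\<^sup>2 = E" "((a + b) powr (1/2))\<^sup>2 = a + b" using E ab by (simp_all add: powr_square)
    have "\<bar>deriv \<psi> x\<bar> \<le> D * (E powr (1/2) / (a + b) powr (1/2)) * max p q"
    proof (rule abs_le_of_square_le)
      show "(deriv \<psi> x)\<^sup>2 \<le> (D * (E powr (1/2) / (a + b) powr (1/2)) * max p q)\<^sup>2"
        unfolding power_mult_distrib power_divide E2 D(2) mx pq(1,2) using B(3) by simp
      show "0 \<le> D * (E powr (1/2) / (a + b) powr (1/2)) * max p q"
        using D pq(3) by (intro mult_nonneg_nonneg) (auto simp: le_max_iff_disj)
    qed
    then show "\<bar>deriv \<psi> x\<bar> \<le> D * (E powr (1/2) / measure lebesgue {y. V y \<le> E} powr (1/2)) *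
              max (real n powr ((2 * \<alpha> - 1) / 3)) ((max 0 (1 - V x / E)) powr (1/2 - \<alpha>))"
      unfolding measure_sublevel p_def q_def .
  qed
qed

end
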